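(* Let $M(U,\tau)$ be a finite Zassenhaus Moufang set such that $U$ is of even order. If there is a special involution in $U$, then $M(U,\tau)\cong M(\mathbb{F}_q)$ and $G^\dagger\cong \mathrm{PSL}_2(q)$ with $q=|U|=2^m$ for some $m\in\mathbb{N}$.
   Context: Permutations act on the right. A Moufang set is a set $X$ with $|X|\ge 3$ together with subgroups $(U_x)_{x\in X}$ of $\mathrm{Sym}(X)$ (root groups) such that each $U_x$ fixes $x$ and acts regularly on $X\setminus\{x\}$, and $U_x^g=U_{xg}$ for all $x\in X$ and $g\in G^\dagger:=\langle U_y\mid y\in X\rangle$ (the little projective group), where $U_x^g=g^{-1}U_xg$. An isomorphism of Moufang sets is a bijection of the underlying sets carrying root groups to root groups. Construction $M(U,\tau)$: let $(U,+)$ be a (not necessarily abelian) group with neutral element $0$, $U^\#=U\setminus\{0\}$, $X=U\cup\{\infty\}$ (disjoint union), and $\tau\in\mathrm{Sym}(X)$ interchanging $0$ and $\infty$. For $a\in U$ let $\alpha_a\in\mathrm{Sym}(X)$ be given by $\infty\alpha_a=\infty$, $b\alpha_a=b+a$; put $U_\infty=\{\alpha_a\mid a\in U\}$ and $U_a=U_\infty^{\tau\alpha_a}$ for $a\in U$. When $(X,(U_x)_{x\in X})$ is a Moufang set it is denoted $M(U,\tau)$. $M(U,\tau)$ is proper if $G^\dagger$ is not sharply $2$-transitive on $X$. It is a Zassenhaus Moufang set if it is proper and the pointwise stabilizer $G^\dagger_{0,\infty,a}$ is trivial for all $a\in U^\#$. An involution in $U$ is an element of order $2$. An element $a\in U^\#$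 is special if $(-a)\tau^{-1}=-(a\tau^{-1})$. $M(\mathbb{F}_q)$ is the Moufang set on the projective line over $\mathbb{F}_q$ whose little projective group is $\mathrm{PSL}_2(q)$ in its natural action, the root group of a point $x$ being the group of unipotent elements of the stabilizer of $x$; equivalently $M(\mathbb{F}_q)=M(U,\tau)$ with $U=(\mathbb{F}_q,+)$ and $x\tau=-x^{-1}$ for $x\ne 0$. *)

theory Defs
  imports "HOL-Algebra.Sym_Groups" "HOL-Algebra.Multiplicative_Group"
begin

text \<open>
  Permutations act on the right: the product \<open>p \<otimes> q\<close> in \<open>Sym X\<close> means "first \<open>p\<close>, then \<open>q\<close>",
  and the image \<open>x p\<close> of the point \<open>x\<close> is written \<open>p x\<close>.
  Permutations of \<open>X\<close> are functions on the whole type that are the identity outside \<open>X\<close>.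
\<close>

definition Sym :: "'x set \<Rightarrow> ('x \<Rightarrow> 'x) monoid"
  where "Sym X = \<lparr>carrier = {p. p permutes X}, mult = (\<lambda>p q. q \<circ> p), one = id\<rparr>"

text \<open>The conjugate \<open>H\<^sup>g = g\<inverse> H g\<close>.\<close>

definition conjugate :: "('g, 'b) monoid_scheme \<Rightarrow> 'g set \<Rightarrow> 'g \<Rightarrow> 'g set"
  where "conjugate G H g = (\<lambda>h. inv\<^bsub>G\<^esub> g \<otimes>\<^bsub>G\<^esub> h \<otimes>\<^bsub>G\<^esub> g) ` H"

definition regular_on :: "('x \<Rightarrow> 'x) set \<Rightarrow> 'x set \<Rightarrow> bool"
  where "regular_on H Y \<longleftrightarrow> (\<forall>y\<in>Y. \<forall>z\<in>Y. \<exists>!h. h \<in> H \<and> h y = z)"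

definition sharply_2_transitive_on :: "('x \<Rightarrow> 'x) set \<Rightarrow> 'x set \<Rightarrow> bool"
  where "sharply_2_transitive_on H X \<longleftrightarrow>
    (\<forall>x\<in>X. \<forall>y\<in>X. \<forall>x'\<in>X. \<forall>y'\<in>X. x \<noteq> y \<and> x' \<noteq> y' \<longrightarrow> (\<exists>!h. h \<in> H \<and> h x = x' \<and> h y = y'))"


subsection \<open>Moufang sets\<close>

definition little_proj :: "'x set \<Rightarrow> ('x \<Rightarrow> ('x \<Rightarrow> 'x) set) \<Rightarrow> ('x \<Rightarrow> 'x) set"
  where "little_proj X R = generate (Sym X) (\<Union>x\<in>X. R x)"

definition little_proj_group :: "'x set \<Rightarrow> ('x \<Rightarrow> ('x \<Rightarrow> 'x) set) \<Rightarrow> ('x \<Rightarrow> 'x) monoid"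
  where "little_proj_group X R = (Sym X)\<lparr>carrier := little_proj X R\<rparr>"

definition moufang_set :: "'x set \<Rightarrow> ('x \<Rightarrow> ('x \<Rightarrow> 'x) set) \<Rightarrow> bool"
  where "moufang_set X R \<longleftrightarrow>
    (infinite X \<or> card X \<ge> 3) \<and>
    (\<forall>x\<in>X. subgroup (R x) (Sym X)) \<and>
    (\<forall>x\<in>X. \<forall>h\<in>R x. h x = x) \<and>
    (\<forall>x\<in>X. regular_on (R x) (X - {x})) \<and>
    (\<forall>x\<in>X. \<forall>g\<in>little_proj X R. conjugate (Sym X) (R x) g = R (g x))"

text \<open>The permutation \<open>\<beta>\<inverse> h \<beta>\<close> of \<open>Y\<close>, extended by the identity outside \<open>Y\<close>.\<close>

definition transport_perm :: "'x set \<Rightarrow> 'y set \<Rightarrow> ('x \<Rightarrow> 'y) \<Rightarrow> ('x \<Rightarrow> 'x) \<Rightarrow> ('y \<Rightarrow> 'y)"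
  where "transport_perm X Y \<beta> h = (\<lambda>y. if y \<in> Y then \<beta> (h (inv_into X \<beta> y)) else y)"

definition moufang_iso ::
    "'x set \<Rightarrow> ('x \<Rightarrow> ('x \<Rightarrow> 'x) set) \<Rightarrow> 'y set \<Rightarrow> ('y \<Rightarrow> ('y \<Rightarrow> 'y) set) \<Rightarrow> ('x \<Rightarrow> 'y) \<Rightarrow> bool"
  where "moufang_iso X R Y S \<beta> \<longleftrightarrow>
    bij_betw \<beta> X Y \<and> (\<forall>x\<in>X. transport_perm X Y \<beta> ` R x = S (\<beta> x))"

definition moufang_isomorphic ::
    "'x set \<Rightarrow> ('x \<Rightarrow> ('x \<Rightarrow> 'x) set) \<Rightarrow> 'y set \<Rightarrow> ('y \<Rightarrow> ('y \<Rightarrow> 'y) set) \<Rightarrow> bool"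
  where "moufang_isomorphic X R Y S \<longleftrightarrow> (\<exists>\<beta>. moufang_iso X R Y S \<beta>)"


subsection \<open>The construction \<open>M(U, \<tau>)\<close>\<close>

text \<open>
  The group \<open>(U, +)\<close>, not necessarily abelian, is written multiplicatively.
  \<open>None\<close> is the point \<open>\<infinity>\<close>, and \<open>Some \<one>\<close> is the point \<open>0\<close>.
\<close>

definition points :: "('a, 'b) monoid_scheme \<Rightarrow> 'a option set"
  where "points U = insert None (Some ` carrier U)"

definition swaps_zero_infinity :: "('a, 'b) monoid_scheme \<Rightarrow> ('a option \<Rightarrow> 'a option) \<Rightarrow> bool"
  where "swaps_zero_infinity U \<tau> \<longleftrightarrow>
    \<tau> \<in> carrier (Sym (points U)) \<and> \<tau> (Some \<one>\<^bsub>U\<^esub>) = None \<and> \<tau> None = Some \<one>\<^bsub>U\<^esub>"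

definition translation :: "('a, 'b) monoid_scheme \<Rightarrow> 'a \<Rightarrow> 'a option \<Rightarrow> 'a option"
  where "translation U a p =
    (case p of None \<Rightarrow> None | Some b \<Rightarrow> Some (if b \<in> carrier U then b \<otimes>\<^bsub>U\<^esub> a else b))"

fun root_group ::
    "('a, 'b) monoid_scheme \<Rightarrow> ('a option \<Rightarrow> 'a option) \<Rightarrow> 'a option \<Rightarrow> ('a option \<Rightarrow> 'a option) set"
  where
    "root_group U \<tau> None = translation U ` carrier U"
  | "root_group U \<tau> (Some a) =
      conjugate (Sym (points U)) (translation U ` carrier U)
        (\<tau> \<otimes>\<^bsub>Sym (points U)\<^esub> translation U a)"

definition moufang_M :: "('a, 'b) monoid_scheme \<Rightarrow> ('a option \<Rightarrow> 'a option) \<Rightarrow> bool"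
  where "moufang_M U \<tau> \<longleftrightarrow> moufang_set (points U) (root_group U \<tau>)"

definition proper_M :: "('a, 'b) monoid_scheme \<Rightarrow> ('a option \<Rightarrow> 'a option) \<Rightarrow> bool"
  where "proper_M U \<tau> \<longleftrightarrow>
    \<not> sharply_2_transitive_on (little_proj (points U) (root_group U \<tau>)) (points U)"

definition zassenhaus_M :: "('a, 'b) monoid_scheme \<Rightarrow> ('a option \<Rightarrow> 'a option) \<Rightarrow> bool"
  where "zassenhaus_M U \<tau> \<longleftrightarrow>
    moufang_M U \<tau> \<and> proper_M U \<tau> \<and>
    (\<forall>a \<in> carrier U - {\<one>\<^bsub>U\<^esub>}.
      {g \<in> little_proj (points U) (root_group U \<tau>).
        g (Some \<one>\<^bsub>U\<^esub>) = Some \<one>\<^bsub>U\<^esub> \<and> g None = None \<and> g (Some a) = Some a} = {id})"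

definition involution :: "('a, 'b) monoid_scheme \<Rightarrow> 'a \<Rightarrow> bool"
  where "involution U a \<longleftrightarrow> a \<in> carrier U \<and> group.ord U a = 2"

text \<open>
  \<open>map_option (m_inv U)\<close> is negation on \<open>U\<close>; its value at \<open>\<infinity>\<close> is irrelevant below, since
  \<open>\<tau>\<inverse>\<close> maps \<open>U\<^sup>#\<close> to itself.
\<close>

definition special :: "('a, 'b) monoid_scheme \<Rightarrow> ('a option \<Rightarrow> 'a option) \<Rightarrow> 'a \<Rightarrow> bool"
  where "special U \<tau> a \<longleftrightarrow>
    a \<in> carrier U - {\<one>\<^bsub>U\<^esub>} \<and>
    (inv\<^bsub>Sym (points U)\<^esub> \<tau>) (Some (inv\<^bsub>U\<^esub> a)) =
      map_option (m_inv U) ((inv\<^bsub>Sym (points U)\<^esub> \<tau>) (Some a))"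


subsection \<open>The projective Moufang set and \<open>PSL\<^sub>2\<close> of a field\<close>

text \<open>\<open>M(F) = M((F, +), \<tau>)\<close> with \<open>x \<tau> = - x\<inverse>\<close> for \<open>x \<noteq> 0\<close>.\<close>

definition field_tau :: "('a, 'b) ring_scheme \<Rightarrow> 'a option \<Rightarrow> 'a option"
  where "field_tau F p =
    (case p of
       None \<Rightarrow> Some \<zero>\<^bsub>F\<^esub>
     | Some x \<Rightarrow>
         if x = \<zero>\<^bsub>F\<^esub> then None
         else if x \<in> carrier F then Some (\<ominus>\<^bsub>F\<^esub> (inv\<^bsub>F\<^esub> x))
         else Some x)"

text \<open>The quadruple \<open>(a, b, c, d)\<close> is the matrix with rows \<open>(a, b)\<close> and \<open>(c, d)\<close>.\<close>

definition SL2 :: "('a, 'b) ring_scheme \<Rightarrow> ('a \<times> 'a \<times> 'a \<times> 'a) monoid"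
  where "SL2 F =
    \<lparr>carrier = {(a, b, c, d). a \<in> carrier F \<and> b \<in> carrier F \<and> c \<in> carrier F \<and> d \<in> carrier F \<and>
        a \<otimes>\<^bsub>F\<^esub> d \<ominus>\<^bsub>F\<^esub> b \<otimes>\<^bsub>F\<^esub> c = \<one>\<^bsub>F\<^esub>},
     mult = (\<lambda>(a, b, c, d) (a', b', c', d').
       (a \<otimes>\<^bsub>F\<^esub> a' \<oplus>\<^bsub>F\<^esub> b \<otimes>\<^bsub>F\<^esub> c', a \<otimes>\<^bsub>F\<^esub> b' \<oplus>\<^bsub>F\<^esub> b \<otimes>\<^bsub>F\<^esub> d',
        c \<otimes>\<^bsub>F\<^esub> a' \<oplus>\<^bsub>F\<^esub> d \<otimes>\<^bsub>F\<^esub> c', c \<otimes>\<^bsub>F\<^esub> b' \<oplus>\<^bsub>F\<^esub> d \<otimes>\<^bsub>F\<^esub> d')),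
     one = (\<one>\<^bsub>F\<^esub>, \<zero>\<^bsub>F\<^esub>, \<zero>\<^bsub>F\<^esub>, \<one>\<^bsub>F\<^esub>)\<rparr>"

definition group_center :: "('g, 'b) monoid_scheme \<Rightarrow> 'g set"
  where "group_center G =
    {z \<in> carrier G. \<forall>g\<in>carrier G. z \<otimes>\<^bsub>G\<^esub> g = g \<otimes>\<^bsub>G\<^esub> z}"

definition PSL2 :: "('a, 'b) ring_scheme \<Rightarrow> ('a \<times> 'a \<times> 'a \<times> 'a) set monoid"
  where "PSL2 F = SL2 F Mod group_center (SL2 F)"

end

theory Submission
  imports Defs "HOL-Algebra.Sylow"
begin

text \<open>
  Write \<open>q = |U|\<close>, let \<open>H\<close> be the stabilizer of \<open>0\<close> and \<open>\<infinity>\<close> in \<open>G\<close>, the little projective group,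
  and \<open>k = |H|\<close>. As the number of points is odd, every involution fixes exactly one point and lies
  in its root group. Counting the involutions that move \<open>\<infinity>\<close> to \<open>0\<close> gives: each root group contains
  exactly \<open>k\<close> involutions, \<open>H\<close> permutes those of \<open>U\<^sub>\<infinity>\<close> regularly, and every element of \<open>G\<close> that
  swaps two points is an involution. So \<open>H\<close> is abelian, and the involutions of a root group \<open>U\<^sub>x\<close>
  form, together with the identity, a central subgroup \<open>V\<^sub>x\<close> of order \<open>k + 1\<close>.

  The special involution shows that \<open>{x} \<union> y V\<^sub>x = {y} \<union> x V\<^sub>y\<close> for all points \<open>x \<noteq> y\<close>; hence these sets
  are the lines, with \<open>k + 2\<close> points each, of a \<open>G\<close>-invariant linear space. Let \<open>g\<close> be fixed point free
  and inverted by some involution. The fixed points of the involutions inverting \<open>g\<close> form a subspace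
  on which the centralizer of \<open>g\<close>, an abelian group, acts regularly. If this subspace were more than
  a line, it would have at least \<open>(k + 1) (k + 2)\<close> points, but letting the centralizer act on a
  conjugate of \<open>g\<close> with the same subspace shows that it has at most \<open>k\<^sup>2\<close>. So at most \<open>k + 2\<close>
  involutions invert \<open>g\<close>, and counting all pairs of involutions by their product gives
  \<open>q \<le> k + 1\<close>. Therefore \<open>U = V\<^sub>\<infinity>\<close> is elementary abelian and \<open>H\<close> is regular on \<open>U\<^sup>#\<close>, which makes \<open>U\<close>
  a field with multiplicative group \<open>H\<close>; the swap of \<open>0\<close> and \<open>\<infinity>\<close> that fixes \<open>1\<close> is inversion.
\<close>

section \<open>Moufang sets with trivial three-point stabilizers\<close>

lemma even_card_involution:
  assumes "finite A" and "\<And>x. x \<in> A \<Longrightarrow> f x \<in> A" and "\<And>x. x \<in> A \<Longrightarrow> f (f x) = x"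
    and "\<And>x. x \<in> A \<Longrightarrow> f x \<noteq> x"
  shows "even (card A)"
  using assms
proof (induction A rule: finite_psubset_induct)
  case (psubset A)
  show ?case
  proof (cases "A = {}")
    case False
    then obtain a where a: "a \<in> A" by blast
    let ?B = "A - {a, f a}"
    have 2: "{a, f a} \<subseteq> A" "card {a, f a} = 2"
      using a psubset.prems(1) psubset.prems(3)[OF a] by (auto simp: eq_commute)
    have B: "f x \<in> ?B" if "x \<in> ?B" for x
      using that a psubset.prems by (metis Diff_iff insert_iff singletonD)
    have "even (card ?B)"
      by (rule psubset.IH) (use a B psubset.prems in auto)
    moreover have "card ?B = card A - 2"
      using 2 psubset.hyps by (metis card_Diff_subset finite_subset)
    moreover have "card A \<ge> 2"
      using 2 psubset.hyps by (metis card_mono)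
    ultimately show ?thesis by simp
  qed simp
qed

text \<open>The group operation comes from the type class \<open>group_add\<close>, and
  \<open>G\<close> and all \<open>R x\<close> are subsets of that type. \<open>odd_X\<close> encodes
  the even order of U, as X has one point more than U.\<close>

locale moufang_action =
  fixes act :: "'a \<Rightarrow> 'b::group_add \<Rightarrow> 'a" (infixl "\<bullet>" 70)
    and X :: "'a set" and G :: "'b set" and R :: "'a \<Rightarrow> 'b set"
  assumes act_0 [simp]: "x \<bullet> 0 = x"
    and act_add [simp]: "x \<bullet> (g + h) = x \<bullet> g \<bullet> h"
    and finite_X: "finite X" and odd_X: "odd (card X)" and card_X: "card X \<ge> 3"
    and finite_G: "finite G"
    and act_closed: "\<lbrakk>x \<in> X; g \<in> G\<rbrakk> \<Longrightarrow> x \<bullet> g \<in> X"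
    and G_0: "0 \<in> G" and G_add: "\<lbrakk>g \<in> G; h \<in> G\<rbrakk> \<Longrightarrow> g + h \<in> G" and G_minus: "g \<in> G \<Longrightarrow> - g \<in> G"
    and R_G: "\<lbrakk>x \<in> X; u \<in> R x\<rbrakk> \<Longrightarrow> u \<in> G"
    and R_0: "x \<in> X \<Longrightarrow> 0 \<in> R x"
    and R_add: "\<lbrakk>x \<in> X; u \<in> R x; v \<in> R x\<rbrakk> \<Longrightarrow> u + v \<in> R x"
    and R_minus: "\<lbrakk>x \<in> X; u \<in> R x\<rbrakk> \<Longrightarrow> - u \<in> R x"
    and R_fix: "\<lbrakk>x \<in> X; u \<in> R x\<rbrakk> \<Longrightarrow> x \<bullet> u = x"
    and R_regular: "\<lbrakk>x \<in> X; y \<in> X - {x}; z \<in> X - {x}\<rbrakk> \<Longrightarrow> \<exists>!u. u \<in> R x \<and> y \<bullet> u = z"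
    and R_conj: "\<lbrakk>x \<in> X; g \<in> G; u \<in> R x\<rbrakk> \<Longrightarrow> - g + u + g \<in> R (x \<bullet> g)"
begin

lemma act_cancel [simp]: "x \<bullet> g \<bullet> (- g) = x" "x \<bullet> (- g) \<bullet> g = x"
  by (metis act_0 act_add left_minus right_minus)+

lemma act_inj [simp]: "x \<bullet> g = y \<bullet> g \<longleftrightarrow> x = y"
  by (metis act_cancel(1))

lemma act_diff [simp]: "x \<bullet> (g - h) = x \<bullet> g \<bullet> (- h)"
  by (simp only: diff_conv_add_uminus act_add)

lemma fixed_minus [simp]: "x \<bullet> g = x \<Longrightarrow> x \<bullet> (- g) = x"
  by (metis act_cancel(1))

lemma G_conj: "\<lbrakk>g \<in> G; h \<in> G\<rbrakk> \<Longrightarrow> - g + h + g \<in> G"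
  by (simp add: G_add G_minus)

lemma G_diff: "\<lbrakk>g \<in> G; h \<in> G\<rbrakk> \<Longrightarrow> g - h \<in> G"
  using G_add G_minus by (metis diff_conv_add_uminus)

lemma R_diff: "\<lbrakk>x \<in> X; u \<in> R x; v \<in> R x\<rbrakk> \<Longrightarrow> u - v \<in> R x"
  using R_add R_minus by (metis diff_conv_add_uminus)

lemma R_unique:
  assumes "x \<in> X" "u \<in> R x" "v \<in> R x" "y \<in> X" "y \<noteq> x" "y \<bullet> u = y \<bullet> v"
  shows "u = v"
proof -
  have "y \<bullet> u \<in> X - {x}"
    using assms by (metis Diff_iff R_G R_fix act_closed act_inj singletonD)
  then show ?thesis using R_regular[of x y "y \<bullet> u"] assms by auto
qed

lemma R_free: "\<lbrakk>x \<in> X; u \<in> R x; y \<in> X; y \<noteq> x; y \<bullet> u = y\<rbrakk> \<Longrightarrow> u = 0"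
  using R_unique[of x u 0 y] R_0 by simp

lemma R_obtain:
  assumes "x \<in> X" "y \<in> X" "z \<in> X" "y \<noteq> x" "z \<noteq> x"
  obtains u where "u \<in> R x" "y \<bullet> u = z"
  using R_regular[of x y z] assms by blast

lemma stab_moves:
  "\<lbrakk>g \<in> G; x \<bullet> g = x; y \<in> X; y \<noteq> x\<rbrakk> \<Longrightarrow> y \<bullet> g \<in> X \<and> y \<bullet> g \<noteq> x"
  using act_closed act_inj by metis

lemma third_point: obtains z where "z \<in> X" "z \<noteq> x" "z \<noteq> y"
proof -
  have "\<not> X \<subseteq> {x, y}"
  proof
    assume "X \<subseteq> {x, y}"
    then have "card X \<le> card {x, y}" by (intro card_mono) auto
    also have "\<dots> \<le> 2" by (simp add: card_insert_if)
    finally show False using card_X by simp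
  qed
  then show ?thesis using that by blast
qed

text \<open>The root group of a point other than \<open>x\<close> and \<open>x'\<close> moves
  \<open>x\<close> to \<open>x'\<close>; the second point is then corrected inside
  \<open>R x'\<close>, which fixes \<open>x'\<close>.\<close>

lemma two_transitive:
  assumes "x \<in> X" "y \<in> X" "x' \<in> X" "y' \<in> X" "x \<noteq> y" "x' \<noteq> y'"
  obtains g where "g \<in> G" "x \<bullet> g = x'" "y \<bullet> g = y'"
proof -
  obtain z where z: "z \<in> X" "z \<noteq> x" "z \<noteq> x'" by (rule third_point)
  obtain u where u: "u \<in> R z" "x \<bullet> u = x'" by (rule R_obtain[of z x x']) (use z assms in auto)
  have "u \<in> G" using R_G u z by blast
  have *: "y \<bullet> u \<noteq> x'" using u assms by auto
  obtain v where v: "v \<in> R x'" "y \<bullet> u \<bullet> v = y'"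
    by (rule R_obtain[of x' "y \<bullet> u" y']) (use * \<open>u \<in> G\<close> assms act_closed in auto)
  have "v \<in> G" using R_G v assms by blast
  show ?thesis
    by (rule that[of "u + v"]) (use u v \<open>u \<in> G\<close> \<open>v \<in> G\<close> R_fix assms G_add in auto)
qed

definition stab2 :: "'a \<Rightarrow> 'a \<Rightarrow> 'b set"
  where "stab2 x y = {g \<in> G. x \<bullet> g = x \<and> y \<bullet> g = y}"

lemma stab2_conj:
  assumes "g \<in> G" "h \<in> stab2 x y"
  shows "- g + h + g \<in> stab2 (x \<bullet> g) (y \<bullet> g)"
  using assms G_conj by (simp add: stab2_def)

end

locale zassenhaus_action = moufang_action +
  assumes three_fixed: "\<lbrakk>g \<in> G; x \<in> X; y \<in> X; z \<in> X; x \<noteq> y; x \<noteq> z; y \<noteq> z;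
      x \<bullet> g = x; y \<bullet> g = y; z \<bullet> g = z\<rbrakk> \<Longrightarrow> g = 0"
begin

text \<open>A coset \<open>h + R x\<close> with \<open>h\<close> fixing a second point consists of \<open>R x\<close>-conjugates of \<open>h\<close>,
  because \<open>h\<close> commutes with no nontrivial element of \<open>R x\<close>.\<close>

lemma fixes_second_point:
  assumes "g \<in> G" "x \<in> X" "x \<bullet> g = x" "g \<notin> R x"
  obtains y where "y \<in> X" "y \<noteq> x" "y \<bullet> g = y"
proof -
  obtain y where y: "y \<in> X" "y \<noteq> x" using third_point by blast
  have yg: "y \<bullet> g \<in> X" "y \<bullet> g \<noteq> x" using stab_moves assms y by auto
  obtain u where u: "u \<in> R x" "y \<bullet> u = y \<bullet> g"
    by (rule R_obtain[of x y "y \<bullet> g"]) (use y yg assms in auto)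
  define h where "h = g - u"
  have uG: "u \<in> G" using R_G u assms by blast
  have h: "h \<in> G" "x \<bullet> h = x" "y \<bullet> h = y"
    using u uG assms G_diff R_fix by (auto simp: h_def) (metis act_cancel(1))
  have "h \<noteq> 0" using u assms by (auto simp: h_def)
  \<comment> \<open>Since \<open>h\<close> normalizes \<open>R x\<close>, this commutator map sends
    \<open>R x\<close> to itself. A coincidence of values would yield a nontrivial element of
    \<open>R x\<close> commuting with \<open>h\<close>, which carries \<open>y\<close> to a third
    fixed point of \<open>h\<close>. So \<open>f\<close> is bijective and attains
    \<open>g - h\<close>.\<close>
  define f where "f w = - w + h + w - h" for w
  have fin: "finite (R x)" using finite_G R_G assms by (meson finite_subset subsetI)
  have "f ` R x \<subseteq> R x"
  proof
    fix v assume "v \<in> f ` R x"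
    then obtain w where w: "w \<in> R x" "v = f w" by auto
    have "- (- h) + w + (- h) \<in> R (x \<bullet> (- h))"
      using R_conj[of x "- h" w] w h assms G_minus by blast
    then have "h + w - h \<in> R x" using h by simp
    then have "- w + (h + w - h) \<in> R x" using w assms R_add R_minus by blast
    then show "v \<in> R x" using w by (simp add: f_def add.assoc diff_conv_add_uminus del: add_uminus_conv_diff)
  qed
  moreover have "inj_on f (R x)"
  proof (rule inj_onI)
    fix v w assume vw: "v \<in> R x" "w \<in> R x" "f v = f w"
    define d where "d = w - v"
    have "- v + h + v = - w + h + w" using vw(3) unfolding f_def by (metis diff_add_cancel)
    then have "w + (- v + h + v) - v = w + (- w + h + w) - v" by simp
    then have dh: "d + h = h + d"
      by (simp add: d_def add.assoc diff_conv_add_uminus del: add_uminus_conv_diff)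
    have d: "d \<in> R x" using vw assms R_diff d_def by blast
    then have dG: "d \<in> G" using R_G assms by blast
    have "y \<bullet> d \<bullet> h = y \<bullet> d" using dh h by (metis act_add)
    moreover have "y \<bullet> d \<in> X" "y \<bullet> d \<noteq> x"
      using stab_moves[of d x y] y d dG assms R_fix by auto
    ultimately have "y \<bullet> d = y"
      using three_fixed[of h x y "y \<bullet> d"] h y assms \<open>h \<noteq> 0\<close> by metis
    then have "d = 0" using R_free d y assms by blast
    then show "v = w" by (simp add: d_def)
  qed
  ultimately have "f ` R x = R x" using fin by (simp add: endo_inj_surj)
  moreover have "h + u - h \<in> R x"
    using R_conj[of x "- h" u] u h assms G_minus by simp
  ultimately obtain w where w: "w \<in> R x" "h + u - h = f w" by (metis imageE)
  have "g = - w + h + w"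
  proof -
    have "g - h = f w" using w by (simp add: h_def)
    then show ?thesis unfolding f_def by (metis diff_add_cancel)
  qed
  then have "y \<bullet> w \<bullet> g = y \<bullet> w" using h by simp
  moreover have "y \<bullet> w \<in> X" "y \<bullet> w \<noteq> x"
    using stab_moves[of w x y] y w assms R_fix R_G by auto
  ultimately show ?thesis using that by blast
qed

lemma unique_fixed:
  assumes "x \<in> X" "u \<in> R x" "u \<noteq> 0" "y \<in> X" "y \<bullet> u = y"
  shows "y = x"
  using assms R_free by blast

text \<open>\<open>g\<close> must preserve the only fixed point \<open>x\<close> of
  \<open>u\<close>. Outside \<open>R x\<close> it would fix a second point \<open>y\<close>, and by
  commutation also the image of \<open>y\<close> under \<open>u\<close>: three fixed points.\<close>

lemma commutes_in_root_group:
  assumes "x \<in> X" "u \<in> R x" "u \<noteq> 0" "g \<in> G" "g + u = u + g"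
  shows "g \<in> R x"
proof (rule ccontr)
  assume g: "g \<notin> R x"
  have "x \<bullet> g \<bullet> u = x \<bullet> g" using assms R_fix by (metis act_add)
  then have xg: "x \<bullet> g = x" using unique_fixed assms act_closed by blast
  obtain y where y: "y \<in> X" "y \<noteq> x" "y \<bullet> g = y"
    using fixes_second_point[OF assms(4,1) xg g] .
  have uG: "u \<in> G" using R_G assms by blast
  have "y \<bullet> u \<bullet> g = y \<bullet> u" using y assms by (metis act_add)
  moreover have "y \<bullet> u \<in> X" "y \<bullet> u \<noteq> x" "y \<bullet> u \<noteq> y"
    using stab_moves[of u x y] y assms uG R_fix unique_fixed[of x u y] by auto
  ultimately have "g = 0" using three_fixed[of g x y "y \<bullet> u"] xg y assms by metis
  then show False using g R_0 assms by blast
qed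

section \<open>Involutions and their fixed points\<close>

definition invols :: "'b set"
  where "invols = {t \<in> G. t \<noteq> 0 \<and> t + t = 0}"

definition invols_at :: "'a \<Rightarrow> 'b set"
  where "invols_at x = {t \<in> R x. t \<noteq> 0 \<and> t + t = 0}"

lemma invol_minus: "t + t = 0 \<Longrightarrow> - t = t" for t :: 'b
  by (simp add: add_eq_0_iff)

lemma invol_act: "t + t = 0 \<Longrightarrow> x \<bullet> t \<bullet> t = x"
  by (metis act_0 act_add)

lemma invol_act_iff: "t + t = 0 \<Longrightarrow> x \<bullet> t = y \<longleftrightarrow> y \<bullet> t = x"
  using invol_act by blast

lemma conj_eq_0_iff: "- g + t + g = 0 \<longleftrightarrow> t = 0" for g t :: 'b
proof
  assume "- g + t + g = 0"
  then have "g + (- g + t + g) - g = g + 0 - g" by simp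
  then show "t = 0" by (simp add: add.assoc)
qed simp

lemma conj_invol: "t + t = 0 \<Longrightarrow> (- g + t + g) + (- g + t + g) = 0" for g t :: 'b
proof -
  assume t: "t + t = 0"
  have "(- g + t + g) + (- g + t + g) = - g + (t + t) + g" by (simp add: add.assoc)
  then show ?thesis using t by simp
qed

lemma invol_conj: "t \<in> invols \<Longrightarrow> g \<in> G \<Longrightarrow> - g + t + g \<in> invols"
  unfolding invols_def using G_conj conj_eq_0_iff conj_invol by simp

lemma invols_at_conj:
  assumes "x \<in> X" "t \<in> invols_at x" "g \<in> G"
  shows "- g + t + g \<in> invols_at (x \<bullet> g)"
  using assms R_conj invol_conj[of t g] R_G by (auto simp: invols_at_def invols_def)

lemma invol_fixed:
  assumes "t \<in> invols"
  obtains x where "x \<in> X" "x \<bullet> t = x"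
proof -
  have t: "t \<in> G" "t + t = 0" using assms by (auto simp: invols_def)
  have "\<exists>x\<in>X. x \<bullet> t = x"
  proof (rule ccontr)
    assume "\<not> ?thesis"
    then have "even (card X)"
      using t act_closed invol_act by (intro even_card_involution[OF finite_X, of "\<lambda>x. x \<bullet> t"]) auto
    then show False using odd_X by simp
  qed
  then show ?thesis using that by blast
qed

text \<open>With two fixed points there is no third, so the involution would pair off the remaining
  points, whose number is odd.\<close>

lemma invol_fixed_unique:
  assumes "t \<in> invols" "x \<in> X" "y \<in> X" "x \<bullet> t = x" "y \<bullet> t = y"
  shows "x = y"
proof (rule ccontr)
  assume "x \<noteq> y"
  have t: "t \<in> G" "t + t = 0" "t \<noteq> 0" using assms by (auto simp: invols_def)
  let ?A = "X - {x, y}"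
  have "even (card ?A)"
  proof (rule even_card_involution[of _ "\<lambda>z. z \<bullet> t"])
    fix z assume z: "z \<in> ?A"
    then show "z \<bullet> t \<bullet> t = z" using t invol_act by blast
    show "z \<bullet> t \<noteq> z" using three_fixed[of t x y z] z t assms \<open>x \<noteq> y\<close> by auto
    show "z \<bullet> t \<in> ?A" using z t assms act_closed[of z t] by (metis Diff_iff act_inj insert_iff singletonD)
  qed (use finite_X in auto)
  moreover have "card ?A = card X - 2"
    using \<open>x \<noteq> y\<close> assms finite_X by (simp add: card_Diff_subset)
  ultimately show False using odd_X card_X by simp
qed

text \<open>An element fixing \<open>x\<close> but outside \<open>R x\<close> has a second fixed
  point, which an involution lacks.\<close>

lemma invol_at:
  assumes "t \<in> invols" "x \<in> X" "x \<bullet> t = x"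
  shows "t \<in> invols_at x"
proof (rule ccontr)
  assume "t \<notin> invols_at x"
  then have "t \<notin> R x" "t \<in> G" using assms by (auto simp: invols_at_def invols_def)
  then obtain y where "y \<in> X" "y \<noteq> x" "y \<bullet> t = y"
    using fixes_second_point[of t x] assms by blast
  then show False using invol_fixed_unique assms by blast
qed

lemma invols_at_invols: "x \<in> X \<Longrightarrow> t \<in> invols_at x \<Longrightarrow> t \<in> invols"
  using R_G by (auto simp: invols_at_def invols_def)

lemma invols_at_fix: "x \<in> X \<Longrightarrow> t \<in> invols_at x \<Longrightarrow> x \<bullet> t = x"
  using R_fix by (auto simp: invols_at_def)

lemma invols_Union: "invols = (\<Union>x\<in>X. invols_at x)"
proof (rule Set.set_eqI, rule iffI)
  fix t assume t: "t \<in> invols"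
  then obtain x where "x \<in> X" "x \<bullet> t = x" by (rule invol_fixed)
  then show "t \<in> (\<Union>x\<in>X. invols_at x)" using invol_at[OF t] by auto
qed (use invols_at_invols in auto)

lemma invols_at_disjoint:
  "\<lbrakk>x \<in> X; y \<in> X; x \<noteq> y\<rbrakk> \<Longrightarrow> invols_at x \<inter> invols_at y = {}"
  using invol_fixed_unique[of _ x y] invols_at_invols invols_at_fix by (metis disjoint_iff)

lemma finite_invols: "finite invols" "x \<in> X \<Longrightarrow> finite (invols_at x)" "finite (stab2 x y)"
  using finite_G R_G by (auto simp: invols_def invols_at_def stab2_def intro: finite_subset[of _ G])

lemma card_invols_at:
  assumes "x \<in> X" "y \<in> X"
  shows "card (invols_at x) = card (invols_at y)"
proof -
  have le: "card (invols_at x) \<le> card (invols_at y)" if xy: "x \<in> X" "y \<in> X" for x y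
  proof (cases "x = y")
    case False
    obtain g where g: "g \<in> G" "x \<bullet> g = y"
      using two_transitive[of x y y x] False \<open>x \<in> X\<close> \<open>y \<in> X\<close> by metis
    show ?thesis
    proof (rule card_inj_on_le)
      show "inj_on (\<lambda>t. - g + t + g) (invols_at x)" by (rule inj_onI) simp
      show "(\<lambda>t. - g + t + g) ` invols_at x \<subseteq> invols_at y"
        using invols_at_conj[of x _ g] g xy by auto
    qed (use xy finite_invols in auto)
  qed simp
  then show ?thesis using assms by (meson le_antisym)
qed

lemma card_stab2:
  assumes "x \<in> X" "y \<in> X" "x' \<in> X" "y' \<in> X" "x \<noteq> y" "x' \<noteq> y'"
  shows "card (stab2 x y) = card (stab2 x' y')"
proof -
  have le: "card (stab2 x y) \<le> card (stab2 x' y')"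
    if xy: "x \<in> X" "y \<in> X" "x' \<in> X" "y' \<in> X" "x \<noteq> y" "x' \<noteq> y'" for x y x' y'
  proof -
    obtain g where g: "g \<in> G" "x \<bullet> g = x'" "y \<bullet> g = y'"
      by (rule two_transitive[of x y x' y']) (use xy in auto)
    show ?thesis
    proof (rule card_inj_on_le)
      show "inj_on (\<lambda>t. - g + t + g) (stab2 x y)" by (rule inj_onI) simp
      show "(\<lambda>t. - g + t + g) ` stab2 x y \<subseteq> stab2 x' y'"
        using stab2_conj[OF g(1)] g by blast
    qed (use finite_invols in auto)
  qed
  then show ?thesis using assms by (meson le_antisym)
qed

end

section \<open>Involutions and lines\<close>

locale zassenhaus_even = zassenhaus_action +
  assumes invols_nonempty: "invols \<noteq> {}"
begin

lemma invols_at_nonempty: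
  assumes "x \<in> X"
  shows "invols_at x \<noteq> {}"
proof -
  obtain y where y: "y \<in> X" "invols_at y \<noteq> {}"
    using invols_nonempty invols_Union by auto
  then have "card (invols_at y) \<noteq> 0" using finite_invols by simp
  then have "card (invols_at x) \<noteq> 0" using card_invols_at assms y by metis
  then show ?thesis by auto
qed

text \<open>Double count of the involutions moving \<open>x\<close>: sorted by the image of
  \<open>x\<close>, and sorted by their fixed point. Both sortings have one class per point other
  than \<open>x\<close>, and within each sorting the classes are conjugate, hence equally
  large.\<close>

lemma card_invols_moving:
  assumes "x \<in> X" "y \<in> X" "x \<noteq> y"
  shows "card {t \<in> invols. x \<bullet> t = y} = card (invols_at x)"
proof -
  define J where "J z = {t \<in> invols. x \<bullet> t = z}" for z
  let ?Y = "X - {x}"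
  have finY: "finite ?Y" using finite_X by simp
  have finJ: "finite (J z)" for z using finite_invols by (simp add: J_def)
  have le: "card (J z) \<le> card (J z')" if z: "z \<in> ?Y" "z' \<in> ?Y" for z z'
  proof -
    obtain u where u: "u \<in> R x" "z \<bullet> u = z'"
      using R_obtain[of x z z'] assms z by blast
    have "x \<bullet> (- u) = x" using u R_fix assms by simp
    have "u \<in> G" using u R_G assms by blast
    show ?thesis
    proof (rule card_inj_on_le)
      show "inj_on (\<lambda>t. - u + t + u) (J z)" by (rule inj_onI) simp
      show "(\<lambda>t. - u + t + u) ` J z \<subseteq> J z'"
        using invol_conj \<open>u \<in> G\<close> \<open>x \<bullet> (- u) = x\<close> u by (auto simp: J_def)
    qed (rule finJ)
  qed
  have eqJ: "card (J z) = card (J y)" if "z \<in> ?Y" for z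
    using le[of z y] le[of y z] that assms by simp
  have "(\<Union>z\<in>?Y. J z) = (\<Union>z\<in>?Y. invols_at z)"
  proof (rule Set.set_eqI, rule iffI)
    fix t assume "t \<in> (\<Union>z\<in>?Y. J z)"
    then have t: "t \<in> invols" "x \<bullet> t \<noteq> x" by (auto simp: J_def)
    obtain z where z: "z \<in> X" "z \<bullet> t = z" using t(1) by (rule invol_fixed)
    with t have "z \<in> ?Y" by auto
    then show "t \<in> (\<Union>z\<in>?Y. invols_at z)" using invol_at[OF t(1)] z by blast
  next
    fix t assume "t \<in> (\<Union>z\<in>?Y. invols_at z)"
    then obtain z where z: "z \<in> X" "z \<noteq> x" "t \<in> invols_at z" by auto
    then have t: "t \<in> invols" "z \<bullet> t = z" using invols_at_invols invols_at_fix by auto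
    then have "x \<bullet> t \<noteq> x" using invol_fixed_unique assms z by blast
    moreover have "x \<bullet> t \<in> X" using t act_closed assms by (auto simp: invols_def)
    ultimately show "t \<in> (\<Union>z\<in>?Y. J z)" using t by (auto simp: J_def)
  qed
  moreover have "card (\<Union>z\<in>?Y. J z) = (\<Sum>z\<in>?Y. card (J z))"
    using finY finJ by (intro card_UN_disjoint) (auto simp: J_def)
  moreover have "card (\<Union>z\<in>?Y. invols_at z) = (\<Sum>z\<in>?Y. card (invols_at z))"
    using finY finite_invols invols_at_disjoint by (intro card_UN_disjoint) auto
  moreover have "(\<Sum>z\<in>?Y. card (J z)) = card ?Y * card (J y)"
    using eqJ by simp
  moreover have "(\<Sum>z\<in>?Y. card (invols_at z)) = card ?Y * card (invols_at x)"
  proof -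
    have "(\<Sum>z\<in>?Y. card (invols_at z)) = (\<Sum>z\<in>?Y. card (invols_at x))"
      by (intro sum.cong refl card_invols_at) (use assms in auto)
    then show ?thesis by simp
  qed
  moreover have "card ?Y \<noteq> 0" using assms finite_X card_X by simp
  ultimately show ?thesis by (simp add: J_def)
qed

definition swaps :: "'a \<Rightarrow> 'a \<Rightarrow> 'b set"
  where "swaps x y = {g \<in> G. x \<bullet> g = y \<and> y \<bullet> g = x}"

lemma swaps_obtain:
  assumes "x \<in> X" "y \<in> X" "x \<noteq> y"
  obtains g where "g \<in> swaps x y"
  using two_transitive[of x y y x] assms unfolding swaps_def by blast

lemma card_swaps_le:
  assumes "x \<in> X" "y \<in> X" "x \<noteq> y"
  shows "card (swaps x y) \<le> card (stab2 x y)"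
proof -
  obtain g where g: "g \<in> swaps x y" using swaps_obtain assms by blast
  show ?thesis
  proof (rule card_inj_on_le)
    show "inj_on (\<lambda>h. h + g) (swaps x y)" by (rule inj_onI) simp
    show "(\<lambda>h. h + g) ` swaps x y \<subseteq> stab2 x y"
      using g G_add by (auto simp: swaps_def stab2_def)
  qed (rule finite_invols)
qed

text \<open>If two elements conjugate \<open>t\<close> alike, their quotient commutes with
  \<open>t\<close> and so lies in \<open>R x\<close>; as it also fixes \<open>y\<close>, it is
  trivial.\<close>

lemma inj_on_conj_stab2:
  assumes "x \<in> X" "y \<in> X" "x \<noteq> y" "t \<in> invols_at x"
  shows "inj_on (\<lambda>h. - h + t + h) (stab2 x y)"
proof (rule inj_onI)
  fix h h' assume h: "h \<in> stab2 x y" "h' \<in> stab2 x y" "- h + t + h = - h' + t + h'"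
  define d where "d = h' - h"
  have "h' + (- h + t + h) - h = h' + (- h' + t + h') - h" using h(3) by simp
  then have "d + t = t + d"
    by (simp add: d_def add.assoc diff_conv_add_uminus del: add_uminus_conv_diff)
  moreover have "d \<in> G" "y \<bullet> d = y"
    using h G_diff by (auto simp: d_def stab2_def)
  moreover have "t \<in> R x" "t \<noteq> 0" using assms by (auto simp: invols_at_def)
  ultimately have "d \<in> R x" using commutes_in_root_group assms by blast
  then have "d = 0" using R_free \<open>y \<bullet> d = y\<close> assms by blast
  then show "h = h'" by (simp add: d_def)
qed

lemma stab2_conj_invols_at:
  assumes "x \<in> X" "t \<in> invols_at x"
  shows "(\<lambda>h. - h + t + h) ` stab2 x y \<subseteq> invols_at x"
proof (rule image_subsetI)
  fix h assume "h \<in> stab2 x y"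
  then have "h \<in> G" "x \<bullet> h = x" by (auto simp: stab2_def)
  then show "- h + t + h \<in> invols_at x" using invols_at_conj[of x t h] assms by simp
qed

lemma moving_invols_subset_swaps: "{t \<in> invols. x \<bullet> t = y} \<subseteq> swaps x y"
  by (auto simp: swaps_def invols_def invol_act)

text \<open>A circle of inequalities: the stabilizer is at most as large as the set of involutions
  at \<open>x\<close>, which has the size of the set of involutions taking \<open>x\<close> to
  \<open>y\<close>; these are swaps, and the swaps are at most as many as the stabilizer elements.
  Equality throughout makes every swap an involution.\<close>

lemma card_invols_at_swaps_stab2:
  assumes "x \<in> X" "y \<in> X" "x \<noteq> y"
  shows "card (invols_at x) = card (stab2 x y)" "card (swaps x y) = card (stab2 x y)"
    "{t \<in> invols. x \<bullet> t = y} = swaps x y"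
proof -
  obtain t where t: "t \<in> invols_at x" using invols_at_nonempty assms by blast
  have fin: "finite (swaps x y)" using finite_G by (auto simp: swaps_def)
  have 1: "card (stab2 x y) \<le> card (invols_at x)"
    using card_inj_on_le[OF inj_on_conj_stab2 stab2_conj_invols_at] finite_invols assms t by blast
  have 2: "card (invols_at x) \<le> card (swaps x y)"
    using card_mono[OF fin moving_invols_subset_swaps] card_invols_moving assms by simp
  have 3: "card (swaps x y) \<le> card (stab2 x y)" using card_swaps_le assms by blast
  show "card (invols_at x) = card (stab2 x y)" "card (swaps x y) = card (stab2 x y)"
    using 1 2 3 by auto
  show "{t \<in> invols. x \<bullet> t = y} = swaps x y"
    using card_subset_eq[OF fin moving_invols_subset_swaps] card_invols_moving assms 1 2 3 by simp
qed

lemma swap_invol: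
  assumes "g \<in> G" "x \<in> X" "x \<noteq> x \<bullet> g" "x \<bullet> g \<bullet> g = x"
  shows "g \<in> invols"
proof -
  have "g \<in> swaps x (x \<bullet> g)" using assms by (auto simp: swaps_def)
  then show ?thesis using card_invols_at_swaps_stab2(3)[of x "x \<bullet> g"] assms act_closed by blast
qed

lemma invols_at_conjugate:
  assumes "x \<in> X" "y \<in> X" "x \<noteq> y" "t \<in> invols_at x" "t' \<in> invols_at x"
  obtains h where "h \<in> stab2 x y" "t' = - h + t + h"
proof -
  have "card ((\<lambda>h. - h + t + h) ` stab2 x y) = card (invols_at x)"
    using card_image[OF inj_on_conj_stab2[OF assms(1-4)]] card_invols_at_swaps_stab2(1)[OF assms(1-3)]
    by simp
  then have "(\<lambda>h. - h + t + h) ` stab2 x y = invols_at x"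
    using card_subset_eq[OF finite_invols(2)[OF assms(1)] stab2_conj_invols_at[OF assms(1,4)]] by simp
  then show ?thesis using that assms by auto
qed

text \<open>A swap times an element of the two-point stabilizer is again a swap, hence an
  involution; expanding its square gives the inversion.\<close>

lemma swap_inverts:
  assumes "x \<in> X" "y \<in> X" "x \<noteq> y" "g \<in> swaps x y" "h \<in> stab2 x y"
  shows "g + h + g = - h" "g + g = 0"
proof -
  have "g + h \<in> swaps x y" using assms G_add by (auto simp: swaps_def stab2_def)
  then have "(g + h) + (g + h) = 0"
    using card_invols_at_swaps_stab2(3)[of x y] assms by (auto simp: invols_def)
  then show "g + h + g = - h" by (metis add.assoc eq_neg_iff_add_eq_0)
  show "g + g = 0" using card_invols_at_swaps_stab2(3)[of x y] assms by (auto simp: invols_def)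
qed

text \<open>Conjugation by a swap is an automorphism of the stabilizer and inverts every element,
  which forces commutativity.\<close>

lemma stab2_commute:
  assumes "x \<in> X" "y \<in> X" "x \<noteq> y" "h \<in> stab2 x y" "h' \<in> stab2 x y"
  shows "h + h' = h' + h"
proof -
  obtain g where g: "g \<in> swaps x y" using swaps_obtain assms by blast
  have hh: "h + h' \<in> stab2 x y" using assms G_add by (auto simp: stab2_def)
  have gg: "g + (g + w) = w" for w using swap_inverts(2)[of x y g h] g assms by (metis add.assoc add_0)
  have "- (h + h') = g + (h + h') + g" using swap_inverts(1) g hh assms by metis
  also have "\<dots> = (g + h + g) + (g + h' + g)" by (simp add: add.assoc gg)
  also have "\<dots> = - h + - h'" using swap_inverts(1) g assms by metis
  also have "\<dots> = - (h' + h)" by (simp add: minus_add del: add_uminus_conv_diff)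
  finally show ?thesis by simp
qed

text \<open>The conjugate of \<open>t\<close> by \<open>u\<close> is also its conjugate by some
  \<open>h\<close> fixing \<open>x\<close> and \<open>y\<close>. Then \<open>u - h\<close> commutes
  with \<open>t\<close> and lies in \<open>R x\<close>, so \<open>h\<close> does too; fixing
  \<open>y\<close>, it is trivial.\<close>

lemma invols_at_central:
  assumes "x \<in> X" "t \<in> invols_at x" "u \<in> R x"
  shows "t + u = u + t"
proof -
  obtain y where y: "y \<in> X" "y \<noteq> x" using third_point by blast
  have uG: "u \<in> G" using assms R_G by blast
  have "- u + t + u \<in> invols_at x" using invols_at_conj[of x t u] assms uG R_fix by simp
  then obtain h where h: "h \<in> stab2 x y" "- u + t + u = - h + t + h"
    using invols_at_conjugate[of x y t] assms y by metis
  define d where "d = u - h"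
  have "u + (- u + t + u) - h = u + (- h + t + h) - h" using h(2) by simp
  then have "d + t = t + d"
    by (simp add: d_def add.assoc diff_conv_add_uminus del: add_uminus_conv_diff)
  moreover have hG: "h \<in> G" "y \<bullet> h = y" using h by (auto simp: stab2_def)
  moreover have "d \<in> G" using G_diff uG hG by (simp add: d_def)
  moreover have "t \<in> R x" "t \<noteq> 0" using assms by (auto simp: invols_at_def)
  ultimately have "d \<in> R x" using commutes_in_root_group assms by blast
  then have "- d + u \<in> R x" using R_add R_minus assms by blast
  moreover have "- d + u = h" by (simp add: d_def minus_diff_eq)
  ultimately have "h = 0" using R_free hG y assms by metis
  then show ?thesis using h(2) by (metis add.assoc add_minus_cancel minus_zero add_0 add.right_neutral)
qed

section \<open>The central subgroups \<open>V x\<close> and the lines\<close>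

definition V :: "'a \<Rightarrow> 'b set"
  where "V x = {u \<in> R x. u + u = 0}"

lemma V_eq: "x \<in> X \<Longrightarrow> V x = insert 0 (invols_at x)"
  using R_0 by (auto simp: V_def invols_at_def)

lemma V_R: "u \<in> V x \<Longrightarrow> u \<in> R x"
  by (simp add: V_def)

lemma V_double: "u \<in> V x \<Longrightarrow> u + u = 0"
  by (simp add: V_def)

lemma V_G: "x \<in> X \<Longrightarrow> u \<in> V x \<Longrightarrow> u \<in> G"
  using R_G by (simp add: V_def)

lemma V_0: "x \<in> X \<Longrightarrow> 0 \<in> V x"
  using R_0 by (simp add: V_def)

lemma V_central: "\<lbrakk>x \<in> X; t \<in> V x; u \<in> R x\<rbrakk> \<Longrightarrow> t + u = u + t"
  using invols_at_central V_eq by fastforce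

lemma V_add:
  assumes "x \<in> X" "u \<in> V x" "v \<in> V x"
  shows "u + v \<in> V x"
proof -
  have "u + v + (u + v) = u + (v + u) + v" by (simp add: add.assoc)
  also have "\<dots> = u + (u + v) + v" using V_central V_R assms by metis
  also have "\<dots> = (u + u) + (v + v)" by (simp add: add.assoc)
  finally show ?thesis using assms R_add by (simp add: V_def)
qed

lemma V_conj: "\<lbrakk>x \<in> X; g \<in> G; u \<in> V x\<rbrakk> \<Longrightarrow> - g + u + g \<in> V (x \<bullet> g)"
  using R_conj conj_invol by (auto simp: V_def)

lemma card_V: "\<lbrakk>x \<in> X; y \<in> X; x \<noteq> y\<rbrakk> \<Longrightarrow> card (V x) = Suc (card (stab2 x y))"
  using V_eq finite_invols card_invols_at_swaps_stab2(1) by (simp add: invols_at_def)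

text \<open>The two points play different roles: \<open>y\<close> runs through its orbit under
  \<open>V x\<close>, and \<open>x\<close> is added. Symmetry is a theorem, \<open>line_sym\<close>,
  and depends on the special involution.\<close>

definition line :: "'a \<Rightarrow> 'a \<Rightarrow> 'a set"
  where "line x y = insert x ((\<lambda>v. y \<bullet> v) ` V x)"

lemma line_act:
  assumes "x \<in> X" "y \<in> X" "g \<in> G"
  shows "line (x \<bullet> g) (y \<bullet> g) = (\<lambda>z. z \<bullet> g) ` line x y"
proof -
  have *: "(\<lambda>z. z \<bullet> h) ` line a b \<subseteq> line (a \<bullet> h) (b \<bullet> h)" if "a \<in> X" "b \<in> X" "h \<in> G" for a b h
  proof -
    have "b \<bullet> v \<bullet> h \<in> (\<lambda>v. b \<bullet> h \<bullet> v) ` V (a \<bullet> h)" if "v \<in> V a" for v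
      using V_conj[of a h v] that \<open>a \<in> X\<close> \<open>h \<in> G\<close>
      by (intro image_eqI[of _ _ "- h + v + h"]) auto
    then show ?thesis by (auto simp: line_def)
  qed
  have "(\<lambda>z. z \<bullet> (- g)) ` line (x \<bullet> g) (y \<bullet> g) \<subseteq> line x y"
    using *[of "x \<bullet> g" "y \<bullet> g" "- g"] act_closed assms G_minus by simp
  then have "(\<lambda>z. z \<bullet> g) ` (\<lambda>z. z \<bullet> (- g)) ` line (x \<bullet> g) (y \<bullet> g) \<subseteq> (\<lambda>z. z \<bullet> g) ` line x y"
    by (rule image_mono)
  then have "line (x \<bullet> g) (y \<bullet> g) \<subseteq> (\<lambda>z. z \<bullet> g) ` line x y" by (simp add: image_image)
  then show ?thesis using *[of x y g] assms by auto
qed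

lemma line_X: "x \<in> X \<Longrightarrow> y \<in> X \<Longrightarrow> line x y \<subseteq> X"
  using V_G act_closed by (auto simp: line_def)

lemma line_self: "x \<in> X \<Longrightarrow> x \<in> line x y \<and> y \<in> line x y"
  using V_0 by (auto simp: line_def intro: image_eqI[of _ _ 0])

lemma line_move:
  assumes "x \<in> X" "y \<in> X" "y \<noteq> x" "z \<in> line x y" "z \<noteq> x"
  obtains v where "v \<in> V x" "z = y \<bullet> v"
  using assms by (auto simp: line_def)

lemma line_eq_base:
  assumes "x \<in> X" "y \<in> X" "y \<noteq> x" "z \<in> line x y" "z \<noteq> x"
  shows "line x z = line x y"
proof -
  obtain v where v: "v \<in> V x" "z = y \<bullet> v" using line_move assms by blast
  have y: "y = z \<bullet> v" using v invol_act V_double by metis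
  have *: "line x (a \<bullet> w) \<subseteq> line x a" if "w \<in> V x" for a w
    using V_add[of x w] that assms by (auto simp: line_def) (metis act_add image_eqI)
  show ?thesis using *[of v y] *[of v z] v(1) unfolding y[symmetric] v(2)[symmetric] by blast
qed

lemma card_line:
  assumes "x \<in> X" "y \<in> X" "y \<noteq> x"
  shows "card (line x y) = card (stab2 x y) + 2"
proof -
  have "inj_on (\<lambda>v. y \<bullet> v) (V x)"
    by (rule inj_onI) (use R_unique V_R assms in blast)
  then have "card ((\<lambda>v. y \<bullet> v) ` V x) = Suc (card (stab2 x y))"
    using card_image card_V assms by metis
  moreover have "x \<notin> (\<lambda>v. y \<bullet> v) ` V x"
    using stab_moves[of _ x y] V_G R_fix V_R assms by (metis imageE)
  moreover have "finite (V x)" using V_eq finite_invols assms by simp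
  ultimately show ?thesis by (simp add: line_def)
qed

end

text \<open>\<open>z\<close> and \<open>w\<close> stand for zero and infinity, \<open>e\<close> for
  the point given by the special involution. Specialness takes the form that one involution at each
  base point carries the other base point to the same \<open>e\<close>; \<open>nontrivial\<close> is
  the trace of properness.\<close>

locale zassenhaus_special = zassenhaus_even +
  fixes z w e s t
  assumes zwe: "z \<in> X" "w \<in> X" "e \<in> X" "z \<noteq> w" "e \<noteq> z" "e \<noteq> w"
    and special: "s \<in> invols_at w" "t \<in> invols_at z" "z \<bullet> s = e" "w \<bullet> t = e"
    and nontrivial: "stab2 z w \<noteq> {0}"
begin

lemma stab2_sym: "stab2 x y = stab2 y x"
  by (auto simp: stab2_def)

text \<open>Both lines are \<open>{z, w}\<close> together with the orbit of \<open>e\<close> under the stabilizer of \<open>z\<close>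
  and \<open>w\<close>; this is the only place where the special involution is needed.\<close>

lemma line_sym_base: "line w z = line z w"
proof -
  have *: "line a b = {a, b} \<union> (\<lambda>h. c \<bullet> h) ` stab2 a b"
    if ab: "a \<in> X" "b \<in> X" "a \<noteq> b" "r \<in> invols_at a" "b \<bullet> r = c" for a b r c
  proof -
    have "(\<lambda>v. b \<bullet> v) ` invols_at a = (\<lambda>h. c \<bullet> h) ` stab2 a b"
    proof (rule Set.set_eqI, rule iffI)
      fix p assume "p \<in> (\<lambda>v. b \<bullet> v) ` invols_at a"
      then obtain v where v: "v \<in> invols_at a" "p = b \<bullet> v" by auto
      obtain h where h: "h \<in> stab2 a b" "v = - h + r + h"
        using invols_at_conjugate[of a b r v] ab v by metis
      then have "b \<bullet> (- h) = b" by (simp add: stab2_def)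
      then have "p = c \<bullet> h" using v h ab by simp
      then show "p \<in> (\<lambda>h. c \<bullet> h) ` stab2 a b" using h by blast
    next
      fix p assume "p \<in> (\<lambda>h. c \<bullet> h) ` stab2 a b"
      then obtain h where h: "h \<in> stab2 a b" "p = c \<bullet> h" by auto
      then have "b \<bullet> (- h) = b" by (simp add: stab2_def)
      then have "p = b \<bullet> (- h + r + h)" using h ab by simp
      then show "p \<in> (\<lambda>v. b \<bullet> v) ` invols_at a" using h stab2_conj_invols_at ab by blast
    qed
    then show ?thesis using V_eq ab by (auto simp: line_def)
  qed
  show ?thesis using *[of w z s e] *[of z w t e] zwe special stab2_sym[of w z] by auto
qed

lemma line_sym:
  assumes "x \<in> X" "y \<in> X" "x \<noteq> y"
  shows "line x y = line y x"
proof -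
  obtain g where "g \<in> G" "w \<bullet> g = x" "z \<bullet> g = y"
    using two_transitive[of w z x y] zwe assms by blast
  then show ?thesis using line_act[of w z g] line_act[of z w g] line_sym_base zwe by simp
qed

text \<open>Any two points of a line span it: replace one base point, exchange the two by symmetry,
  replace the other.\<close>

lemma line_unique:
  assumes "x \<in> X" "y \<in> X" "x \<noteq> y" "p \<in> line x y" "q \<in> line x y" "p \<noteq> q"
  shows "line p q = line x y"
proof (cases "p = x")
  case True
  then show ?thesis using line_eq_base assms by metis
next
  case False
  have p: "p \<in> X" using line_X assms by blast
  have 1: "line x p = line x y" using line_eq_base False assms by metis
  then have 2: "line p x = line x y" using line_sym[of p x] False p assms by metis
  then show ?thesis using line_eq_base[of p x q] False p assms by metis
qed

section \<open>Elements inverted by an involution\<close>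

definition cent :: "'b \<Rightarrow> 'b set"
  where "cent g = {c \<in> G. c + g = g + c}"

definition inverters :: "'b \<Rightarrow> 'b set"
  where "inverters g = {i \<in> invols. i + g + i = - g}"

definition axis :: "'b \<Rightarrow> 'a set"
  where "axis g = {x \<in> X. \<exists>i\<in>inverters g. x \<bullet> i = x}"

text \<open>In the group PSL_2(q) with q even these are the nontrivial elements of the nonsplit
  tori.\<close>

definition elliptic :: "'b \<Rightarrow> bool"
  where "elliptic g \<longleftrightarrow> g \<in> G \<and> (\<forall>x\<in>X. x \<bullet> g \<noteq> x) \<and> inverters g \<noteq> {}"

lemma invols_G: "i \<in> invols \<Longrightarrow> i \<in> G" "i \<in> invols \<Longrightarrow> i + i = 0" "i \<in> invols \<Longrightarrow> i \<noteq> 0"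
  by (auto simp: invols_def)

lemma invols_cancel: "i \<in> invols \<Longrightarrow> i + (i + x) = x"
  by (metis invols_G(2) add.assoc add_0)

lemma invols_add_eq_0: "i \<in> invols \<Longrightarrow> j \<in> invols \<Longrightarrow> i + j = 0 \<Longrightarrow> i = j"
  using invol_minus[OF invols_G(2)] by (metis eq_neg_iff_add_eq_0)

lemma cent_add: "c \<in> cent g \<Longrightarrow> d \<in> cent g \<Longrightarrow> c + d \<in> cent g"
  using G_add by (simp add: cent_def) (metis add.assoc)

lemma cent_minus: "c \<in> cent g \<Longrightarrow> - c \<in> cent g"
proof -
  assume c: "c \<in> cent g"
  then have "- c + (c + g) + - c = - c + (g + c) + - c" by (simp add: cent_def)
  then have "- c + g = g + - c" by (simp add: add.assoc del: add_uminus_conv_diff)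
  then show ?thesis using c G_minus by (simp add: cent_def)
qed

lemma cent_sym: "g \<in> G \<Longrightarrow> c \<in> cent g \<Longrightarrow> g \<in> cent c"
  by (simp add: cent_def)

lemma cent_conj:
  assumes "h \<in> G" "c \<in> cent g"
  shows "- h + c + h \<in> cent (- h + g + h)"
proof -
  have "(- h + c + h) + (- h + g + h) = - h + (c + g) + h" by (simp add: add.assoc)
  also have "\<dots> = - h + (g + c) + h" using assms by (simp add: cent_def)
  also have "\<dots> = (- h + g + h) + (- h + c + h)" by (simp add: add.assoc)
  finally show ?thesis using G_conj assms by (simp add: cent_def)
qed

lemma inverters_commute:
  assumes "i \<in> inverters g"
  shows "i + g = - g + i" "i + - g = g + i"
proof -
  have i: "i \<in> invols" "i + g + i = - g" using assms by (auto simp: inverters_def)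
  have "i + g = i + g + (i + i)" using i invols_G by simp
  also have "\<dots> = - g + i" using i(2) by (metis add.assoc)
  finally show "i + g = - g + i" .
  have "i + - g = i + (i + (g + i))" using i(2) by (simp add: add.assoc)
  then show "i + - g = g + i" using invols_cancel i by simp
qed

lemma inverters_conj:
  assumes "h \<in> G" "i \<in> inverters g"
  shows "- h + i + h \<in> inverters (- h + g + h)"
proof -
  have "(- h + i + h) + (- h + g + h) + (- h + i + h) = - h + (i + g + i) + h"
    by (simp add: add.assoc)
  also have "\<dots> = - h + - g + h" using assms by (simp add: inverters_def)
  also have "\<dots> = - (- h + g + h)" by (simp add: minus_add add.assoc)
  finally show ?thesis using invol_conj assms by (simp add: inverters_def)
qed

lemma axis_conj:
  assumes "h \<in> G" "x \<in> axis g"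
  shows "x \<bullet> h \<in> axis (- h + g + h)"
proof -
  obtain i where i: "i \<in> inverters g" "x \<bullet> i = x" "x \<in> X" using assms by (auto simp: axis_def)
  have "x \<bullet> h \<bullet> (- h + i + h) = x \<bullet> h" using i by simp
  then show ?thesis
    using inverters_conj[OF assms(1) i(1)] act_closed[OF i(3) assms(1)] unfolding axis_def by blast
qed

lemma elliptic_conj:
  assumes "h \<in> G" "elliptic g"
  shows "elliptic (- h + g + h)"
proof -
  have "x \<bullet> (- h + g + h) \<noteq> x" if "x \<in> X" for x
  proof
    assume "x \<bullet> (- h + g + h) = x"
    then have "x \<bullet> (- h) \<bullet> g = x \<bullet> (- h)" by (metis act_add act_cancel(1))
    then show False using assms act_closed G_minus that by (auto simp: elliptic_def)
  qed
  moreover have "inverters (- h + g + h) \<noteq> {}"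
    using assms inverters_conj[OF assms(1)] by (auto simp: elliptic_def)
  ultimately show ?thesis using assms G_conj by (simp add: elliptic_def)
qed

lemma elliptic_not_invol: "elliptic g \<Longrightarrow> g \<notin> invols"
  using invol_fixed by (metis elliptic_def)

text \<open>A fixed point \<open>x\<close> of \<open>c\<close> is carried by \<open>g\<close> to
  further fixed points of \<open>c\<close>. These stay below three only if \<open>g\<close> swaps
  \<open>x\<close> with its image; then \<open>g\<close> is an involution and has a fixed point
  itself.\<close>

lemma cent_fixed_point_free:
  assumes "elliptic g" "c \<in> cent g" "c \<noteq> 0" "x \<in> X"
  shows "x \<bullet> c \<noteq> x"
proof
  assume c: "x \<bullet> c = x"
  have g: "g \<in> G" "\<And>y. y \<in> X \<Longrightarrow> y \<bullet> g \<noteq> y" using assms by (auto simp: elliptic_def)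
  have cg: "y \<bullet> g \<bullet> c = y \<bullet> c \<bullet> g" for y
    using assms(2) by (simp add: cent_def) (metis act_add)
  have "x \<bullet> g \<bullet> g = x"
  proof (rule ccontr)
    assume "x \<bullet> g \<bullet> g \<noteq> x"
    moreover have "x \<noteq> x \<bullet> g" using g(2) assms by metis
    ultimately have "c = 0"
      using three_fixed[of c x "x \<bullet> g" "x \<bullet> g \<bullet> g"] g c cg assms act_closed by (auto simp: cent_def)
    then show False using assms by simp
  qed
  then have "g \<in> invols" using swap_invol[of g x] g assms by metis
  then show False using elliptic_not_invol assms by blast
qed

lemma cent_double:
  assumes "elliptic g" "c \<in> cent g" "c \<noteq> 0"
  shows "c + c \<noteq> 0"
proof
  assume "c + c = 0"
  then have "c \<in> invols" using assms by (simp add: invols_def cent_def)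
  then show False using invol_fixed cent_fixed_point_free assms by metis
qed

text \<open>An automorphism of order two without nontrivial fixed elements on a finite group is
  inversion. Here an element of \<open>cent g\<close> commuting with \<open>i\<close> lies in the
  root group of the fixed point of \<open>i\<close>, so it is trivial; hence every \<open>c\<close>
  has the form \<open>f w\<close>, and such elements are inverted.\<close>

lemma fixed_point_free_inverts:
  assumes "elliptic g" "i \<in> invols" "\<And>c. c \<in> cent g \<Longrightarrow> i + c + i \<in> cent g" "c \<in> cent g"
  shows "i + c + i = - c"
proof -
  obtain x where x: "x \<in> X" "x \<bullet> i = x" using invol_fixed assms by blast
  then have i: "i \<in> R x" "i \<noteq> 0" using invol_at assms by (auto simp: invols_at_def)
  define f where "f w = - w + i + w + i" for w
  have fin: "finite (cent g)" using finite_G by (simp add: cent_def)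
  have "f ` cent g \<subseteq> cent g"
  proof (rule image_subsetI)
    fix v assume v: "v \<in> cent g"
    have "f v = - v + (i + v + i)" by (simp add: f_def add.assoc)
    then show "f v \<in> cent g" using cent_add cent_minus assms(3) v by simp
  qed
  moreover have "inj_on f (cent g)"
  proof (rule inj_onI)
    fix v v' assume v: "v \<in> cent g" "v' \<in> cent g" "f v = f v'"
    define d where "d = v' - v"
    have "- v + i + v = - v' + i + v'" using v(3) by (simp add: f_def)
    then have "v' + (- v + i + v) - v = v' + (- v' + i + v') - v" by simp
    then have "d + i = i + d"
      by (simp add: d_def add.assoc diff_conv_add_uminus del: add_uminus_conv_diff)
    moreover have d: "d \<in> cent g"
      using v cent_add cent_minus by (simp add: d_def diff_conv_add_uminus del: add_uminus_conv_diff)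
    ultimately have "d \<in> R x" using commutes_in_root_group[of x i d] x i by (simp add: cent_def)
    then have "d = 0" using cent_fixed_point_free assms d x R_fix by blast
    then show "v = v'" by (simp add: d_def)
  qed
  ultimately have "f ` cent g = cent g" using fin by (simp add: endo_inj_surj)
  then obtain w where w: "c = - w + i + w + i" using assms(4) by (auto simp: f_def)
  have "i + c + i = i + - w + i + w" using w invols_G(2)[OF assms(2)] by (simp add: add.assoc del: add_uminus_conv_diff)
  also have "\<dots> = - c"
    using w invol_minus[OF invols_G(2)[OF assms(2)]]
    by (simp add: minus_add add.assoc del: add_uminus_conv_diff)
  finally show ?thesis .
qed

lemma inverters_cent:
  assumes "elliptic g" "i \<in> inverters g" "c \<in> cent g"
  shows "i + c + i = - c"
proof (rule fixed_point_free_inverts[OF assms(1) _ _ assms(3)])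
  show i: "i \<in> invols" using assms by (simp add: inverters_def)
  fix c assume c: "c \<in> cent g"
  then have cg: "c + - g = - g + c" using cent_minus[OF cent_sym[of g c]] assms by (auto simp: cent_def elliptic_def)
  have "i + c + i + g = i + c + (i + g)" by (simp add: add.assoc)
  also have "\<dots> = i + (c + - g) + i"
    using inverters_commute(1)[OF assms(2)] by (simp add: add.assoc del: add_uminus_conv_diff)
  also have "\<dots> = (i + - g) + c + i" by (simp add: cg add.assoc del: add_uminus_conv_diff)
  also have "\<dots> = g + (i + c + i)"
    using inverters_commute(2)[OF assms(2)] by (simp add: add.assoc del: add_uminus_conv_diff)
  finally show "i + c + i \<in> cent g" using c i G_add invols_G by (simp add: cent_def)
qed

lemma cent_commute:
  assumes "elliptic g" "c \<in> cent g" "d \<in> cent g"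
  shows "c + d = d + c"
proof -
  obtain i where i: "i \<in> inverters g" using assms by (auto simp: elliptic_def)
  then have ii: "i \<in> invols" by (simp add: inverters_def)
  have "- (c + d) = i + (c + d) + i" using inverters_cent i cent_add assms by metis
  also have "\<dots> = (i + c + i) + (i + d + i)" by (simp add: add.assoc invols_cancel[OF ii])
  also have "\<dots> = - c + - d" using inverters_cent i assms by metis
  also have "\<dots> = - (d + c)" by (simp add: minus_add del: add_uminus_conv_diff)
  finally show ?thesis by simp
qed

text \<open>The centralizer of \<open>g\<close> is abelian and inverted by every inverter of
  \<open>g\<close>, and \<open>g\<close> lies in \<open>cent c\<close> in turn. So centralizers of
  elliptic elements coincide or meet trivially, and each has one family of inverters.\<close>

lemma cent_elliptic:
  assumes "elliptic g" "c \<in> cent g" "c \<noteq> 0"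
  shows "elliptic c" "cent c = cent g" "inverters c = inverters g"
proof -
  have sub: "inverters g \<subseteq> inverters c"
    using inverters_cent[OF assms(1) _ assms(2)] by (auto simp: inverters_def)
  show c: "elliptic c"
    using assms cent_fixed_point_free sub by (auto simp: elliptic_def cent_def)
  have g: "g \<in> cent c" using cent_sym assms by (auto simp: elliptic_def)
  show eq: "cent c = cent g"
  proof
    show "cent g \<subseteq> cent c" using cent_commute[OF assms(1) _ assms(2)] by (auto simp: cent_def)
    show "cent c \<subseteq> cent g" using cent_commute[OF c _ g] by (auto simp: cent_def)
  qed
  show "inverters c = inverters g"
    using sub inverters_cent[OF c _ g] by (auto simp: inverters_def)
qed

lemma inverters_add:
  assumes "i \<in> inverters g" "j \<in> inverters g" "g \<in> G"
  shows "i + j \<in> cent g"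
proof -
  have "i + j + g = i + (- g + j)" using inverters_commute(1)[OF assms(2)] by (simp add: add.assoc)
  also have "\<dots> = g + (i + j)" using inverters_commute(2)[OF assms(1)] by (metis add.assoc)
  finally show ?thesis using assms G_add invols_G by (auto simp: cent_def inverters_def)
qed

text \<open>The product \<open>i + j\<close> centralizes \<open>g\<close> and yet fixes
  \<open>x\<close>, so it is trivial.\<close>

lemma inverters_same_point:
  assumes "elliptic g" "i \<in> inverters g" "j \<in> inverters g" "x \<in> X" "x \<bullet> i = x" "x \<bullet> j = x"
  shows "i = j"
proof -
  have "i + j \<in> cent g" using inverters_add assms by (simp add: elliptic_def)
  moreover have "x \<bullet> (i + j) = x" using assms by simp
  ultimately have "i + j = 0" using cent_fixed_point_free assms by blast
  then show ?thesis using invols_add_eq_0 assms by (simp add: inverters_def)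
qed

text \<open>The product \<open>c\<close> of the inverters at \<open>x\<close> and \<open>y\<close>
  preserves the line. It suffices to find, for each \<open>p\<close> on the line, an involution
  fixing \<open>p\<close> and inverting \<open>c\<close>, because \<open>c\<close> and
  \<open>g\<close> have the same inverters.\<close>

lemma line_subset_axis:
  assumes "elliptic g" "x \<in> axis g" "y \<in> axis g" "x \<noteq> y"
  shows "line x y \<subseteq> axis g"
proof
  fix p assume p: "p \<in> line x y"
  obtain i where i: "i \<in> inverters g" "x \<bullet> i = x" "x \<in> X" using assms by (auto simp: axis_def)
  obtain j where j: "j \<in> inverters g" "y \<bullet> j = y" "y \<in> X" using assms by (auto simp: axis_def)
  have ij: "i \<in> invols" "j \<in> invols" using i j by (auto simp: inverters_def)
  have V: "i \<in> V x" "j \<in> V y" using V_eq invol_at i j ij by auto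
  \<comment> \<open>\<open>V a\<close> preserves each line through \<open>a\<close>: it fixes
    \<open>a\<close> and moves \<open>b\<close> along the line.\<close>
  have img: "(\<lambda>q. q \<bullet> v) ` line a b = line a b"
    if ab: "a \<in> X" "b \<in> X" "a \<noteq> b" "v \<in> V a" for a b v
  proof -
    have "b \<bullet> v \<in> line a b" using ab by (simp add: line_def)
    moreover have "b \<bullet> v \<noteq> a" "a \<bullet> v = a"
      using ab stab_moves[of v a b] V_G R_fix V_R by metis+
    ultimately show ?thesis using line_act[of a b v] line_eq_base[of a b "b \<bullet> v"] ab V_G by simp
  qed
  define c where "c = i + j"
  have "(\<lambda>q. q \<bullet> c) ` line x y = (\<lambda>q. q \<bullet> j) ` (\<lambda>q. q \<bullet> i) ` line x y"
    by (simp add: c_def image_image)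
  also have "\<dots> = (\<lambda>q. q \<bullet> j) ` line y x" using img[of x y i] V i j assms line_sym[of x y] by simp
  also have "\<dots> = line x y" using img[of y x j] V i j assms line_sym[of x y] by simp
  finally have cL: "(\<lambda>q. q \<bullet> c) ` line x y = line x y" .
  have pX: "p \<in> X" using p line_X i j by blast
  have c: "c \<in> cent g" using inverters_add i j assms by (simp add: c_def elliptic_def)
  have "c \<noteq> 0"
  proof
    assume "c = 0"
    then have "i = j" using invols_add_eq_0 ij by (simp add: c_def)
    then show False using invol_fixed_unique[of i x y] i j ij assms by simp
  qed
  then have c': "elliptic c" "inverters c = inverters g" using cent_elliptic assms c by blast+
  then have cG: "c \<in> G" and fpf: "\<And>q. q \<in> X \<Longrightarrow> q \<bullet> c \<noteq> q" by (auto simp: elliptic_def)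
  define q where "q = p \<bullet> (- c)"
  have qc: "q \<bullet> c = p" by (simp add: q_def)
  have "p \<in> (\<lambda>q. q \<bullet> c) ` line x y" using cL p by simp
  then have q: "q \<in> line x y" using qc by auto
  have pc: "p \<bullet> c \<in> line x y" using cL p by auto
  have qX: "q \<in> X" using q line_X i j by blast
  have "q \<noteq> p" using fpf[OF qX] qc by auto
  then have "line p q = line x y" using line_unique[of x y p q] p q i j assms by blast
  \<comment> \<open>The points \<open>q\<close>, \<open>p\<close> and the image of \<open>p\<close>
    under \<open>c\<close> are collinear, so some \<open>v\<close> in \<open>V p\<close> takes
    \<open>q\<close> to that image. Then \<open>v + c\<close> swaps \<open>p\<close> with its image
    under \<open>c\<close>, hence is an involution, and \<open>v\<close> inverts
    \<open>c\<close>.\<close>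
  then obtain v where v: "v \<in> V p" "p \<bullet> c = q \<bullet> v"
    using line_move[of p q "p \<bullet> c"] pX qX \<open>q \<noteq> p\<close> pc fpf by metis
  have vp: "p \<bullet> v = p" "v \<in> G" "v + v = 0" using v pX R_fix V_R V_G V_double by auto
  have "p \<bullet> c \<bullet> v = q" using v vp invol_act by metis
  then have "p \<bullet> (v + c) \<bullet> (v + c) = p" "p \<bullet> (v + c) = p \<bullet> c" using vp qc by simp_all
  then have vc: "v + c \<in> invols"
    using swap_invol[of "v + c" p] vp cG G_add fpf pX by (metis (no_types))
  then have "v + c + (v + c) = 0" by (rule invols_G)
  then have "v + c + v = - c" by (metis add.assoc eq_neg_iff_add_eq_0)
  moreover have "v \<noteq> 0" using vc elliptic_not_invol c' by auto
  ultimately have "v \<in> inverters c" using vp by (simp add: inverters_def invols_def)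
  then show "p \<in> axis g" using c' vp pX by (auto simp: axis_def)
qed

text \<open>Relative to one fixed inverter \<open>i\<close>, a point of the axis is recorded by the
  product of \<open>i\<close> with the inverter at that point.\<close>

lemma card_axis_le_cent:
  assumes "elliptic g"
  shows "card (axis g) \<le> card (cent g)"
proof -
  obtain i where i: "i \<in> inverters g" using assms by (auto simp: elliptic_def)
  have "\<forall>x\<in>axis g. \<exists>j. j \<in> inverters g \<and> x \<bullet> j = x" by (auto simp: axis_def)
  then obtain j where j: "\<And>x. x \<in> axis g \<Longrightarrow> j x \<in> inverters g \<and> x \<bullet> j x = x" by metis
  show ?thesis
  proof (rule card_inj_on_le)
    show "inj_on (\<lambda>x. i + j x) (axis g)"
    proof (rule inj_onI)
      fix x y assume x: "x \<in> axis g" "y \<in> axis g" "i + j x = i + j y"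
      then have "x \<bullet> j x = x" "y \<bullet> j x = y" using j by (auto, metis)
      then show "x = y" using invol_fixed_unique[of "j x" x y] j[OF x(1)] x by (auto simp: axis_def inverters_def)
    qed
    show "(\<lambda>x. i + j x) ` axis g \<subseteq> cent g"
      using inverters_add i j assms by (auto simp: elliptic_def)
  qed (use finite_G in \<open>simp add: cent_def\<close>)
qed

lemma axis_cent:
  assumes "elliptic g" "x \<in> axis g" "c \<in> cent g"
  shows "x \<bullet> c \<in> axis g"
proof -
  have "- c + g + c = - c + (c + g)" using assms by (simp add: cent_def add.assoc)
  then have "- c + g + c = g" by simp
  then show ?thesis using axis_conj[of c x g] assms by (simp add: cent_def)
qed

text \<open>An involution at \<open>x\<close> moves \<open>y\<close> along the line through
  \<open>x\<close> and \<open>y\<close>, and the axis is a subspace.\<close>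

lemma axis_invols_at:
  assumes "elliptic g" "x \<in> axis g" "y \<in> axis g" "r \<in> invols_at x"
  shows "y \<bullet> r \<in> axis g"
proof (cases "y = x")
  case True
  then show ?thesis using assms invols_at_fix by (auto simp: axis_def)
next
  case False
  have "y \<bullet> r \<in> line x y" using V_eq assms by (auto simp: line_def axis_def)
  then show ?thesis using line_subset_axis[of g x y] assms False by blast
qed

text \<open>The inverters at \<open>x\<close> and at another axis point have a nontrivial product,
  which centralizes both \<open>g\<close> and its conjugate by \<open>r\<close>. So the two
  centralizers coincide, \<open>r\<close> normalizes \<open>cent g\<close> and therefore inverts
  \<open>g\<close>. The lemma serves to find conjugates of \<open>g\<close> with other
  inverters.\<close>

lemma axis_inverter_unique:
  assumes "elliptic g" "x \<in> axis g" "i \<in> inverters g" "x \<bullet> i = x" "r \<in> invols_at x"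
    "inverters (- r + g + r) = inverters g"
  shows "r = i"
proof -
  have x: "x \<in> X" using assms by (simp add: axis_def)
  then have r: "r \<in> invols" "r \<in> G" using assms invols_at_invols invols_G by blast+
  have rr: "- r = r" using invol_minus invols_G r by blast
  have g': "elliptic (- r + g + r)" using elliptic_conj r assms by blast
  obtain y where y: "y \<in> axis g" "y \<noteq> x"
  proof -
    have "x \<bullet> g \<in> axis g" using axis_cent[of g x g] assms by (simp add: cent_def elliptic_def)
    moreover have "x \<bullet> g \<noteq> x" using assms x by (simp add: elliptic_def)
    ultimately show ?thesis using that by blast
  qed
  then obtain j where j: "j \<in> inverters g" "y \<bullet> j = y" "y \<in> X" by (auto simp: axis_def)
  define c where "c = i + j"
  have c: "c \<in> cent g" "c \<in> cent (- r + g + r)"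
    using inverters_add assms j g' by (auto simp: c_def elliptic_def)
  have "c \<noteq> 0"
  proof
    assume "c = 0"
    then have "i = j" using invols_add_eq_0 j assms by (simp add: c_def inverters_def)
    then show False using invol_fixed_unique[of i x y] assms j x y by (simp add: inverters_def)
  qed
  then have "cent g = cent (- r + g + r)"
    using cent_elliptic(2) c g' assms by metis
  then have "r + d + r \<in> cent g" if "d \<in> cent g" for d
    using cent_conj[of r d g] r rr that by simp
  then have "r + g + r = - g"
    using fixed_point_free_inverts[of g r g] r assms by (simp add: cent_def elliptic_def)
  then have "r \<in> inverters g" using r by (simp add: inverters_def)
  then show ?thesis using inverters_same_point[of g r i x] assms x invols_at_fix by blast
qed

section \<open>Counting products of two involutions\<close>

abbreviation k :: nat
  where "k \<equiv> card (stab2 z w)"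

lemma card_stab2_k: "x \<in> X \<Longrightarrow> y \<in> X \<Longrightarrow> x \<noteq> y \<Longrightarrow> card (stab2 x y) = k"
  using card_stab2 zwe by blast

lemma card_invols_at_k: "x \<in> X \<Longrightarrow> card (invols_at x) = k"
  using third_point card_invols_at_swaps_stab2(1) card_stab2_k by metis

lemma k_ge_2: "k \<ge> 2"
proof -
  have 0: "0 \<in> stab2 z w" using G_0 by (simp add: stab2_def)
  then obtain h where "h \<in> stab2 z w" "h \<noteq> 0" using nontrivial by blast
  then have "card {0, h} \<le> k" using 0 by (intro card_mono finite_invols) auto
  then show ?thesis using \<open>h \<noteq> 0\<close> by simp
qed

text \<open>Every conjugate of \<open>g'\<close> by an element of \<open>cent g\<close> has an
  inverter at \<open>x\<close> and one at \<open>y\<close>. The resulting pair of involutions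
  determines the element of \<open>cent g\<close>, and there are \<open>k * k\<close> pairs.\<close>

lemma card_cent_le:
  assumes "elliptic g" "x \<in> axis g" "y \<in> axis g" "x \<noteq> y" "r \<in> invols_at x"
    and r: "inverters (- r + g + r) \<noteq> inverters g"
  shows "card (cent g) \<le> k * k"
proof -
  have x: "x \<in> X" "y \<in> X" using assms by (auto simp: axis_def)
  then have rG: "r \<in> G" "r + r = 0" using assms invols_at_invols invols_G by blast+
  have rr: "- r = r" using invol_minus rG by blast
  define g' where "g' = - r + g + r"
  have g': "elliptic g'" using elliptic_conj rG assms by (simp add: g'_def)
  have G: "c \<in> G" if "c \<in> cent g" for c using that by (simp add: cent_def)
  define gc where "gc c = - c + g' + c" for c
  have gc: "elliptic (gc c)" if "c \<in> cent g" for c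
    using elliptic_conj g' G that by (simp add: gc_def)
  \<comment> \<open>The axis of \<open>g\<close> is stable under \<open>cent g\<close> and under
    \<open>r\<close>, so all its points lie on the axis of each conjugate
    \<open>gc c\<close>.\<close>
  have ax: "p \<in> axis (gc c)" if "p \<in> axis g" "c \<in> cent g" for p c
  proof -
    have "p \<bullet> (- c) \<in> axis g" using axis_cent assms cent_minus that by blast
    then have "p \<bullet> (- c) \<bullet> r \<in> axis g" using axis_invols_at assms by blast
    then have "p \<bullet> (- c) \<bullet> r \<bullet> r \<bullet> c \<in> axis (- c + (- r + g + r) + c)"
      using axis_conj rG G that by blast
    then show ?thesis using rr rG invol_act by (simp add: gc_def g'_def)
  qed
  have ex: "\<exists>i j. i \<in> inverters (gc c) \<and> i \<in> invols_at x \<and> j \<in> inverters (gc c) \<and> j \<in> invols_at y"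
    if "c \<in> cent g" for c
    using ax[OF assms(2) that] ax[OF assms(3) that] invol_at x by (fastforce simp: axis_def inverters_def)
  then obtain i j where ij: "\<And>c. c \<in> cent g \<Longrightarrow> i c \<in> inverters (gc c) \<and> i c \<in> invols_at x
      \<and> j c \<in> inverters (gc c) \<and> j c \<in> invols_at y" by metis
  have "inj_on (\<lambda>c. (i c, j c)) (cent g)"
  proof (rule inj_onI, rule ccontr)
    fix c d assume cd: "c \<in> cent g" "d \<in> cent g" "(i c, j c) = (i d, j d)" "c \<noteq> d"
    define u where "u = i c + j c"
    have u: "u \<in> cent (gc c)" "u \<in> cent (gc d)"
      using inverters_add ij[OF cd(1)] ij[OF cd(2)] gc cd by (auto simp: u_def elliptic_def)
    have "u \<noteq> 0"
    proof
      assume "u = 0"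
      then have "i c = j c"
        using invols_add_eq_0 ij cd invols_at_invols x by (metis u_def)
      then show False using invols_at_disjoint[of x y] ij[OF cd(1)] x assms by auto
    qed
    then have eq: "inverters (gc c) = inverters (gc d)"
      using cent_elliptic(3) gc cd u by metis
    define n where "n = c - d"
    have n: "n \<in> cent g" "n \<noteq> 0"
      using cent_add[of c g "- d"] cent_minus cd by (auto simp: n_def)
    \<comment> \<open>Because \<open>r\<close> commutes with the involutions at \<open>x\<close>,
      the inverter \<open>l\<close> of \<open>g\<close> also inverts \<open>g'\<close>.\<close>
    obtain l where l: "l \<in> inverters g" "x \<bullet> l = x" using assms by (auto simp: axis_def)
    have lx: "l \<in> invols_at x" "l \<in> invols" using l invol_at x by (auto simp: inverters_def)
    have "r + l = l + r" using invols_at_central x lx assms by (simp add: invols_at_def)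
    then have "- r + l + r = - r + (r + l)" by (simp add: add.assoc)
    then have "- r + l + r = l" by simp
    then have lg': "l \<in> inverters g'" using inverters_conj[OF rG(1) l(1)] by (simp add: g'_def)
    then have "- c + l + c \<in> inverters (gc c)" using inverters_conj G cd by (simp add: gc_def)
    then have "- (- d) + (- c + l + c) + (- d) \<in> inverters (- (- d) + gc d + (- d))"
      using inverters_conj[of "- d"] G G_minus cd eq by simp
    then have "- n + l + n \<in> inverters g'"
      by (simp add: n_def gc_def add.assoc diff_conv_add_uminus minus_add del: add_uminus_conv_diff)
    then have "l + (- n + l + n) \<in> cent g'" using inverters_add lg' g' by (simp add: elliptic_def)
    \<comment> \<open>Both \<open>l\<close> and its conjugate by \<open>n\<close> invert
      \<open>g'\<close>, so their product centralizes \<open>g'\<close>. As \<open>l\<close> inverts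
      \<open>n\<close>, this product is \<open>n + n\<close>, a nontrivial element common to
      \<open>cent g\<close> and \<open>cent g'\<close>; then the inverters agree, contrary to
      \<open>r\<close>.\<close>
    moreover have "l + (- n + l + n) = n + n"
    proof -
      have "l + - n = n + l"
        using inverters_commute(2)[of l n] cent_elliptic(3)[OF assms(1) n] l by simp
      then have "l + (- n + l + n) = n + (l + (l + n))" by (simp add: add.assoc[symmetric] del: add_uminus_conv_diff)
      then show ?thesis using invols_cancel lx by simp
    qed
    ultimately have nn: "n + n \<in> cent g'" "n + n \<in> cent g" "n + n \<noteq> 0"
      using cent_add cent_double assms n by auto
    then have "inverters g' = inverters g" using cent_elliptic(3) assms g' by metis
    then show False using r by (simp add: g'_def)
  qed
  then have "card (cent g) \<le> card (invols_at x \<times> invols_at y)"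
    by (rule card_inj_on_le) (use ij x finite_invols in auto)
  then show ?thesis using card_invols_at_k x by (simp add: card_cartesian_product)
qed

text \<open>A line has \<open>k + 2\<close> points. Were the axis larger, it would contain a
  plane-like set with at least \<open>(k + 2) * Suc k\<close> points, against the bound
  \<open>k * k\<close> for the centralizer.\<close>

lemma card_axis_le:
  assumes "elliptic g"
  shows "card (axis g) \<le> k + 2"
proof (rule ccontr)
  assume large: "\<not> card (axis g) \<le> k + 2"
  have fin: "finite (axis g)" using finite_X by (simp add: axis_def)
  obtain i where i: "i \<in> inverters g" using assms by (auto simp: elliptic_def)
  then have "i \<in> invols" by (simp add: inverters_def)
  then obtain x where "x \<in> X" "x \<bullet> i = x" by (rule invol_fixed)
  note ix = i this
  then have x: "x \<in> axis g" by (auto simp: axis_def)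
  have "\<not> axis g \<subseteq> {x}"
  proof
    assume "axis g \<subseteq> {x}"
    then have "card (axis g) \<le> card {x}" by (intro card_mono) auto
    then show False using large by simp
  qed
  then obtain y where y: "y \<in> axis g" "y \<noteq> x" by blast
  have X: "x \<in> X" "y \<in> X" using x y by (auto simp: axis_def)
  let ?L = "line x y"
  have L: "?L \<subseteq> axis g" using line_subset_axis assms x y by blast
  have cardL: "card ?L = k + 2" using card_line card_stab2_k X y by metis
  have finL: "finite ?L" using L fin finite_subset by blast
  have "\<not> axis g \<subseteq> ?L" using card_mono[OF finL] cardL large by force
  then obtain p where p: "p \<in> axis g" "p \<notin> ?L" by blast
  have pX: "p \<in> X" using p by (simp add: axis_def)
  \<comment> \<open>The lines joining \<open>p\<close> to the points of \<open>?L\<close> meet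
    pairwise only in \<open>p\<close>; each contributes the \<open>Suc k\<close> images of its point
    of \<open>?L\<close> under \<open>V p\<close>.\<close>
  have "card (?L \<times> V p) \<le> card (axis g)"
  proof (rule card_inj_on_le)
    show "(\<lambda>(a, v). a \<bullet> v) ` (?L \<times> V p) \<subseteq> axis g"
    proof clarsimp
      fix a v assume a: "a \<in> ?L" "v \<in> V p"
      have "a \<bullet> v \<in> line p a" using a by (simp add: line_def)
      then show "a \<bullet> v \<in> axis g" using line_subset_axis[of g p a] assms p a L by blast
    qed
    show "inj_on (\<lambda>(a, v). a \<bullet> v) (?L \<times> V p)"
    proof (rule inj_onI, clarsimp)
      fix a v b u assume ab: "a \<in> ?L" "v \<in> V p" "b \<in> ?L" "u \<in> V p" "a \<bullet> v = b \<bullet> u"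
      have aX: "a \<in> X" "b \<in> X" using ab L by (auto simp: axis_def)
      have ap: "a \<noteq> p" "b \<noteq> p" using ab p by auto
      have "a \<bullet> v \<in> line p a" using ab(2) by (simp add: line_def)
      moreover have "b \<bullet> u \<in> line p b" using ab(4) by (simp add: line_def)
      then have "a \<bullet> v \<in> line p b" using ab(5) by simp
      moreover have "a \<bullet> v \<noteq> p" using stab_moves[of v p a] V_G R_fix V_R pX aX ap ab by metis
      ultimately have "line p a = line p b" using line_eq_base pX aX ap by metis
      then have ab_p: "a \<in> line p a" "b \<in> line p a" "p \<in> line p a" using line_self pX by auto
      have "a = b"
      proof (rule ccontr)
        assume "a \<noteq> b"
        then have "line a b = line p a" "line a b = ?L"
          using line_unique[of p a a b] line_unique[of x y a b] ab_p ab X pX aX ap y by auto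
        then show False using ab_p p by auto
      qed
      then show "a = b \<and> v = u" using R_unique[of p v u a] V_R ab ap aX pX by auto
    qed
  qed (rule fin)
  then have 1: "(k + 2) * Suc k \<le> card (axis g)"
    using card_V[of p] third_point card_stab2_k pX cardL by (metis card_cartesian_product)
  \<comment> \<open>A second involution at \<open>x\<close> exists as \<open>k\<close> is at least
    2, that is, by properness.\<close>
  obtain r where r: "r \<in> invols_at x" "r \<noteq> i"
  proof -
    have "\<not> invols_at x \<subseteq> {i}"
    proof
      assume "invols_at x \<subseteq> {i}"
      then have "card (invols_at x) \<le> card {i}" by (intro card_mono) auto
      then show False using card_invols_at_k X k_ge_2 by simp
    qed
    then show ?thesis using that by blast
  qed
  then have "inverters (- r + g + r) \<noteq> inverters g"
    using axis_inverter_unique assms x ix by blast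
  then have "card (cent g) \<le> k * k" using card_cent_le[of g x y r] assms x y r by blast
  then have "card (axis g) \<le> k * k" using card_axis_le_cent assms le_trans by blast
  then show False using 1 by simp
qed

lemma card_inverters_le:
  assumes "elliptic g"
  shows "card (inverters g) \<le> k + 2"
proof -
  have "\<forall>i\<in>inverters g. \<exists>x. x \<in> X \<and> x \<bullet> i = x"
  proof
    fix i assume "i \<in> inverters g"
    then have "i \<in> invols" by (simp add: inverters_def)
    then show "\<exists>x. x \<in> X \<and> x \<bullet> i = x" by (rule invol_fixed) blast
  qed
  then obtain f where f: "\<And>i. i \<in> inverters g \<Longrightarrow> f i \<in> X \<and> f i \<bullet> i = f i" by metis
  have "card (inverters g) \<le> card (axis g)"
  proof (rule card_inj_on_le)
    show "inj_on f (inverters g)"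
      by (rule inj_onI) (metis f inverters_same_point assms)
    show "f ` inverters g \<subseteq> axis g" using f by (auto simp: axis_def)
  qed (use finite_X in \<open>simp add: axis_def\<close>)
  then show ?thesis using card_axis_le[OF assms] by linarith
qed

text \<open>Factorizations of \<open>g\<close> into two involutions, recorded by the first factor
  \<open>i\<close>; the second is \<open>i + g\<close>.\<close>

definition prods :: "'b \<Rightarrow> 'b set"
  where "prods g = {i \<in> invols. i + g \<in> invols}"

lemma prods_inverters: "prods g \<subseteq> inverters g"
proof
  fix i assume i: "i \<in> prods g"
  then have "i + g + (i + g) = 0" using invols_G by (simp add: prods_def)
  then have "i + g + i = - g" by (metis add.assoc eq_neg_iff_add_eq_0)
  then show "i \<in> inverters g" using i by (simp add: prods_def inverters_def)
qed

lemma finite_prods: "finite (prods g)"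
  using finite_invols by (simp add: prods_def)

lemma card_prods_0: "card (prods 0) \<le> card X * k"
proof -
  have "prods 0 = (\<Union>x\<in>X. invols_at x)" unfolding invols_Union[symmetric] by (simp add: prods_def)
  moreover have "card (\<Union>x\<in>X. invols_at x) \<le> (\<Sum>x\<in>X. card (invols_at x))"
    using finite_X by (rule card_UN_le)
  ultimately show ?thesis using card_invols_at_k by simp
qed

lemma card_invols: "card invols = card X * k"
proof -
  have "card (\<Union>x\<in>X. invols_at x) = (\<Sum>x\<in>X. card (invols_at x))"
    by (rule card_UN_disjoint) (use finite_X finite_invols invols_at_disjoint in auto)
  then show ?thesis using card_invols_at_k invols_Union by simp
qed

text \<open>\<open>i\<close> inverts \<open>g\<close>, so it permutes the fixed points of
  \<open>g\<close>.\<close>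

lemma prods_fixed:
  assumes "x \<in> X" "g \<in> G" "x \<bullet> g = x" "i \<in> prods g"
  shows "x \<bullet> i \<bullet> g = x \<bullet> i"
proof -
  have "i + g + i = - g" using prods_inverters assms by (auto simp: inverters_def)
  then have "x \<bullet> i \<bullet> g \<bullet> i = x" using assms by (metis act_add fixed_minus)
  moreover have "i + i = 0" using assms invols_G by (simp add: prods_def)
  ultimately show ?thesis using invol_act by metis
qed

text \<open>Both factors of a nontrivial \<open>g\<close> in \<open>R x\<close> must fix
  \<open>x\<close>, so \<open>g\<close> is a product of elements of \<open>V x\<close> and is itself
  one of the \<open>k\<close> involutions at \<open>x\<close>. The first factor differs from
  \<open>g\<close>, since the second is nontrivial; this leaves \<open>k - 1\<close>
  choices.\<close>

lemma sum_prods_root_group: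
  assumes "x \<in> X"
  shows "(\<Sum>g\<in>R x - {0}. card (prods g)) \<le> k * (k - 1)"
proof -
  have fin: "finite (R x)" using finite_G R_G assms by (meson finite_subset subsetI)
  have at: "i \<in> invols_at x \<and> i + g \<in> invols_at x" if "g \<in> R x - {0}" "i \<in> prods g" for g i
  proof -
    have g: "g \<in> G" "x \<bullet> g = x" using that assms R_G R_fix by auto
    have i: "i \<in> invols" "i + g \<in> invols" using that by (auto simp: prods_def)
    have "x \<bullet> i \<bullet> g = x \<bullet> i" using prods_fixed assms g that by blast
    then have "x \<bullet> i = x" using unique_fixed[of x g "x \<bullet> i"] that assms i invols_G act_closed by auto
    then show ?thesis using invol_at i assms g by simp
  qed
  have sub: "prods g \<subseteq> invols_at x - {g}" if "g \<in> R x - {0}" for g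
  proof
    fix i assume i: "i \<in> prods g"
    then have "i \<noteq> g" using invols_G by (auto simp: prods_def)
    then show "i \<in> invols_at x - {g}" using at that i by blast
  qed
  have zero: "card (prods g) = 0" if "g \<in> (R x - {0}) - invols_at x" for g
  proof -
    have "prods g = {}"
    proof (rule ccontr)
      assume "prods g \<noteq> {}"
      then obtain i where i: "i \<in> prods g" by blast
      then have iv: "i \<in> V x" "i + g \<in> V x" using at[of g i] that V_eq assms by auto
      then have "i + (i + g) \<in> V x" using V_add assms by blast
      then have "g \<in> V x" using invols_cancel i by (simp add: prods_def)
      then show False using that V_eq assms by auto
    qed
    then show ?thesis by simp
  qed
  have "(\<Sum>g\<in>R x - {0}. card (prods g)) = (\<Sum>g\<in>invols_at x. card (prods g))"
  proof (rule sum.mono_neutral_right)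
    show "\<forall>g\<in>(R x - {0}) - invols_at x. card (prods g) = 0" using zero by blast
  qed (use fin in \<open>auto simp: invols_at_def\<close>)
  also have "\<dots> \<le> (\<Sum>g\<in>invols_at x. k - 1)"
  proof (rule sum_mono)
    fix g assume g: "g \<in> invols_at x"
    then have "card (prods g) \<le> card (invols_at x - {g})"
      using sub[of g] finite_invols assms by (intro card_mono) (auto simp: invols_at_def)
    also have "\<dots> = k - 1" using g finite_invols assms card_invols_at_k by simp
    finally show "card (prods g) \<le> k - 1" .
  qed
  finally show ?thesis using card_invols_at_k assms by simp
qed

text \<open>The first factor permutes the two fixed points of \<open>g\<close> and cannot fix both,
  so it is one of the \<open>k\<close> swaps.\<close>

lemma card_prods_stab2:
  assumes "x \<in> X" "y \<in> X" "x \<noteq> y" "g \<in> stab2 x y" "g \<noteq> 0"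
  shows "card (prods g) \<le> k"
proof -
  have g: "g \<in> G" "x \<bullet> g = x" "y \<bullet> g = y" using assms by (auto simp: stab2_def)
  have "prods g \<subseteq> swaps x y"
  proof
    fix i assume i: "i \<in> prods g"
    then have ii: "i \<in> invols" "i \<in> G" "i + i = 0" using invols_G by (auto simp: prods_def)
    have fix2: "p = x \<or> p = y" if "p \<in> X" "p \<bullet> g = p" for p
      using three_fixed[of g x y p] that g assms by metis
    have x: "x \<bullet> i = x \<or> x \<bullet> i = y" and y: "y \<bullet> i = x \<or> y \<bullet> i = y"
      using fix2 prods_fixed i g assms act_closed ii by metis+
    have "x \<bullet> i \<noteq> x \<or> y \<bullet> i \<noteq> y" using invol_fixed_unique assms ii by blast
    then have "x \<bullet> i = y" "y \<bullet> i = x" using x y invol_act_iff[OF ii(3)] by metis+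
    then show "i \<in> swaps x y" using ii by (simp add: swaps_def)
  qed
  moreover have "finite (swaps x y)" using finite_G by (simp add: swaps_def)
  ultimately have "card (prods g) \<le> card (swaps x y)" by (rule card_mono[rotated])
  then show ?thesis using card_invols_at_swaps_stab2(2) card_stab2_k assms by simp
qed

definition fpf :: "'b set"
  where "fpf = {g \<in> G. \<forall>x\<in>X. x \<bullet> g \<noteq> x}"

lemma card_prods_fpf:
  assumes "g \<in> fpf"
  shows "card (prods g) \<le> k + 2"
proof (cases "inverters g = {}")
  case True
  then show ?thesis using prods_inverters[of g] by simp
next
  case False
  then have "elliptic g" using assms by (simp add: fpf_def elliptic_def)
  moreover have "finite (inverters g)" using finite_invols by (simp add: inverters_def)
  ultimately show ?thesis
    using card_inverters_le card_mono[OF _ prods_inverters] by (meson le_trans)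
qed

section \<open>Sorting the elements of G by their fixed points\<close>

definition fix_set :: "'a set \<Rightarrow> 'b set"
  where "fix_set p = {g \<in> G. \<forall>x\<in>p. x \<bullet> g = x} - {0}"

abbreviation pairs :: "'a set set"
  where "pairs \<equiv> {p. p \<subseteq> X \<and> card p = 2}"

lemma finite_pairs: "finite pairs"
  using finite_X by simp

lemma pairE:
  assumes "p \<in> pairs"
  obtains x y where "x \<in> X" "y \<in> X" "x \<noteq> y" "p = {x, y}" "fix_set p = stab2 x y - {0}"
  using assms by (auto simp: card_2_iff fix_set_def stab2_def)

text \<open>A nontrivial element has zero, one or two fixed points; having exactly one means lying
  in a root group, by \<open>fixes_second_point\<close>.\<close>

lemma G_cases:
  "G = {0} \<union> (\<Union>x\<in>X. R x - {0}) \<union> (\<Union>p\<in>pairs. fix_set p) \<union> fpf" (is "_ = ?A")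
proof
  show "?A \<subseteq> G" using G_0 R_G by (auto simp: fix_set_def fpf_def)
  show "G \<subseteq> ?A"
  proof
    fix g assume g: "g \<in> G"
    consider "g = 0" | "g \<in> fpf" | x where "g \<noteq> 0" "x \<in> X" "x \<bullet> g = x"
      using g by (auto simp: fpf_def)
    then show "g \<in> ?A"
    proof cases
      case 3
      show ?thesis
      proof (cases "g \<in> R x")
        case False
        then obtain y where "y \<in> X" "y \<noteq> x" "y \<bullet> g = y" using fixes_second_point g 3 by blast
        then have "{x, y} \<in> pairs" "g \<in> fix_set {x, y}" using 3 g by (auto simp: fix_set_def)
        then show ?thesis by blast
      qed (use 3 in auto)
    qed auto
  qed
qed

lemma root_groups_disjoint: "x \<in> X \<Longrightarrow> y \<in> X \<Longrightarrow> x \<noteq> y \<Longrightarrow> (R x - {0}) \<inter> (R y - {0}) = {}"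
  using unique_fixed R_fix by blast

lemma fix_set_disjoint:
  assumes "p \<in> pairs" "p' \<in> pairs" "p \<noteq> p'"
  shows "fix_set p \<inter> fix_set p' = {}"
proof (rule ccontr)
  assume "fix_set p \<inter> fix_set p' \<noteq> {}"
  then obtain g where g: "g \<in> fix_set p" "g \<in> fix_set p'" by blast
  obtain x y where xy: "x \<in> X" "y \<in> X" "x \<noteq> y" "p = {x, y}" using assms pairE by metis
  obtain x' y' where xy': "x' \<in> X" "y' \<in> X" "x' \<noteq> y'" "p' = {x', y'}" using assms pairE by metis
  have "a = x \<or> a = y" if "a \<in> p'" for a
    using three_fixed[of g x y a] g xy xy' that by (auto simp: fix_set_def)
  then have "p' \<subseteq> p" using xy by auto
  then show False using xy xy' assms by auto
qed

lemma root_group_fix_set_disjoint: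
  assumes "x \<in> X" "p \<in> pairs"
  shows "(R x - {0}) \<inter> fix_set p = {}"
proof (rule ccontr)
  assume "(R x - {0}) \<inter> fix_set p \<noteq> {}"
  then obtain g where g: "g \<in> R x - {0}" "g \<in> fix_set p" by blast
  obtain a b where ab: "a \<in> X" "b \<in> X" "a \<noteq> b" "p = {a, b}" using assms pairE by metis
  then show False using unique_fixed[of x g a] unique_fixed[of x g b] g assms by (auto simp: fix_set_def)
qed

lemma finite_R: "x \<in> X \<Longrightarrow> finite (R x)"
  using finite_G R_G by (meson finite_subset subsetI)

lemma card_R: "x \<in> X \<Longrightarrow> card (R x) = card X - 1"
proof -
  assume x: "x \<in> X"
  obtain y where y: "y \<in> X" "y \<noteq> x" using third_point by blast
  have "bij_betw (\<lambda>u. y \<bullet> u) (R x) (X - {x})"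
  proof (rule bij_betw_imageI)
    show "inj_on (\<lambda>u. y \<bullet> u) (R x)" by (rule inj_onI) (use R_unique x y in blast)
    show "(\<lambda>u. y \<bullet> u) ` R x = X - {x}"
    proof
      show "(\<lambda>u. y \<bullet> u) ` R x \<subseteq> X - {x}" using stab_moves[of _ x y] R_G R_fix x y by blast
      show "X - {x} \<subseteq> (\<lambda>u. y \<bullet> u) ` R x" using R_obtain[of x y] x y by (metis Diff_iff image_eqI singletonI subsetI)
    qed
  qed
  then show ?thesis using bij_betw_same_card x finite_X by fastforce
qed

text \<open>Elements are sorted by the images of \<open>z\<close> and \<open>w\<close>; two elements
  in one class differ by an element of the stabilizer.\<close>

lemma card_G_le: "card G \<le> card X * (card X - 1) * k"
proof -
  define A where "A = (SIGMA x:X. X - {x})"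
  define B where "B a = {g \<in> G. z \<bullet> g = fst a \<and> w \<bullet> g = snd a}" for a
  have finA: "finite A" using finite_X by (simp add: A_def)
  have "card A = card X * (card X - 1)" using finite_X by (simp add: A_def)
  have "card (B a) \<le> k" if "a \<in> A" for a
  proof (cases "B a = {}")
    case False
    then obtain g where g: "g \<in> B a" by blast
    show ?thesis
    proof (rule card_inj_on_le)
      show "inj_on (\<lambda>h. h - g) (B a)" by (rule inj_onI) (metis diff_add_cancel)
      show "(\<lambda>h. h - g) ` B a \<subseteq> stab2 z w"
        using g G_diff by (auto simp: B_def stab2_def) (metis act_cancel(1))+
    qed (rule finite_invols)
  qed simp
  then have "(\<Sum>a\<in>A. card (B a)) \<le> card A * k" using sum_bounded_above[of A "\<lambda>a. card (B a)" k] by simp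
  moreover have "G \<subseteq> (\<Union>a\<in>A. B a)"
    using zwe act_closed by (auto simp: A_def B_def)
  then have "card G \<le> card (\<Union>a\<in>A. B a)"
    by (rule card_mono[rotated]) (use finA finite_G in \<open>auto simp: B_def\<close>)
  moreover have "card (\<Union>a\<in>A. B a) \<le> (\<Sum>a\<in>A. card (B a))" using finA by (rule card_UN_le)
  ultimately show ?thesis using \<open>card A = _\<close> by simp
qed

text \<open>Used twice: with the number of factorizations, and with the constant 1, which gives the
  order of G.\<close>

lemma sum_over_G:
  fixes f :: "'b \<Rightarrow> nat"
  shows "sum f G = f 0 + (\<Sum>x\<in>X. sum f (R x - {0})) + (\<Sum>p\<in>pairs. sum f (fix_set p)) + sum f fpf"
proof -
  have X: "X \<noteq> {}" using zwe by blast
  have fin: "finite (\<Union>x\<in>X. R x - {0})" "finite (\<Union>p\<in>pairs. fix_set p)" "finite fpf"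
    using finite_X finite_R finite_pairs finite_G by (auto simp: fix_set_def fpf_def)
  have d1: "{0} \<inter> (\<Union>x\<in>X. R x - {0}) = {}" by auto
  have d2: "({0} \<union> (\<Union>x\<in>X. R x - {0})) \<inter> (\<Union>p\<in>pairs. fix_set p) = {}"
  proof -
    have "(R x - {0}) \<inter> (\<Union>p\<in>pairs. fix_set p) = {}" if "x \<in> X" for x
      using root_group_fix_set_disjoint[OF that] by blast
    moreover have "0 \<notin> fix_set p" for p by (simp add: fix_set_def)
    ultimately show ?thesis by blast
  qed
  have d3: "({0} \<union> (\<Union>x\<in>X. R x - {0}) \<union> (\<Union>p\<in>pairs. fix_set p)) \<inter> fpf = {}"
    using R_fix X by (fastforce simp: fix_set_def fpf_def card_2_iff)
  have "sum f G = sum f {0} + sum f (\<Union>x\<in>X. R x - {0}) + sum f (\<Union>p\<in>pairs. fix_set p) + sum f fpf"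
    by (subst G_cases) (simp only: sum.union_disjoint[OF _ _ d3] sum.union_disjoint[OF _ _ d2]
        sum.union_disjoint[OF _ _ d1] fin finite_Un finite.emptyI finite.insertI simp_thms)
  moreover have "sum f (\<Union>x\<in>X. R x - {0}) = (\<Sum>x\<in>X. sum f (R x - {0}))"
    by (rule sum.UNION_disjoint) (use finite_X finite_R root_groups_disjoint in auto)
  moreover have "sum f (\<Union>p\<in>pairs. fix_set p) = (\<Sum>p\<in>pairs. sum f (fix_set p))"
    by (rule sum.UNION_disjoint)
      (use finite_pairs finite_G fix_set_disjoint in \<open>auto simp: fix_set_def\<close>)
  ultimately show ?thesis by simp
qed

lemma card_invols_square_le: "card invols * card invols \<le> (\<Sum>g\<in>G. card (prods g))"
proof -
  have "card (invols \<times> invols) \<le> card (SIGMA g:G. prods g)"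
  proof (rule card_inj_on_le)
    show "inj_on (\<lambda>(i, j). (i + j, i)) (invols \<times> invols)" by (auto intro!: inj_onI)
    show "(\<lambda>(i, j). (i + j, i)) ` (invols \<times> invols) \<subseteq> (SIGMA g:G. prods g)"
      using invols_G G_add invols_cancel by (auto simp: prods_def)
  qed (use finite_G finite_prods in auto)
  then show ?thesis using finite_G finite_prods by (simp add: card_cartesian_product)
qed

lemma two_card_pairs: "2 * card pairs = card X * (card X - 1)"
proof -
  have "even (card X * (card X - 1))" by (cases "card X") auto
  then show ?thesis using n_subsets[OF finite_X, of 2] by (simp add: choose_two)
qed

lemma card_fix_set: "p \<in> pairs \<Longrightarrow> card (fix_set p) = k - 1"
proof -
  assume "p \<in> pairs"
  then obtain x y where xy: "x \<in> X" "y \<in> X" "x \<noteq> y" "fix_set p = stab2 x y - {0}"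
    using pairE by metis
  then show ?thesis using card_stab2_k finite_invols G_0 by (simp add: stab2_def)
qed

text \<open>Each class of G has a bound on its factorizations, and together these must account for
  all pairs of involutions. The fixed point free elements are counted by what the other classes
  leave of G.\<close>

theorem card_X_le: "card X \<le> k + 2"
proof -
  \<comment> \<open>Integers replace natural numbers so that the differences can be
    expanded.\<close>
  let ?N = "int (card X)" and ?K = "int k" and ?C = "int (card pairs)" and ?F = "int (card fpf)"
  have "card invols * card invols \<le> card X * k + card X * (k * (k - 1))
      + card pairs * ((k - 1) * k) + card fpf * (k + 2)"
  proof -
    have "(\<Sum>x\<in>X. \<Sum>g\<in>R x - {0}. card (prods g)) \<le> card X * (k * (k - 1))"
      using sum_bounded_above[of X "\<lambda>x. \<Sum>g\<in>R x - {0}. card (prods g)"] sum_prods_root_group by simp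
    moreover have "(\<Sum>p\<in>pairs. \<Sum>g\<in>fix_set p. card (prods g)) \<le> card pairs * ((k - 1) * k)"
    proof -
      have "(\<Sum>g\<in>fix_set p. card (prods g)) \<le> (k - 1) * k" if p: "p \<in> pairs" for p
      proof -
        obtain x y where xy: "x \<in> X" "y \<in> X" "x \<noteq> y" "fix_set p = stab2 x y - {0}"
          using pairE p by metis
        then have "(\<Sum>g\<in>fix_set p. card (prods g)) \<le> card (fix_set p) * k"
          using sum_bounded_above[of "fix_set p" "\<lambda>g. card (prods g)" k] card_prods_stab2 by simp
        then show ?thesis using card_fix_set p by simp
      qed
      then show ?thesis
        using sum_bounded_above[of pairs "\<lambda>p. \<Sum>g\<in>fix_set p. card (prods g)"] by simp
    qed
    moreover have "(\<Sum>g\<in>fpf. card (prods g)) \<le> card fpf * (k + 2)"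
      using sum_bounded_above[of fpf "\<lambda>g. card (prods g)" "k + 2"] card_prods_fpf by simp
    ultimately show ?thesis
      using card_invols_square_le card_prods_0 sum_over_G[of "\<lambda>g. card (prods g)"] by linarith
  qed
  then have *: "int (card X * k * (card X * k)) \<le> int (card X * k + card X * (k * (k - 1))
      + card pairs * ((k - 1) * k) + card fpf * (k + 2))"
    unfolding card_invols of_nat_le_iff .
  have 1: "?N * ?K * (?N * ?K) \<le> ?N * ?K + ?N * (?K * (?K - 1)) + ?C * ((?K - 1) * ?K) + ?F * (?K + 2)"
  proof -
    have "int (k - 1) = ?K - 1" using k_ge_2 by simp
    then show ?thesis using * by (simp only: of_nat_add of_nat_mult) simp
  qed
  have "card G = 1 + card X * (card X - 2) + card pairs * (k - 1) + card fpf"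
  proof -
    have "(\<Sum>x\<in>X. card (R x - {0})) = (\<Sum>x\<in>X. card X - 2)"
      by (rule sum.cong) (use card_R R_0 finite_R in \<open>auto simp: numeral_2_eq_2\<close>)
    moreover have "(\<Sum>p\<in>pairs. card (fix_set p)) = (\<Sum>p\<in>pairs. k - 1)"
      by (rule sum.cong) (use card_fix_set in auto)
    ultimately show ?thesis using sum_over_G[of "\<lambda>_. 1"] by simp
  qed
  then have "int (1 + card X * (card X - 2) + card pairs * (k - 1) + card fpf)
      \<le> int (card X * (card X - 1) * k)"
    using card_G_le unfolding of_nat_le_iff by simp
  then have 2: "1 + ?N * (?N - 2) + ?C * (?K - 1) + ?F \<le> ?N * (?N - 1) * ?K"
    using k_ge_2 card_X by (simp add: of_nat_diff)
  have "int (2 * card pairs) = int (card X * (card X - 1))"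
    by (simp only: two_card_pairs)
  then have 3: "2 * ?C = ?N * (?N - 1)" using card_X by (simp add: of_nat_diff)
  \<comment> \<open>Weighting the bound for the order of G by \<open>?K + 2\<close> makes
    \<open>?F\<close> cancel against its occurrence in \<open>1\<close>.\<close>
  have "(?K + 2) * (1 + ?N * (?N - 2) + ?C * (?K - 1) + ?F) \<le> (?K + 2) * (?N * (?N - 1) * ?K)"
    using 2 by (rule mult_left_mono) simp
  then have "2 * (?N * ?K * (?N * ?K)) \<le> 2 * (?N * ?K) + 2 * (?N * (?K * (?K - 1))) + 2 * ?C * ((?K - 1) * ?K)
      + (?K + 2) * (2 * (?N * (?N - 1) * ?K) - 2 - 2 * (?N * (?N - 2)) - 2 * ?C * (?K - 1))"
    using 1 by (simp add: algebra_simps)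
  \<comment> \<open>With \<open>3\<close>, everything cancels except this product, whose first
    factor is positive.\<close>
  then have "0 \<le> (?N - 1) * (2 * (?K + 2 - ?N))"
    unfolding 3 by (simp add: algebra_simps)
  then have "0 \<le> ?K + 2 - ?N"
    using card_X by (simp add: zero_le_mult_iff)
  then show ?thesis by linarith
qed

section \<open>Elementary abelian root groups and the regular stabilizer\<close>

text \<open>By \<open>card_X_le\<close> the root group has at most \<open>Suc k\<close> elements,
  the size of its subgroup \<open>V x\<close>.\<close>

lemma root_group_exponent_2:
  assumes "x \<in> X" "u \<in> R x"
  shows "u + u = 0"
proof -
  obtain y where "y \<in> X" "x \<noteq> y" using third_point by metis
  then have "card (V x) = Suc k" using card_V assms card_stab2_k by metis
  then have "card (R x) \<le> card (V x)" using card_X_le card_R assms by simp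
  then have "V x = R x" using card_seteq[OF finite_R] V_R assms by blast
  then show ?thesis using assms V_double by blast
qed

lemma root_group_commute:
  assumes "x \<in> X" "u \<in> R x" "v \<in> R x"
  shows "u + v = v + u"
  using V_central root_group_exponent_2 assms by (simp add: V_def)

text \<open>The orbit map at \<open>e\<close> is injective, and at most \<open>k\<close> points
  other than \<open>z\<close> and \<open>w\<close> are available.\<close>

lemma stab2_transitive:
  assumes "x \<in> X" "x \<noteq> z" "x \<noteq> w"
  obtains h where "h \<in> stab2 z w" "e \<bullet> h = x"
proof -
  have "inj_on (\<lambda>h. e \<bullet> h) (stab2 z w)"
  proof (rule inj_onI)
    fix h h' assume h: "h \<in> stab2 z w" "h' \<in> stab2 z w" "e \<bullet> h = e \<bullet> h'"
    then have "h - h' = 0"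
      using three_fixed[of "h - h'" z w e] zwe G_diff by (auto simp: stab2_def)
    then show "h = h'" by simp
  qed
  then have "card ((\<lambda>h. e \<bullet> h) ` stab2 z w) = k" by (rule card_image)
  moreover have "(\<lambda>h. e \<bullet> h) ` stab2 z w \<subseteq> X - {z, w}"
    using zwe stab_moves[of _ z e] stab_moves[of _ w e] by (auto simp: stab2_def)
  moreover have "card (X - {z, w}) \<le> k" using card_X_le zwe finite_X by (simp add: card_Diff_subset)
  ultimately have "(\<lambda>h. e \<bullet> h) ` stab2 z w = X - {z, w}"
    using finite_X by (intro card_seteq) auto
  then have "x \<in> (\<lambda>h. e \<bullet> h) ` stab2 z w" using assms by simp
  then show ?thesis using that by (elim imageE) simp
qed

text \<open>An arbitrary swap is corrected by the stabilizer. In the field with unit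
  \<open>e\<close> this swap will be inversion.\<close>

lemma swap_fixing_e:
  obtains \<mu> where "\<mu> \<in> swaps z w" "e \<bullet> \<mu> = e"
proof -
  obtain \<nu> where \<nu>: "\<nu> \<in> swaps z w" using swaps_obtain zwe by blast
  have "e \<bullet> \<nu> \<in> X" "e \<bullet> \<nu> \<noteq> z" "e \<bullet> \<nu> \<noteq> w"
    using act_inj[of e \<nu> z] act_inj[of e \<nu> w] \<nu> zwe act_closed
    by (auto simp: swaps_def)
  then obtain h where h: "h \<in> stab2 z w" "e \<bullet> h = e \<bullet> \<nu>" using stab2_transitive by blast
  have "e \<bullet> \<nu> \<bullet> (- h) = e" using h(2) by (metis act_cancel(1))
  then show ?thesis
    by (intro that[of "\<nu> - h"]) (use \<nu> h G_diff in \<open>auto simp: swaps_def stab2_def\<close>)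
qed

end

section \<open>The action of \<open>SL\<^sub>2\<close> on the projective line\<close>

lemma group_Sym: "group (Sym X)"
proof (rule groupI)
  fix p assume "p \<in> carrier (Sym X)"
  then have "inv_into UNIV p \<in> carrier (Sym X)" "inv_into UNIV p \<otimes>\<^bsub>Sym X\<^esub> p = \<one>\<^bsub>Sym X\<^esub>"
    by (auto simp: Sym_def permutes_inv permutes_inv_o)
  then show "\<exists>q\<in>carrier (Sym X). q \<otimes>\<^bsub>Sym X\<^esub> p = \<one>\<^bsub>Sym X\<^esub>" by blast
qed (auto simp: Sym_def permutes_compose permutes_id o_assoc)

lemma Sym_simps: "carrier (Sym X) = {p. p permutes X}" "p \<otimes>\<^bsub>Sym X\<^esub> q = q \<circ> p" "\<one>\<^bsub>Sym X\<^esub> = id"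
  by (simp_all add: Sym_def)

lemma inv_Sym: "p permutes X \<Longrightarrow> inv\<^bsub>Sym X\<^esub> p = inv_into UNIV p"
  by (rule group.inv_equality[OF group_Sym]) (auto simp: Sym_simps permutes_inv permutes_inv_o)

lemma conjugate_Sym: "g permutes X \<Longrightarrow> conjugate (Sym X) H g = (\<lambda>h. g \<circ> h \<circ> inv_into UNIV g) ` H"
  by (simp add: conjugate_def inv_Sym Sym_simps o_assoc)

context field
begin

definition vec_mult :: "'a \<times> 'a \<Rightarrow> 'a \<times> 'a \<times> 'a \<times> 'a \<Rightarrow> 'a \<times> 'a"
  where "vec_mult = (\<lambda>(u, v) (a, b, c, d). (u \<otimes> a \<oplus> v \<otimes> c, u \<otimes> b \<oplus> v \<otimes> d))"

definition proj_point :: "'a \<times> 'a \<Rightarrow> 'a option"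
  where "proj_point = (\<lambda>(u, v). if v = \<zero> then None else Some (u \<otimes> inv v))"

definition homog :: "'a option \<Rightarrow> 'a \<times> 'a"
  where "homog p = (case p of None \<Rightarrow> (\<one>, \<zero>) | Some x \<Rightarrow> (x, \<one>))"

text \<open>Row vectors, so that \<open>x\<close> is sent to \<open>(x a + c) / (x b + d)\<close>: this is a homomorphism for
  permutations acting on the right.\<close>

definition moebius :: "'a \<times> 'a \<times> 'a \<times> 'a \<Rightarrow> 'a option \<Rightarrow> 'a option"
  where "moebius M p = (if p \<in> points (add_monoid R) then proj_point (vec_mult (homog p) M) else p)"

abbreviation vecs :: "('a \<times> 'a) set"
  where "vecs \<equiv> carrier R \<times> carrier R - {(\<zero>, \<zero>)}"

lemma points_add_monoid: "points (add_monoid R) = insert None (Some ` carrier R)"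
  by (simp add: points_def)

lemma inv_closed_nonzero: "x \<in> carrier R \<Longrightarrow> x \<noteq> \<zero> \<Longrightarrow> inv x \<in> carrier R"
  by (simp add: field_Units)

lemma r_inv_nonzero: "x \<in> carrier R \<Longrightarrow> x \<noteq> \<zero> \<Longrightarrow> x \<otimes> inv x = \<one>"
  by (simp add: field_Units)

lemma inv_nonzero: "x \<in> carrier R \<Longrightarrow> x \<noteq> \<zero> \<Longrightarrow> inv x \<noteq> \<zero>"
  using r_inv_nonzero by fastforce

lemma SL2_carrier:
  "(a, b, c, d) \<in> carrier (SL2 R) \<longleftrightarrow>
    a \<in> carrier R \<and> b \<in> carrier R \<and> c \<in> carrier R \<and> d \<in> carrier R \<and> a \<otimes> d \<ominus> b \<otimes> c = \<one>"
  by (simp add: SL2_def)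

lemma SL2_mult:
  "(a, b, c, d) \<otimes>\<^bsub>SL2 R\<^esub> (a', b', c', d') =
    (a \<otimes> a' \<oplus> b \<otimes> c', a \<otimes> b' \<oplus> b \<otimes> d', c \<otimes> a' \<oplus> d \<otimes> c', c \<otimes> b' \<oplus> d \<otimes> d')"
  by (simp add: SL2_def)

lemma SL2_one: "\<one>\<^bsub>SL2 R\<^esub> = (\<one>, \<zero>, \<zero>, \<one>)"
  by (simp add: SL2_def)

lemma det_mult:
  assumes "a \<in> carrier R" "b \<in> carrier R" "c \<in> carrier R" "d \<in> carrier R"
    "a' \<in> carrier R" "b' \<in> carrier R" "c' \<in> carrier R" "d' \<in> carrier R"
  shows "(a \<otimes> a' \<oplus> b \<otimes> c') \<otimes> (c \<otimes> b' \<oplus> d \<otimes> d') \<ominus> (a \<otimes> b' \<oplus> b \<otimes> d') \<otimes> (c \<otimes> a' \<oplus> d \<otimes> c')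
    = (a \<otimes> d \<ominus> b \<otimes> c) \<otimes> (a' \<otimes> d' \<ominus> b' \<otimes> c')"
  using assms by algebra

lemma group_SL2: "group (SL2 R)"
proof (rule groupI)
  fix M N assume "M \<in> carrier (SL2 R)" "N \<in> carrier (SL2 R)"
  then show "M \<otimes>\<^bsub>SL2 R\<^esub> N \<in> carrier (SL2 R)"
    by (cases M; cases N) (auto simp: SL2_carrier SL2_mult det_mult)
next
  show "\<one>\<^bsub>SL2 R\<^esub> \<in> carrier (SL2 R)" by (simp add: SL2_carrier SL2_one minus_eq)
next
  fix L M N assume "L \<in> carrier (SL2 R)" "M \<in> carrier (SL2 R)" "N \<in> carrier (SL2 R)"
  then show "L \<otimes>\<^bsub>SL2 R\<^esub> M \<otimes>\<^bsub>SL2 R\<^esub> N = L \<otimes>\<^bsub>SL2 R\<^esub> (M \<otimes>\<^bsub>SL2 R\<^esub> N)"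
    by (cases L; cases M; cases N)
      (auto simp: SL2_carrier SL2_mult l_distr r_distr m_assoc a_assoc a_lcomm)
next
  fix M assume "M \<in> carrier (SL2 R)"
  then show "\<one>\<^bsub>SL2 R\<^esub> \<otimes>\<^bsub>SL2 R\<^esub> M = M"
    by (cases M) (auto simp: SL2_carrier SL2_mult SL2_one)
next
  fix M assume M: "M \<in> carrier (SL2 R)"
  obtain a b c d where abcd: "M = (a, b, c, d)" by (cases M)
  have *: "a \<in> carrier R" "b \<in> carrier R" "c \<in> carrier R" "d \<in> carrier R" "a \<otimes> d \<ominus> b \<otimes> c = \<one>"
    using M abcd by (auto simp: SL2_carrier)
  have "d \<otimes> a \<ominus> \<ominus> b \<otimes> \<ominus> c = a \<otimes> d \<ominus> b \<otimes> c" "d \<otimes> a \<oplus> \<ominus> b \<otimes> c = a \<otimes> d \<ominus> b \<otimes> c"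
    "d \<otimes> b \<oplus> \<ominus> b \<otimes> d = \<zero>" "\<ominus> c \<otimes> a \<oplus> a \<otimes> c = \<zero>" "\<ominus> c \<otimes> b \<oplus> a \<otimes> d = a \<otimes> d \<ominus> b \<otimes> c"
    using *(1-4) by algebra+
  then have "(d, \<ominus> b, \<ominus> c, a) \<in> carrier (SL2 R)"
    "(d, \<ominus> b, \<ominus> c, a) \<otimes>\<^bsub>SL2 R\<^esub> M = \<one>\<^bsub>SL2 R\<^esub>"
    using * abcd by (auto simp: SL2_carrier SL2_mult SL2_one)
  then show "\<exists>N\<in>carrier (SL2 R). N \<otimes>\<^bsub>SL2 R\<^esub> M = \<one>\<^bsub>SL2 R\<^esub>" by blast
qed

lemma vec_mult_mult:
  assumes "x \<in> carrier R \<times> carrier R" "M \<in> carrier (SL2 R)" "N \<in> carrier (SL2 R)"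
  shows "vec_mult x (M \<otimes>\<^bsub>SL2 R\<^esub> N) = vec_mult (vec_mult x M) N"
  using assms
  by (cases x; cases M; cases N)
    (auto simp: vec_mult_def SL2_carrier SL2_mult l_distr r_distr m_assoc a_assoc a_lcomm)

lemma vec_mult_one: "x \<in> carrier R \<times> carrier R \<Longrightarrow> vec_mult x \<one>\<^bsub>SL2 R\<^esub> = x"
  by (auto simp: vec_mult_def SL2_one)

lemma vec_mult_closed: "x \<in> carrier R \<times> carrier R \<Longrightarrow> M \<in> carrier (SL2 R) \<Longrightarrow> vec_mult x M \<in> carrier R \<times> carrier R"
  by (cases M) (auto simp: vec_mult_def SL2_carrier)

lemma vec_mult_zero: "M \<in> carrier (SL2 R) \<Longrightarrow> vec_mult (\<zero>, \<zero>) M = (\<zero>, \<zero>)"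
  by (cases M) (auto simp: vec_mult_def SL2_carrier)

lemma vec_mult_nonzero:
  assumes "x \<in> vecs" "M \<in> carrier (SL2 R)"
  shows "vec_mult x M \<in> vecs"
proof -
  interpret SL: group "SL2 R" by (rule group_SL2)
  let ?N = "inv\<^bsub>SL2 R\<^esub> M"
  have "vec_mult (vec_mult x M) ?N = x"
    using vec_mult_mult[of x M ?N] vec_mult_one assms by auto
  then have "vec_mult x M \<noteq> (\<zero>, \<zero>)" using vec_mult_zero[of ?N] assms by auto
  then show ?thesis using vec_mult_closed assms by blast
qed

lemma proj_point_closed: "x \<in> vecs \<Longrightarrow> proj_point x \<in> points (add_monoid R)"
  by (auto simp: proj_point_def points_add_monoid inv_closed_nonzero split: if_splits)

lemma homog_closed: "p \<in> points (add_monoid R) \<Longrightarrow> homog p \<in> vecs"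
  by (auto simp: homog_def points_add_monoid)

lemma proj_point_homog: "p \<in> points (add_monoid R) \<Longrightarrow> proj_point (homog p) = p"
  by (auto simp: proj_point_def homog_def points_add_monoid)

text \<open>Normalizing a vector changes it only by a scalar. Together with
  \<open>proj_point_scale\<close> this makes \<open>moebius\<close> multiplicative.\<close>

lemma homog_proj_point:
  assumes "x \<in> vecs"
  obtains l where "l \<in> carrier R" "l \<noteq> \<zero>" "homog (proj_point x) = (l \<otimes> fst x, l \<otimes> snd x)"
proof (cases x)
  case (Pair u v)
  then have uv: "u \<in> carrier R" "v \<in> carrier R" "u \<noteq> \<zero> \<or> v \<noteq> \<zero>" using assms by auto
  show ?thesis
  proof (cases "v = \<zero>")
    case True
    then show ?thesis using that[of "inv u"] uv Pair
      by (auto simp: homog_def proj_point_def inv_closed_nonzero r_inv_nonzero inv_nonzero m_comm)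
  next
    case False
    then show ?thesis using that[of "inv v"] uv Pair
      by (auto simp: homog_def proj_point_def inv_closed_nonzero r_inv_nonzero inv_nonzero m_comm)
  qed
qed

lemma proj_point_scale:
  assumes "l \<in> carrier R" "l \<noteq> \<zero>" "x \<in> vecs"
  shows "proj_point (l \<otimes> fst x, l \<otimes> snd x) = proj_point x"
proof (cases x)
  case (Pair u v)
  then have uv: "u \<in> carrier R" "v \<in> carrier R" using assms by auto
  show ?thesis
  proof (cases "v = \<zero>")
    case False
    then have lv: "l \<otimes> v \<noteq> \<zero>" "l \<otimes> v \<in> carrier R" using integral assms uv by blast+
    have iv: "inv v \<in> carrier R" "v \<otimes> inv v = \<one>"
      using inv_closed_nonzero r_inv_nonzero False uv by auto
    have ilv: "inv (l \<otimes> v) \<in> carrier R" "(l \<otimes> v) \<otimes> inv (l \<otimes> v) = \<one>"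
      using inv_closed_nonzero r_inv_nonzero lv by auto
    have "(l \<otimes> u) \<otimes> inv (l \<otimes> v) = (l \<otimes> u) \<otimes> inv (l \<otimes> v) \<otimes> (v \<otimes> inv v)"
      using uv iv ilv assms by simp
    also have "\<dots> = (u \<otimes> inv v) \<otimes> ((l \<otimes> v) \<otimes> inv (l \<otimes> v))"
      using uv iv(1) ilv(1) assms by algebra
    also have "\<dots> = u \<otimes> inv v" using uv iv ilv by simp
    finally show ?thesis using False lv Pair by (simp add: proj_point_def)
  qed (use Pair assms in \<open>simp add: proj_point_def\<close>)
qed

lemma vec_mult_scale:
  assumes "l \<in> carrier R" "x \<in> carrier R \<times> carrier R" "M \<in> carrier (SL2 R)"
  shows "vec_mult (l \<otimes> fst x, l \<otimes> snd x) M = (l \<otimes> fst (vec_mult x M), l \<otimes> snd (vec_mult x M))"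
  using assms by (cases x; cases M) (auto simp: vec_mult_def SL2_carrier r_distr m_assoc)

lemma moebius_points:
  "M \<in> carrier (SL2 R) \<Longrightarrow> p \<in> points (add_monoid R) \<Longrightarrow> moebius M p \<in> points (add_monoid R)"
  unfolding moebius_def using proj_point_closed vec_mult_nonzero homog_closed by presburger

lemma moebius_mult:
  assumes "M \<in> carrier (SL2 R)" "N \<in> carrier (SL2 R)"
  shows "moebius (M \<otimes>\<^bsub>SL2 R\<^esub> N) = moebius N \<circ> moebius M"
proof
  fix p
  show "moebius (M \<otimes>\<^bsub>SL2 R\<^esub> N) p = (moebius N \<circ> moebius M) p"
  proof (cases "p \<in> points (add_monoid R)")
    case True
    let ?x = "vec_mult (homog p) M"
    have x: "?x \<in> vecs" using True assms vec_mult_nonzero homog_closed by blast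
    obtain l where l: "l \<in> carrier R" "l \<noteq> \<zero>" "homog (proj_point ?x) = (l \<otimes> fst ?x, l \<otimes> snd ?x)"
      using homog_proj_point[OF x] by blast
    have "moebius N (moebius M p) = proj_point (vec_mult (homog (proj_point ?x)) N)"
      using True proj_point_closed[OF x] by (simp add: moebius_def)
    also have "\<dots> = proj_point (vec_mult ?x N)"
      unfolding l(3) using vec_mult_scale[of l ?x N] proj_point_scale[of l "vec_mult ?x N"] l(1,2) x
        vec_mult_nonzero[OF x assms(2)] assms by auto
    also have "\<dots> = moebius (M \<otimes>\<^bsub>SL2 R\<^esub> N) p"
      using True homog_closed[OF True] vec_mult_mult[of "homog p" M N] assms by (simp add: moebius_def)
    finally show ?thesis by simp
  qed (simp add: moebius_def)
qed

lemma moebius_one: "moebius \<one>\<^bsub>SL2 R\<^esub> = id"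
  using homog_closed by (fastforce simp: moebius_def vec_mult_one proj_point_homog)

lemma moebius_permutes:
  assumes "M \<in> carrier (SL2 R)"
  shows "moebius M permutes points (add_monoid R)"
proof (rule bij_imp_permutes)
  interpret SL: group "SL2 R" by (rule group_SL2)
  let ?N = "inv\<^bsub>SL2 R\<^esub> M"
  have "moebius ?N \<circ> moebius M = id" "moebius M \<circ> moebius ?N = id"
    using moebius_mult[of M ?N] moebius_mult[of ?N M] moebius_one assms by auto
  then have *: "moebius ?N (moebius M p) = p" "moebius M (moebius ?N p) = p" for p
    by (metis comp_apply id_apply)+
  show "bij_betw (moebius M) (points (add_monoid R)) (points (add_monoid R))"
    by (rule bij_betwI[of _ _ _ "moebius ?N"]) (use * moebius_points assms in auto)
qed (simp add: moebius_def)

lemma moebius_hom: "moebius \<in> hom (SL2 R) (Sym (points (add_monoid R)))"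
  by (rule homI) (simp_all add: moebius_permutes moebius_mult Sym_simps)

lemma moebius_apply:
  assumes "a \<in> carrier R" "b \<in> carrier R" "c \<in> carrier R" "d \<in> carrier R"
  shows "moebius (a, b, c, d) None = proj_point (a, b)"
    "x \<in> carrier R \<Longrightarrow> moebius (a, b, c, d) (Some x) = proj_point (x \<otimes> a \<oplus> c, x \<otimes> b \<oplus> d)"
  using assms by (auto simp: moebius_def homog_def vec_mult_def points_add_monoid)

lemma moebius_translation:
  assumes "a \<in> carrier R"
  shows "(\<one>, \<zero>, a, \<one>) \<in> carrier (SL2 R)" "moebius (\<one>, \<zero>, a, \<one>) = translation (add_monoid R) a"
proof -
  show "(\<one>, \<zero>, a, \<one>) \<in> carrier (SL2 R)" using assms by (simp add: SL2_carrier minus_eq)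
  show "moebius (\<one>, \<zero>, a, \<one>) = translation (add_monoid R) a"
  proof
    fix p
    show "moebius (\<one>, \<zero>, a, \<one>) p = translation (add_monoid R) a p"
    proof (cases "p \<in> points (add_monoid R)")
      case True
      then show ?thesis
        using assms by (auto simp: points_add_monoid moebius_apply proj_point_def translation_def)
    next
      case False
      then show ?thesis
        by (cases p) (auto simp: points_add_monoid moebius_def translation_def)
    qed
  qed
qed

text \<open>In homogeneous coordinates the vector \<open>(x, \<one>)\<close> goes to
  \<open>(\<one>, \<ominus> x)\<close>.\<close>

lemma moebius_field_tau:
  "(\<zero>, \<ominus> \<one>, \<one>, \<zero>) \<in> carrier (SL2 R)" "moebius (\<zero>, \<ominus> \<one>, \<one>, \<zero>) = field_tau R"
proof -
  show "(\<zero>, \<ominus> \<one>, \<one>, \<zero>) \<in> carrier (SL2 R)" by (simp add: SL2_carrier minus_eq l_minus)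
  have 1: "\<ominus> \<one> \<noteq> \<zero>" using zero_not_one by (metis add.inv_closed minus_minus minus_zero one_closed)
  have inv_uminus: "inv (\<ominus> x) = \<ominus> (inv x)" if "x \<in> carrier R" "x \<noteq> \<zero>" for x
    using that inv_closed_nonzero r_inv_nonzero
    by (intro comm_inv_char) (auto simp: l_minus r_minus)
  show "moebius (\<zero>, \<ominus> \<one>, \<one>, \<zero>) = field_tau R"
  proof
    fix p
    consider "p \<notin> points (add_monoid R)" | "p = None" | x where "p = Some x" "x \<in> carrier R"
      by (auto simp: points_add_monoid)
    then show "moebius (\<zero>, \<ominus> \<one>, \<one>, \<zero>) p = field_tau R p"
    proof cases
      case 1
      then show ?thesis by (cases p) (auto simp: moebius_def field_tau_def points_add_monoid)
    next
      case 2
      then show ?thesis using 1 inv_closed_nonzero by (simp add: moebius_apply field_tau_def proj_point_def)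
    next
      case 3
      have "x \<otimes> \<ominus> \<one> = \<ominus> x" using 3 by (simp add: r_minus)
      moreover have "\<ominus> x = \<zero> \<longleftrightarrow> x = \<zero>" using 3 by (metis minus_minus minus_zero)
      ultimately show ?thesis using 3 inv_closed_nonzero
        by (auto simp: moebius_apply field_tau_def proj_point_def inv_uminus)
    qed
  qed
qed

section \<open>Characteristic two: faithful action and trivial center\<close>

text \<open>In characteristic two, \<open>a \<otimes> a \<ominus> \<one>\<close> is the square of
  \<open>a \<oplus> \<one>\<close>.\<close>

lemma square_eq_one:
  assumes "a \<in> carrier R" "a \<otimes> a = \<one>" "\<And>x. x \<in> carrier R \<Longrightarrow> x \<oplus> x = \<zero>"
  shows "a = \<one>"
proof -
  have "\<ominus> \<one> = \<one>" using assms(3)[of \<one>] by (simp add: minus_equality)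
  moreover have "(a \<ominus> \<one>) \<otimes> (a \<oplus> \<one>) = a \<otimes> a \<ominus> \<one>" using assms(1) by algebra
  ultimately have "(a \<oplus> \<one>) \<otimes> (a \<oplus> \<one>) = \<zero>" using assms by (simp add: minus_eq)
  then have "a \<oplus> \<one> = \<zero>" using integral assms by blast
  then have "a \<ominus> \<one> = \<zero>" using \<open>\<ominus> \<one> = \<one>\<close> by (simp add: minus_eq)
  then show ?thesis using assms(1) by simp
qed

lemma moebius_fixes_zero_infinity:
  assumes "(a, b, c, d) \<in> carrier (SL2 R)" "moebius (a, b, c, d) None = None"
    "moebius (a, b, c, d) (Some \<zero>) = Some \<zero>"
  shows "b = \<zero>" "c = \<zero>" "a \<otimes> d = \<one>" "d \<noteq> \<zero>"
proof -
  have *: "a \<in> carrier R" "b \<in> carrier R" "c \<in> carrier R" "d \<in> carrier R" "a \<otimes> d \<ominus> b \<otimes> c = \<one>"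
    using assms by (auto simp: SL2_carrier)
  show b: "b = \<zero>" using assms(2) * by (auto simp: moebius_apply proj_point_def split: if_splits)
  have d: "d \<noteq> \<zero>" "c \<otimes> inv d = \<zero>"
    using assms(3) * by (auto simp: moebius_apply proj_point_def split: if_splits)
  then show c: "c = \<zero>" using integral inv_closed_nonzero inv_nonzero * by blast
  show "a \<otimes> d = \<one>" using * b c by (simp add: minus_eq)
  show "d \<noteq> \<zero>" by (rule d)
qed

text \<open>A matrix acting trivially is diagonal because it fixes zero and infinity, scalar because
  it fixes one, and then the identity by \<open>square_eq_one\<close>.\<close>

lemma moebius_inj:
  assumes char: "\<And>x. x \<in> carrier R \<Longrightarrow> x \<oplus> x = \<zero>"
  shows "inj_on moebius (carrier (SL2 R))"
proof -
  interpret SL: group "SL2 R" by (rule group_SL2)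
  have hom: "group_hom (SL2 R) (Sym (points (add_monoid R))) moebius"
    using group_SL2 group_Sym moebius_hom by (simp add: group_hom_def group_hom_axioms_def)
  have "M = \<one>\<^bsub>SL2 R\<^esub>" if M: "M \<in> carrier (SL2 R)" "moebius M = id" for M
  proof -
    obtain a b c d where abcd: "M = (a, b, c, d)" by (cases M)
    then have *: "a \<in> carrier R" "b \<in> carrier R" "c \<in> carrier R" "d \<in> carrier R"
      using M by (auto simp: SL2_carrier)
    have 0: "b = \<zero>" "c = \<zero>" "a \<otimes> d = \<one>" "d \<noteq> \<zero>"
      using moebius_fixes_zero_infinity[of a b c d] M abcd by auto
    have "moebius M (Some \<one>) = Some \<one>" using M by simp
    then have "a \<otimes> inv d = \<one>" using abcd * 0 by (simp add: moebius_apply proj_point_def)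
    then have "a \<otimes> inv d \<otimes> d = d" using * by simp
    moreover have "inv d \<otimes> d = \<one>" "inv d \<in> carrier R"
      using * 0 inv_closed_nonzero r_inv_nonzero m_comm by metis+
    ultimately have ad: "a = d" using * by (simp add: m_assoc)
    then have "a = \<one>" using square_eq_one[of a] 0 * char by blast
    then show ?thesis using 0 ad abcd by (simp add: SL2_one)
  qed
  then have "kernel (SL2 R) (Sym (points (add_monoid R))) moebius = {\<one>\<^bsub>SL2 R\<^esub>}"
    using moebius_one by (auto simp: kernel_def Sym_simps)
  then show ?thesis by (simp add: group_hom.inj_iff_trivial_ker[OF hom])
qed

text \<open>Commuting with one lower and one upper unipotent matrix already forces a scalar
  matrix.\<close>

lemma group_center_SL2:
  assumes char: "\<And>x. x \<in> carrier R \<Longrightarrow> x \<oplus> x = \<zero>"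
  shows "group_center (SL2 R) = {\<one>\<^bsub>SL2 R\<^esub>}"
proof -
  interpret SL: group "SL2 R" by (rule group_SL2)
  have "M = \<one>\<^bsub>SL2 R\<^esub>" if M: "M \<in> group_center (SL2 R)" for M
  proof -
    obtain a b c d where abcd: "M = (a, b, c, d)" by (cases M)
    then have *: "a \<in> carrier R" "b \<in> carrier R" "c \<in> carrier R" "d \<in> carrier R" "a \<otimes> d \<ominus> b \<otimes> c = \<one>"
      using M by (auto simp: SL2_carrier group_center_def)
    have el: "(\<one>, \<zero>, \<one>, \<one>) \<in> carrier (SL2 R)" "(\<one>, \<one>, \<zero>, \<one>) \<in> carrier (SL2 R)"
      by (auto simp: SL2_carrier minus_eq)
    have "M \<otimes>\<^bsub>SL2 R\<^esub> (\<one>, \<zero>, \<one>, \<one>) = (\<one>, \<zero>, \<one>, \<one>) \<otimes>\<^bsub>SL2 R\<^esub> M"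
      "M \<otimes>\<^bsub>SL2 R\<^esub> (\<one>, \<one>, \<zero>, \<one>) = (\<one>, \<one>, \<zero>, \<one>) \<otimes>\<^bsub>SL2 R\<^esub> M"
      using M el by (auto simp: group_center_def)
    then have eq: "a \<oplus> b = a" "c \<oplus> d = a \<oplus> c" "a = a \<oplus> c"
      using * abcd by (auto simp: SL2_mult)
    then have "b = \<zero>" "c = \<zero>" using * by auto
    moreover have "d = a" using eq * \<open>c = \<zero>\<close> by simp
    moreover have "a \<otimes> a = \<one>" using * calculation by (simp add: minus_eq)
    then have "a = \<one>" using square_eq_one[of a] * char by blast
    ultimately show ?thesis using abcd by (simp add: SL2_one)
  qed
  moreover have "\<one>\<^bsub>SL2 R\<^esub> \<in> group_center (SL2 R)" by (simp add: group_center_def)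
  ultimately show ?thesis by blast
qed

lemma PSL2_iso_SL2:
  assumes "\<And>x. x \<in> carrier R \<Longrightarrow> x \<oplus> x = \<zero>"
  shows "PSL2 R \<cong> SL2 R"
  using group.trivial_factor_iso[OF group_SL2] group_center_SL2[OF assms]
  unfolding PSL2_def is_iso_def by auto

end

section \<open>The permutation group of a Moufang set\<close>

text \<open>Composition from left to right is written additively, since \<open>group_add\<close> is the type class of
  not necessarily commutative groups.\<close>

typedef 'a bijection = "{f :: 'a \<Rightarrow> 'a. bij f}"
  morphisms apply_bij Abs_bij
  by (rule exI[of _ id]) simp

setup_lifting type_definition_bijection

instantiation bijection :: (type) group_add
begin

lift_definition zero_bijection :: "'a bijection" is id by simp

lift_definition plus_bijection :: "'a bijection \<Rightarrow> 'a bijection \<Rightarrow> 'a bijection"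
  is "\<lambda>p q. q \<circ> p" by (rule bij_comp)

lift_definition uminus_bijection :: "'a bijection \<Rightarrow> 'a bijection"
  is "inv_into UNIV" by (rule bij_imp_bij_inv)

definition minus_bijection :: "'a bijection \<Rightarrow> 'a bijection \<Rightarrow> 'a bijection"
  where "p - q = p + - q" for p q :: "'a bijection"

instance
proof
  fix p q r :: "'a bijection"
  show "p + q + r = p + (q + r)" by transfer (simp add: o_assoc)
  show "0 + p = p" by transfer simp
  show "p + 0 = p" by transfer simp
  show "- p + p = 0" by transfer (metis bij_is_surj surj_iff)
  show "p + - q = p - q" by (simp add: minus_bijection_def)
qed

end

lemma bij_eqI: "(\<And>x. apply_bij p x = apply_bij q x) \<Longrightarrow> p = q"
  by (metis apply_bij_inject ext)

lemma apply_bij_simps [simp]: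
  "apply_bij 0 x = x" "apply_bij (p + q) x = apply_bij q (apply_bij p x)"
  by (simp_all add: zero_bijection.rep_eq plus_bijection.rep_eq)

context moufang_action
begin

text \<open>The Zassenhaus condition is stated at zero and infinity only; two-transitivity spreads
  it to all pairs by conjugation.\<close>

lemma three_fixed_of_base:
  assumes zw: "z \<in> X" "w \<in> X" "z \<noteq> w"
    and base: "\<And>g a. \<lbrakk>g \<in> G; a \<in> X; a \<noteq> z; a \<noteq> w; z \<bullet> g = z; w \<bullet> g = w; a \<bullet> g = a\<rbrakk> \<Longrightarrow> g = 0"
    and g: "g \<in> G" "x \<in> X" "y \<in> X" "v \<in> X" "x \<noteq> y" "x \<noteq> v" "y \<noteq> v"
      "x \<bullet> g = x" "y \<bullet> g = y" "v \<bullet> g = v"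
  shows "g = 0"
proof -
  obtain h where h: "h \<in> G" "x \<bullet> h = z" "y \<bullet> h = w" using two_transitive zw g by metis
  have "z \<bullet> (- h) = x" "w \<bullet> (- h) = y" using h by (metis act_cancel(1))+
  then have "- h + g + h = 0"
    using base[of "- h + g + h" "v \<bullet> h"] h g G_conj act_closed act_inj by (metis act_add act_cancel(1))
  then have "h + (- h + g + h) - h = h + 0 - h" by simp
  then show ?thesis by (simp add: add.assoc)
qed

text \<open>This turns properness into the nontriviality of the two-point stabilizer.\<close>

lemma sharply_two_transitive:
  assumes zw: "z \<in> X" "w \<in> X" "z \<noteq> w" "stab2 z w = {0}"
    and x: "x \<in> X" "y \<in> X" "x' \<in> X" "y' \<in> X" "x \<noteq> y" "x' \<noteq> y'"
  shows "\<exists>!g. g \<in> G \<and> x \<bullet> g = x' \<and> y \<bullet> g = y'"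
proof (rule ex_ex1I)
  show "\<exists>g. g \<in> G \<and> x \<bullet> g = x' \<and> y \<bullet> g = y'" using two_transitive x by metis
next
  fix g g' assume g: "g \<in> G \<and> x \<bullet> g = x' \<and> y \<bullet> g = y'" "g' \<in> G \<and> x \<bullet> g' = x' \<and> y \<bullet> g' = y'"
  obtain h where h: "h \<in> G" "x \<bullet> h = z" "y \<bullet> h = w" using two_transitive zw x by metis
  have "x' \<bullet> (- g') = x" "y' \<bullet> (- g') = y" using g(2) by (metis act_cancel(1))+
  then have "g - g' \<in> stab2 x y" using g G_diff by (simp add: stab2_def)
  then have "- h + (g - g') + h \<in> stab2 z w" using stab2_conj h by metis
  then have "- h + (g - g') + h = 0" using zw by simp
  then have "h + (- h + (g - g') + h) - h = h + 0 - h" by simp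
  then have "g - g' = 0" by (simp add: add.assoc)
  then show "g = g'" by simp
qed

end

text \<open>If an odd prime divided the order, Sylow's theorem would give a subgroup of that order,
  and in it a nontrivial element whose square and whose odd prime power are both trivial.\<close>

lemma (in group) order_power_2:
  assumes fin: "finite (carrier G)" and sq: "\<And>x. x \<in> carrier G \<Longrightarrow> x \<otimes> x = \<one>"
  shows "\<exists>m. order G = 2 ^ m"
proof -
  have "order G > 0" using fin order_gt_0_iff_finite by blast
  then obtain k n where n: "\<not> 2 dvd n" "order G = n * 2 ^ k"
    using prime_power_canonical[of 2 "order G"] two_is_prime_nat by blast
  have "n = 1"
  proof (rule ccontr)
    assume "n \<noteq> 1"
    then obtain q where q: "prime q" "q dvd n" using prime_factor_nat by blast
    then have "odd q" using n(1) dvd_trans by blast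
    obtain l where "order G = q ^ 1 * l" using q(2) n(2) by (metis dvd_def dvd_mult2 power_one_right)
    then obtain H where H: "subgroup H G" "card H = q"
      using sylow_thm[OF q(1) is_group _ fin, of 1 l] by auto
    interpret H: group "G\<lparr>carrier := H\<rparr>" using subgroup_imp_group H(1) .
    have finH: "finite H" using H(1) fin finite_subset subgroup.subset by blast
    have "\<not> H \<subseteq> {\<one>}"
    proof
      assume "H \<subseteq> {\<one>}"
      then have "card H \<le> 1" using card_mono[of "{\<one>}" H] by simp
      then show False using H(2) prime_gt_1_nat[OF q(1)] by simp
    qed
    then obtain x where x: "x \<in> H" "x \<noteq> \<one>" by blast
    then have xG: "x \<in> carrier G" using H(1) subgroup.subset by blast
    have "x [^]\<^bsub>G\<lparr>carrier := H\<rparr>\<^esub> order (G\<lparr>carrier := H\<rparr>) = \<one>"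
      using H.pow_order_eq_1[of x] x by simp
    then have "x [^] q = \<one>" using H(2) by (simp add: order_def nat_pow_consistent[symmetric])
    moreover obtain j where "q = Suc (2 * j)" using \<open>odd q\<close> by (auto elim: oddE)
    moreover have "x [^] (2 * j) = \<one>"
      using nat_pow_pow[of x 2 j] xG sq[OF xG] by (simp add: numeral_2_eq_2)
    ultimately show False using x xG by simp
  qed
  then show ?thesis using n by auto
qed

section \<open>From the construction M(U, \<tau>) to the abstract action\<close>

locale special_zassenhaus_M = group U for U :: "('a, 'b) monoid_scheme" (structure) +
  fixes \<tau> :: "'a option \<Rightarrow> 'a option" and a :: 'a
  assumes swaps: "swaps_zero_infinity U \<tau>"
    and fin: "finite (carrier U)"
    and zass: "zassenhaus_M U \<tau>"
    and even_order: "even (order U)"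
    and inv_a: "involution U a"
    and special_a: "special U \<tau> a"
begin

abbreviation "P \<equiv> points U"
abbreviation "RG \<equiv> root_group U \<tau>"
abbreviation "L \<equiv> little_proj P RG"

definition G :: "'a option bijection set"
  where "G = {p. apply_bij p \<in> L}"

definition R :: "'a option \<Rightarrow> 'a option bijection set"
  where "R x = {p. apply_bij p \<in> RG x}"

lemma moufang: "moufang_set P RG"
  using zass by (simp add: zassenhaus_M_def moufang_M_def)

lemma None_P: "None \<in> P" and Some_P: "Some b \<in> P \<longleftrightarrow> b \<in> carrier U"
  by (auto simp: points_def)

lemma finite_P: "finite P"
  using fin by (simp add: points_def)

lemma card_P: "card P = Suc (order U)"
  using fin by (simp add: points_def order_def card_image)

lemma RG_subgroup: "x \<in> P \<Longrightarrow> subgroup (RG x) (Sym P)"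
  using moufang by (simp add: moufang_set_def)

lemma RG_permutes: "x \<in> P \<Longrightarrow> h \<in> RG x \<Longrightarrow> h permutes P"
  using subgroup.mem_carrier[OF RG_subgroup] by (simp add: Sym_simps)

lemma L_subgroup: "subgroup L (Sym P)"
  unfolding little_proj_def
  by (rule group.generate_is_subgroup[OF group_Sym]) (use RG_permutes in \<open>auto simp: Sym_simps\<close>)

lemma L_permutes: "h \<in> L \<Longrightarrow> h permutes P"
  using subgroup.mem_carrier[OF L_subgroup] by (simp add: Sym_simps)

lemma RG_L: "x \<in> P \<Longrightarrow> h \<in> RG x \<Longrightarrow> h \<in> L"
  unfolding little_proj_def by (rule generate.incl) blast

lemma apply_Abs_bij: "h permutes Y \<Longrightarrow> apply_bij (Abs_bij h) = h"
  by (simp add: Abs_bij_inverse permutes_bij)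

lemma subgroup_Sym:
  assumes "subgroup H (Sym P)"
  shows "id \<in> H" "\<lbrakk>f \<in> H; g \<in> H\<rbrakk> \<Longrightarrow> g \<circ> f \<in> H" "f \<in> H \<Longrightarrow> inv_into UNIV f \<in> H"
proof -
  show "id \<in> H" using subgroup.one_closed[OF assms] by (simp add: Sym_simps)
  show "g \<circ> f \<in> H" if "f \<in> H" "g \<in> H"
    using subgroup.m_closed[OF assms that] by (simp add: Sym_simps)
  show "inv_into UNIV f \<in> H" if "f \<in> H"
  proof -
    have "f permutes P" using subgroup.mem_carrier[OF assms that] by (simp add: Sym_simps)
    then show ?thesis using subgroup.m_inv_closed[OF assms that] by (simp add: inv_Sym)
  qed
qed

lemma rep_eqs: "apply_bij 0 = id" "apply_bij (p + q) = apply_bij q \<circ> apply_bij p"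
  "apply_bij (- p) = inv_into UNIV (apply_bij p)"
  by (simp_all add: zero_bijection.rep_eq plus_bijection.rep_eq uminus_bijection.rep_eq)

sublocale moufang_action "\<lambda>x p. apply_bij p x" P G R
proof
  show "finite P" by (rule finite_P)
  show "odd (card P)" using card_P even_order by simp
  show "3 \<le> card P" using moufang finite_P by (simp add: moufang_set_def)
  have "finite L"
    by (rule finite_subset[OF _ finite_permutations[OF finite_P]]) (use L_permutes in blast)
  then have "finite (apply_bij -` L)" by (rule finite_vimageI) (simp add: inj_def apply_bij_inject)
  then show "finite G" by (simp add: G_def vimage_def)
  show "0 \<in> G" "\<And>g h. g \<in> G \<Longrightarrow> h \<in> G \<Longrightarrow> g + h \<in> G" "\<And>g. g \<in> G \<Longrightarrow> - g \<in> G"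
    using subgroup_Sym[OF L_subgroup] by (simp_all add: G_def rep_eqs)
  fix x assume x: "x \<in> P"
  show "apply_bij g x \<in> P" if "g \<in> G" for g
    using that x L_permutes by (simp add: G_def permutes_in_image)
  show "u \<in> G" if "u \<in> R x" for u using that RG_L x by (simp add: G_def R_def)
  show "0 \<in> R x" "\<And>g h. g \<in> R x \<Longrightarrow> h \<in> R x \<Longrightarrow> g + h \<in> R x" "\<And>g. g \<in> R x \<Longrightarrow> - g \<in> R x"
    using subgroup_Sym[OF RG_subgroup[OF x]] by (simp_all add: R_def rep_eqs)
  show "apply_bij u x = x" if "u \<in> R x" for u
    using that x moufang by (simp add: moufang_set_def R_def)
  show "\<exists>!u. u \<in> R x \<and> apply_bij u y = z" if yz: "y \<in> P - {x}" "z \<in> P - {x}" for y z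
  proof -
    have "\<exists>!h. h \<in> RG x \<and> h y = z"
      using moufang x yz by (simp add: moufang_set_def regular_on_def)
    then obtain h where h: "h \<in> RG x" "h y = z" "\<And>h'. h' \<in> RG x \<Longrightarrow> h' y = z \<Longrightarrow> h' = h" by blast
    have hA: "apply_bij (Abs_bij h) = h" using apply_Abs_bij RG_permutes x h(1) by blast
    show ?thesis
    proof (rule ex1I[of _ "Abs_bij h"])
      show "Abs_bij h \<in> R x \<and> apply_bij (Abs_bij h) y = z" using hA h(1,2) by (simp add: R_def)
      fix u assume "u \<in> R x \<and> apply_bij u y = z"
      then have "apply_bij u = apply_bij (Abs_bij h)" using hA h(3) by (simp add: R_def)
      then show "u = Abs_bij h" by (simp add: apply_bij_inject)
    qed
  qed
  show "- g + u + g \<in> R (apply_bij g x)" if gu: "g \<in> G" "u \<in> R x" for g u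
  proof -
    have "conjugate (Sym P) (RG x) (apply_bij g) = RG (apply_bij g x)"
      using moufang x gu by (simp add: moufang_set_def G_def)
    moreover have "apply_bij g \<circ> apply_bij u \<circ> inv_into UNIV (apply_bij g)
        \<in> conjugate (Sym P) (RG x) (apply_bij g)"
      using gu L_permutes by (simp add: conjugate_Sym G_def R_def)
    ultimately show ?thesis by (simp add: R_def rep_eqs o_assoc)
  qed
qed simp_all

abbreviation "origin \<equiv> Some \<one>"

lemma origin_P: "origin \<in> P"
  by (simp add: Some_P)

lemma base_three_fixed:
  assumes "g \<in> G" "x \<in> P" "x \<noteq> origin" "x \<noteq> None"
    "apply_bij g origin = origin" "apply_bij g None = None" "apply_bij g x = x"
  shows "g = 0"
proof -
  obtain b where b: "x = Some b" "b \<in> carrier U - {\<one>}" using assms by (auto simp: points_def)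
  have "{g \<in> L. g origin = origin \<and> g None = None \<and> g (Some b) = Some b} = {id}"
    using bspec[OF zass[unfolded zassenhaus_M_def, THEN conjunct2, THEN conjunct2] b(2)] .
  moreover have "apply_bij g \<in> {g \<in> L. g origin = origin \<and> g None = None \<and> g (Some b) = Some b}"
    using assms b by (simp add: G_def)
  ultimately have "apply_bij g = apply_bij 0" by (simp add: rep_eqs(1))
  then show ?thesis by (simp only: apply_bij_inject)
qed

sublocale zassenhaus_action "\<lambda>x p. apply_bij p x" P G R
proof
  fix g x y z
  assume g: "g \<in> G" "x \<in> P" "y \<in> P" "z \<in> P" "x \<noteq> y" "x \<noteq> z" "y \<noteq> z"
    "apply_bij g x = x" "apply_bij g y = y" "apply_bij g z = z"
  show "g = 0"
    by (rule three_fixed_of_base[OF origin_P None_P _ _ g]) (use base_three_fixed in auto)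
qed

lemma a_U: "a \<in> carrier U" "a \<noteq> \<one>" "a \<otimes> a = \<one>"
proof -
  show a: "a \<in> carrier U" using inv_a by (simp add: involution_def)
  show "a \<noteq> \<one>" using special_a by (simp add: special_def)
  have "ord a = 2" using inv_a by (simp add: involution_def)
  then have "a [^] (2::nat) = \<one>" using pow_ord_eq_1[OF a] by simp
  then show "a \<otimes> a = \<one>" using a by (simp add: numeral_2_eq_2)
qed

lemma translation_in: "b \<in> carrier U \<Longrightarrow> translation U b \<in> RG None"
  by simp

lemma translation_permutes: "b \<in> carrier U \<Longrightarrow> translation U b permutes P"
  using RG_permutes[OF None_P translation_in] .

lemma translation_one: "translation U \<one> = id"
  by (rule ext) (simp add: translation_def split: option.split)

lemma translation_involution:
  "b \<in> carrier U \<Longrightarrow> b \<otimes> b = \<one> \<Longrightarrow> translation U b \<circ> translation U b = id"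
  by (rule ext) (auto simp: translation_def m_assoc split: option.split)

lemma tau: "\<tau> permutes P" "\<tau> origin = None" "\<tau> None = origin"
  using swaps by (simp_all add: swaps_zero_infinity_def Sym_simps)

text \<open>\<open>s\<close> is the translation by \<open>a\<close>, and \<open>t\<close> is the
  conjugate under \<tau> of the translation by the preimage \<open>b\<close> of \<open>a\<close>.
  Both reach \<open>Some a\<close>.\<close>

lemma special_invols:
  obtains s t where "s \<in> invols_at None" "t \<in> invols_at origin"
    "apply_bij s origin = Some a" "apply_bij t None = Some a"
proof -
  let ?i = "inv_into UNIV \<tau>"
  have bij: "bij \<tau>" using tau(1) by (rule permutes_bij)
  have i: "?i (\<tau> x) = x" "\<tau> (?i x) = x" for x
    using tau(1) by (simp_all add: permutes_inverses)
  have "?i (Some a) \<in> P" using permutes_inv[OF tau(1)] a_U by (simp add: permutes_in_image Some_P)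
  moreover have "?i (Some a) \<noteq> None" "?i (Some a) \<noteq> origin"
    using i(2)[of "Some a"] tau a_U by (metis option.inject, metis option.distinct(1))
  ultimately obtain b where b: "?i (Some a) = Some b" "b \<in> carrier U" "b \<noteq> \<one>"
    by (auto simp: points_def)
  have "inv a = a" using a_U by (simp add: inv_equality)
  \<comment> \<open>Since \<open>a\<close> is its own inverse, specialness says exactly that
    \<open>b\<close> is its own inverse; this makes \<open>t\<close> an involution.\<close>
  then have "inv b = b" using special_a b tau(1) by (simp add: special_def inv_Sym)
  then have bb: "b \<otimes> b = \<one>" using b r_inv by metis
  define s where "s = Abs_bij (translation U a)"
  define t where "t = - Abs_bij \<tau> + Abs_bij (translation U b) + Abs_bij \<tau>"
  have abs: "apply_bij (Abs_bij (translation U c)) = translation U c" if "c \<in> carrier U" for c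
    by (rule apply_Abs_bij[OF translation_permutes[OF that]])
  have s: "apply_bij s = translation U a" using abs a_U by (simp add: s_def)
  have t: "apply_bij t = \<tau> \<circ> translation U b \<circ> ?i"
    using abs[OF b(2)] apply_Abs_bij[OF tau(1)]
    by (simp add: t_def rep_eqs o_assoc del: apply_bij_simps)
  have s_zero: "apply_bij s origin = Some a" using a_U by (simp add: s translation_def)
  have t_None: "apply_bij t None = Some a"
  proof -
    have "?i None = origin" using i(1)[of origin] tau by simp
    moreover have "\<tau> (Some b) = Some a" using i(2)[of "Some a"] b by simp
    ultimately show ?thesis using b by (simp add: t translation_def)
  qed
  have "apply_bij (s + s) = apply_bij 0"
    using translation_involution a_U by (simp add: rep_eqs s del: apply_bij_simps)
  then have ss: "s + s = 0" by (simp add: apply_bij_inject)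
  have "apply_bij (t + t) x = x" for x
  proof -
    have "translation U b (translation U b y) = y" for y
      using translation_involution[OF b(2) bb] by (metis comp_apply id_apply)
    then show ?thesis by (simp add: t i)
  qed
  then have tt: "t + t = 0" by (intro bij_eqI) (simp del: apply_bij_simps(2))
  have "s \<in> R None" using s translation_in a_U by (simp add: R_def)
  moreover have "t \<in> R origin"
    using tau(1) b by (auto simp: R_def t conjugate_Sym Sym_simps translation_one)
  moreover have "s \<noteq> 0" "t \<noteq> 0" using s_zero t_None a_U by auto
  ultimately show ?thesis using that[of s t] s_zero t_None ss tt by (simp add: invols_at_def)
qed

text \<open>Fixed choices, needed as arguments when \<open>zassenhaus_special\<close> is
  instantiated.\<close>

definition s where "s = (SOME s. s \<in> invols_at None \<and> apply_bij s origin = Some a)"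
definition t where "t = (SOME t. t \<in> invols_at origin \<and> apply_bij t None = Some a)"

lemma st: "s \<in> invols_at None" "apply_bij s origin = Some a" "t \<in> invols_at origin" "apply_bij t None = Some a"
proof -
  obtain s' t' where st: "s' \<in> invols_at None" "t' \<in> invols_at origin"
    "apply_bij s' origin = Some a" "apply_bij t' None = Some a" by (rule special_invols)
  show "s \<in> invols_at None" "apply_bij s origin = Some a"
    using someI[of "\<lambda>s. s \<in> invols_at None \<and> apply_bij s origin = Some a" s'] st by (simp_all add: s_def)
  show "t \<in> invols_at origin" "apply_bij t None = Some a"
    using someI[of "\<lambda>t. t \<in> invols_at origin \<and> apply_bij t None = Some a" t'] st by (simp_all add: t_def)
qed

lemma stab2_nontrivial: "stab2 origin None \<noteq> {0}"
proof
  assume triv: "stab2 origin None = {0}"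
  have "sharply_2_transitive_on L P"
    unfolding sharply_2_transitive_on_def
  proof (intro ballI impI)
    fix x y x' y' assume xy: "x \<in> P" "y \<in> P" "x' \<in> P" "y' \<in> P" "x \<noteq> y \<and> x' \<noteq> y'"
    then have "\<exists>!g. g \<in> G \<and> apply_bij g x = x' \<and> apply_bij g y = y'"
      using sharply_two_transitive[OF origin_P None_P _ triv, of x y x' y'] by simp
    then obtain g where g: "g \<in> G" "apply_bij g x = x'" "apply_bij g y = y'"
      "\<And>g'. g' \<in> G \<Longrightarrow> apply_bij g' x = x' \<Longrightarrow> apply_bij g' y = y' \<Longrightarrow> g' = g" by blast
    show "\<exists>!h. h \<in> L \<and> h x = x' \<and> h y = y'"
    proof (rule ex1I[of _ "apply_bij g"])
      show "apply_bij g \<in> L \<and> apply_bij g x = x' \<and> apply_bij g y = y'" using g(1-3) by (simp add: G_def)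
      fix h assume h: "h \<in> L \<and> h x = x' \<and> h y = y'"
      then have hA: "apply_bij (Abs_bij h) = h" using apply_Abs_bij L_permutes by blast
      then have "Abs_bij h = g" using g(4)[of "Abs_bij h"] h by (simp add: G_def)
      then show "h = apply_bij g" using hA by simp
    qed
  qed
  then show False using zass by (simp add: zassenhaus_M_def proper_M_def)
qed

sublocale zassenhaus_special "\<lambda>x p. apply_bij p x" P G R origin None "Some a" s t
proof
  show "invols \<noteq> {}" using invols_at_invols st None_P by blast
qed (use st stab2_nontrivial origin_P None_P a_U in \<open>auto simp: Some_P\<close>)

section \<open>The field structure\<close>

abbreviation "H \<equiv> stab2 origin None"

definition image_of :: "'a option bijection \<Rightarrow> 'a \<Rightarrow> 'a"
  where "image_of h b = the (apply_bij h (Some b))"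

text \<open>For nonzero \<open>b\<close> the choice is unique by \<open>H_unique\<close>: the
  stabilizer is regular on the nonzero elements, and \<open>a\<close> becomes the unit of the
  field.\<close>

definition hua :: "'a \<Rightarrow> 'a option bijection"
  where "hua b = (SOME h. h \<in> H \<and> apply_bij h (Some a) = Some b)"

definition tr :: "'a \<Rightarrow> 'a option bijection"
  where "tr b = Abs_bij (translation U b)"

lemma apply_tr: "b \<in> carrier U \<Longrightarrow> apply_bij (tr b) = translation U b"
  unfolding tr_def by (rule apply_Abs_bij[OF translation_permutes])

lemma tr_R: "b \<in> carrier U \<Longrightarrow> tr b \<in> R None"
  using translation_in apply_tr by (simp add: R_def)

lemma apply_tr_Some: "b \<in> carrier U \<Longrightarrow> c \<in> carrier U \<Longrightarrow> apply_bij (tr b) (Some c) = Some (c \<otimes> b)"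
  by (simp add: apply_tr translation_def)

lemma H_G: "h \<in> H \<Longrightarrow> h \<in> G" and H_origin: "h \<in> H \<Longrightarrow> apply_bij h origin = origin"
  and H_None: "h \<in> H \<Longrightarrow> apply_bij h None = None"
  by (simp_all add: stab2_def)

lemma G_outside: "g \<in> G \<Longrightarrow> x \<notin> P \<Longrightarrow> apply_bij g x = x"
  using permutes_not_in[OF L_permutes] by (simp add: G_def)

lemma H_add: "h \<in> H \<Longrightarrow> h' \<in> H \<Longrightarrow> h + h' \<in> H" and H_minus: "h \<in> H \<Longrightarrow> - h \<in> H"
  using G_add G_minus by (simp_all add: stab2_def)

lemma apply_H:
  assumes "h \<in> H" "b \<in> carrier U"
  shows "apply_bij h (Some b) = Some (image_of h b)" "image_of h b \<in> carrier U"
proof -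
  have "apply_bij h (Some b) \<in> P" using act_closed H_G assms by (simp add: Some_P)
  moreover have "apply_bij h (Some b) \<noteq> None" using act_inj[where x = "Some b" and g = h and y = None] H_None assms by simp
  ultimately show "apply_bij h (Some b) = Some (image_of h b)" "image_of h b \<in> carrier U"
    by (auto simp: image_of_def points_def)
qed

lemma image_of_one: "h \<in> H \<Longrightarrow> image_of h \<one> = \<one>"
  using H_origin by (simp add: image_of_def)

lemma image_of_eq_one: "h \<in> H \<Longrightarrow> b \<in> carrier U \<Longrightarrow> image_of h b = \<one> \<longleftrightarrow> b = \<one>"
  using apply_H[of h b] H_origin[of h] act_inj[where x = "Some b" and g = h and y = origin] by auto

lemma image_of_add:
  "h \<in> H \<Longrightarrow> h' \<in> H \<Longrightarrow> b \<in> carrier U \<Longrightarrow> image_of (h + h') b = image_of h' (image_of h b)"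
  using apply_H[of h b] by (simp add: image_of_def)

lemma image_of_0: "image_of 0 b = b"
  by (simp add: image_of_def)

lemma image_of_minus: "h \<in> H \<Longrightarrow> b \<in> carrier U \<Longrightarrow> image_of h (image_of (- h) b) = b"
  using image_of_add[OF H_minus, of h h b] by (simp add: image_of_0)

text \<open>Conjugation by \<open>h\<close> permutes the translations, so \<open>h\<close> acts on \<open>U\<close> by automorphisms.\<close>

lemma image_of_mult:
  assumes h: "h \<in> H" and b: "b \<in> carrier U" and c: "c \<in> carrier U"
  shows "image_of h (b \<otimes> c) = image_of h b \<otimes> image_of h c"
proof -
  have "- h + tr c + h \<in> R None"
    using R_conj[OF None_P H_G[OF h] tr_R[OF c]] H_None[OF h] by simp
  then have "apply_bij (- h + tr c + h) \<in> translation U ` carrier U" by (simp add: R_def)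
  then obtain d where d: "d \<in> carrier U" "apply_bij (- h + tr c + h) = translation U d" by auto
  have "apply_bij (- h + tr c + h) origin = Some (image_of h c)"
    using H_origin[OF H_minus[OF h]] apply_tr_Some[OF c one_closed] c apply_H[OF h c] by simp
  then have dc: "d = image_of h c" using d by (simp add: translation_def)
  have "Some (image_of h (b \<otimes> c)) = apply_bij h (apply_bij (tr c) (Some b))"
    using apply_H[of h "b \<otimes> c"] h b c apply_tr_Some by simp
  also have "\<dots> = apply_bij (- h + tr c + h) (apply_bij h (Some b))"
    by simp
  also have "\<dots> = Some (image_of h b \<otimes> d)"
    using d apply_H[OF h b] by (simp add: translation_def del: apply_bij_simps)
  finally show ?thesis using dc by simp
qed

lemma hua:
  assumes "b \<in> carrier U" "b \<noteq> \<one>"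
  shows "hua b \<in> H" "image_of (hua b) a = b"
proof -
  obtain h where "h \<in> H" "apply_bij h (Some a) = Some b"
    using stab2_transitive[of "Some b"] assms by (auto simp: Some_P)
  then have "h \<in> H \<and> apply_bij h (Some a) = Some b" by simp
  then have *: "hua b \<in> H \<and> apply_bij (hua b) (Some a) = Some b"
    unfolding hua_def by (rule someI)
  then show "hua b \<in> H" by simp
  show "image_of (hua b) a = b" using * by (simp add: image_of_def)
qed

lemma H_unique:
  assumes "h \<in> H" "h' \<in> H" "image_of h a = image_of h' a"
  shows "h = h'"
proof -
  have eq: "apply_bij h (Some a) = apply_bij h' (Some a)" using assms apply_H a_U by metis
  have "h - h' \<in> G" using G_diff H_G assms by blast
  moreover have "apply_bij (h - h') origin = origin" "apply_bij (h - h') None = None"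
    "apply_bij (h - h') (Some a) = Some a"
    using H_origin H_None assms eq by simp_all
  ultimately have "h - h' = 0"
    using three_fixed[of "h - h'" origin None "Some a"] a_U None_P by (simp add: Some_P)
  then show ?thesis by simp
qed

text \<open>Both sides belong to \<open>H\<close> and take \<open>a\<close> to the same element.
  This rule becomes associativity of the product.\<close>

lemma hua_image_of:
  assumes "h \<in> H" "b \<in> carrier U" "b \<noteq> \<one>"
  shows "hua (image_of h b) = hua b + h"
proof (rule H_unique)
  have c: "image_of h b \<in> carrier U" "image_of h b \<noteq> \<one>"
    using apply_H image_of_eq_one assms by auto
  show "hua (image_of h b) \<in> H" "hua b + h \<in> H" using hua c assms H_add by blast+
  show "image_of (hua (image_of h b)) a = image_of (hua b + h) a"
    using hua c assms image_of_add a_U by simp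
qed

lemma square_U: "b \<in> carrier U \<Longrightarrow> b \<otimes> b = \<one>"
  and commute_U: "b \<in> carrier U \<Longrightarrow> c \<in> carrier U \<Longrightarrow> b \<otimes> c = c \<otimes> b"
proof -
  show "b \<otimes> b = \<one>" if b: "b \<in> carrier U"
  proof -
    have "tr b + tr b = 0" using root_group_exponent_2[OF None_P tr_R[OF b]] .
    then have "apply_bij (tr b + tr b) origin = origin" by (simp del: apply_bij_simps(2))
    then show ?thesis using apply_tr_Some b by simp
  qed
  show "b \<otimes> c = c \<otimes> b" if bc: "b \<in> carrier U" "c \<in> carrier U"
  proof -
    have "tr b + tr c = tr c + tr b" using root_group_commute[OF None_P] tr_R bc by blast
    then have "apply_bij (tr b + tr c) origin = apply_bij (tr c + tr b) origin" by simp
    then show ?thesis using apply_tr_Some bc by simp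
  qed
qed

text \<open>The element \<open>\<one>\<close> is the zero of the field. It is treated apart because
  no element of \<open>H\<close> takes \<open>a\<close> to it.\<close>

definition field_mult :: "'a \<Rightarrow> 'a \<Rightarrow> 'a"
  where "field_mult b c = (if c = \<one> then \<one> else image_of (hua c) b)"

definition F :: "'a ring"
  where "F = \<lparr>carrier = carrier U, monoid.mult = field_mult, one = a,
    ring.zero = \<one>, ring.add = (\<otimes>)\<rparr>"

lemma F_simps [simp]:
  "carrier F = carrier U" "b \<otimes>\<^bsub>F\<^esub> c = field_mult b c" "\<one>\<^bsub>F\<^esub> = a" "\<zero>\<^bsub>F\<^esub> = \<one>" "b \<oplus>\<^bsub>F\<^esub> c = b \<otimes> c"
  by (simp_all add: F_def)

lemma field_mult_closed: "b \<in> carrier U \<Longrightarrow> c \<in> carrier U \<Longrightarrow> field_mult b c \<in> carrier U"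
  using apply_H hua by (simp add: field_mult_def)

lemma field_mult_one: "c \<in> carrier U \<Longrightarrow> field_mult \<one> c = \<one>"
  using image_of_one hua by (simp add: field_mult_def)

lemma field_mult_one_right: "field_mult b \<one> = \<one>"
  by (simp add: field_mult_def)

lemma field_mult_commute:
  assumes "b \<in> carrier U" "c \<in> carrier U"
  shows "field_mult b c = field_mult c b"
proof (cases "b = \<one> \<or> c = \<one>")
  case True
  then show ?thesis using field_mult_one field_mult_one_right assms by auto
next
  case False
  then have h: "hua b \<in> H" "hua c \<in> H" "image_of (hua b) a = b" "image_of (hua c) a = c"
    using hua assms by auto
  have "hua b + hua c = hua c + hua b" using stab2_commute[of origin None] origin_P None_P h by simp
  then have "image_of (hua c) (image_of (hua b) a) = image_of (hua b) (image_of (hua c) a)"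
    using image_of_add h a_U by metis
  then show ?thesis using False h by (simp add: field_mult_def)
qed

lemma field_mult_assoc:
  assumes "b \<in> carrier U" "c \<in> carrier U" "d \<in> carrier U"
  shows "field_mult (field_mult b c) d = field_mult b (field_mult c d)"
proof (cases "c = \<one> \<or> d = \<one>")
  case True
  then show ?thesis using field_mult_one field_mult_one_right assms by auto
next
  case False
  then have h: "hua c \<in> H" "hua d \<in> H" using hua assms by auto
  have "image_of (hua d) c \<noteq> \<one>" using image_of_eq_one h False assms by simp
  then show ?thesis using False h hua_image_of image_of_add assms by (simp add: field_mult_def)
qed

text \<open>Distributivity is \<open>image_of_mult\<close>, commutativity of the product is that of
  \<open>H\<close>, and the inverse of \<open>b\<close> is the image of \<open>a\<close> under
  \<open>- hua b\<close>.\<close>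

lemma field_F: "field F"
proof (rule cring.cring_fieldI)
  show cr: "cring F"
  proof (rule cringI)
    show "abelian_group F"
    proof (rule abelian_groupI)
      fix b assume "b \<in> carrier F"
      then show "\<exists>c\<in>carrier F. c \<oplus>\<^bsub>F\<^esub> b = \<zero>\<^bsub>F\<^esub>" using square_U by auto
    qed (auto simp: m_assoc intro: commute_U)
    show "comm_monoid F"
    proof (rule comm_monoidI)
      fix b assume b: "b \<in> carrier F"
      show "\<one>\<^bsub>F\<^esub> \<otimes>\<^bsub>F\<^esub> b = b"
        using hua[of b] b image_of_one a_U by (cases "b = \<one>") (simp_all add: field_mult_def)
    qed (use field_mult_closed field_mult_commute field_mult_assoc a_U in auto)
    fix b c d assume "b \<in> carrier F" "c \<in> carrier F" "d \<in> carrier F"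
    then show "(b \<oplus>\<^bsub>F\<^esub> c) \<otimes>\<^bsub>F\<^esub> d = b \<otimes>\<^bsub>F\<^esub> d \<oplus>\<^bsub>F\<^esub> c \<otimes>\<^bsub>F\<^esub> d"
      using image_of_mult hua by (simp add: field_mult_def)
  qed
  interpret cring F by (rule cr)
  show "Units F = carrier F - {\<zero>\<^bsub>F\<^esub>}"
  proof
    show "Units F \<subseteq> carrier F - {\<zero>\<^bsub>F\<^esub>}"
      using field_mult_one a_U by (auto simp: Units_def)
    show "carrier F - {\<zero>\<^bsub>F\<^esub>} \<subseteq> Units F"
    proof
      fix b assume b: "b \<in> carrier F - {\<zero>\<^bsub>F\<^esub>}"
      then have h: "hua b \<in> H" "image_of (hua b) a = b" using hua by auto
      let ?c = "image_of (- hua b) a"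
      have c: "?c \<in> carrier U" using apply_H H_minus h a_U by blast
      have 1: "field_mult ?c b = a" using b h image_of_minus a_U by (simp add: field_mult_def)
      then have "field_mult b ?c = a" using field_mult_commute[of b ?c] b c by simp
      with 1 show "b \<in> Units F" using b c by (auto simp: Units_def intro: bexI[of _ ?c])
    qed
  qed
qed

sublocale F: field F
  by (rule field_F)

lemma F_inv:
  assumes "b \<in> carrier U" "b \<noteq> \<one>"
  shows "inv\<^bsub>F\<^esub> b = image_of (- hua b) a"
proof (rule F.comm_inv_char)
  have h: "hua b \<in> H" "image_of (hua b) a = b" using hua assms by auto
  show c: "image_of (- hua b) a \<in> carrier F" using apply_H H_minus h a_U by simp
  have "field_mult (image_of (- hua b) a) b = a"
    using assms h image_of_minus a_U by (simp add: field_mult_def)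
  then show "b \<otimes>\<^bsub>F\<^esub> image_of (- hua b) a = \<one>\<^bsub>F\<^esub>"
    using field_mult_commute c assms by (simp add: image_of_0)
qed (use assms in simp)

lemma F_uminus: "b \<in> carrier U \<Longrightarrow> \<ominus>\<^bsub>F\<^esub> b = b"
  by (rule F.minus_equality) (simp_all add: square_U)

lemma char_F: "b \<in> carrier F \<Longrightarrow> b \<oplus>\<^bsub>F\<^esub> b = \<zero>\<^bsub>F\<^esub>"
  by (simp add: square_U)

lemma points_F: "points (add_monoid F) = P"
  by (simp add: points_def)

lemma translation_F: "translation (add_monoid F) = translation U"
  by (intro ext) (simp add: translation_def split: option.split)

section \<open>Identification with the projective line over F\<close>

text \<open>The swap fixing \<open>a\<close> inverts \<open>hua b\<close>, so it takes
  \<open>b\<close> to the image of \<open>a\<close> under \<open>- hua b\<close>, the inverse of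
  \<open>b\<close>. The sign in \<open>field_tau\<close> disappears in characteristic two.\<close>

lemma field_tau_swap:
  obtains \<mu> where "\<mu> \<in> G" "apply_bij \<mu> = field_tau F"
proof -
  obtain \<mu> where \<mu>: "\<mu> \<in> swaps origin None" "apply_bij \<mu> (Some a) = Some a" by (rule swap_fixing_e)
  then have G: "\<mu> \<in> G" "apply_bij \<mu> origin = None" "apply_bij \<mu> None = origin" by (auto simp: swaps_def)
  have "apply_bij \<mu> p = field_tau F p" for p
  proof -
    consider "p = None" | "p = origin" | b where "p = Some b" "b \<in> carrier U" "b \<noteq> \<one>"
      | b where "p = Some b" "b \<notin> carrier U" by (cases p) auto
    then show ?thesis
    proof cases
      case 3
      then have h: "hua b \<in> H" "image_of (hua b) a = b" using hua by auto
      have "\<mu> + hua b + \<mu> = - hua b" "\<mu> + \<mu> = 0"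
        using swap_inverts[of origin None \<mu> "hua b"] \<mu> h origin_P None_P by auto
      then have "\<mu> + - hua b = hua b + \<mu>" by (metis add.assoc add_0)
      then have "apply_bij (hua b + \<mu>) (Some a) = apply_bij (\<mu> + - hua b) (Some a)" by simp
      then have "apply_bij \<mu> (Some b) = apply_bij (- hua b) (Some a)"
        using apply_H[OF h(1) a_U(1)] h \<mu> by simp
      then have "apply_bij \<mu> (Some b) = Some (inv\<^bsub>F\<^esub> b)"
        using apply_H[OF H_minus[OF h(1)] a_U(1)] F_inv 3 by simp
      moreover have "inv\<^bsub>F\<^esub> b \<in> carrier U" using F_inv apply_H[OF H_minus[OF h(1)] a_U(1)] 3 by simp
      ultimately show ?thesis using 3 F_uminus by (simp add: field_tau_def)
    next
      case 4
      then have "p \<notin> P" by (simp add: Some_P)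
      then have "apply_bij \<mu> p = p" using G_outside G(1) by blast
      then show ?thesis using 4 one_closed by (auto simp: field_tau_def)
    qed (use G in \<open>simp_all add: field_tau_def\<close>)
  qed
  then show ?thesis using that G by blast
qed

lemma root_group_F_simps:
  "root_group (add_monoid F) (field_tau F) None = translation U ` carrier U"
  "root_group (add_monoid F) (field_tau F) (Some b) =
    conjugate (Sym P) (translation U ` carrier U) (translation U b \<circ> field_tau F)"
  unfolding root_group.simps translation_F points_F by (simp_all add: Sym_simps)

lemma RG_conjugate: "x \<in> P \<Longrightarrow> g \<in> L \<Longrightarrow> conjugate (Sym P) (RG x) g = RG (g x)"
  using moufang by (simp add: moufang_set_def)

text \<open>Although \<open>field_tau F\<close> may differ from \<tau>, it belongs to the little
  projective group, so the Moufang axiom gives the same conjugates of the root group at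
  infinity.\<close>

lemma root_group_F:
  assumes "p \<in> P"
  shows "root_group (add_monoid F) (field_tau F) p = RG p"
proof (cases p)
  case None
  show ?thesis unfolding None root_group_F_simps by simp
next
  case (Some b)
  then have b: "b \<in> carrier U" using assms by (simp add: Some_P)
  obtain \<mu> where \<mu>: "\<mu> \<in> G" "apply_bij \<mu> = field_tau F" by (rule field_tau_swap)
  let ?g = "translation U b \<circ> field_tau F"
  have "translation U b \<in> L" using RG_L[OF None_P translation_in[OF b]] .
  then have "?g \<in> L" using subgroup_Sym(2)[OF L_subgroup] \<mu> by (simp add: G_def)
  then have 1: "conjugate (Sym P) (RG None) ?g = RG (?g None)"
    by (rule RG_conjugate[OF None_P])
  have 2: "?g None = Some b" using b by (simp add: field_tau_def translation_def)
  show ?thesis using 1 unfolding 2 root_group.simps(1) Some root_group_F_simps .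
qed

text \<open>The root groups agree as sets of permutations, so the identity map is an
  isomorphism.\<close>

lemma moufang_isomorphic_F:
  "moufang_isomorphic P RG (points (add_monoid F)) (root_group (add_monoid F) (field_tau F))"
proof -
  have "transport_perm P P id h = h" if "h permutes P" for h
    using permutes_not_in[OF that] inv_into_f_f[of id P] by (auto simp: transport_perm_def fun_eq_iff)
  then have "transport_perm P P id ` RG p = RG p" if "p \<in> P" for p
    using RG_permutes[OF that] by force
  then have "moufang_iso P RG P (root_group (add_monoid F) (field_tau F)) id"
    using root_group_F by (simp add: moufang_iso_def)
  then show ?thesis unfolding moufang_isomorphic_def points_F by blast
qed

lemma moebius_hom: "F.moebius \<in> hom (SL2 F) (Sym P)"
  using F.moebius_hom unfolding points_F .

text \<open>One inclusion holds because the root groups are conjugates of translations by matrices.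
  For the other, two-transitivity of \<open>G\<close> reduces to maps fixing zero and
  infinity.\<close>

lemma moebius_image: "F.moebius ` carrier (SL2 F) = L"
proof -
  let ?M = "F.moebius ` carrier (SL2 F)"
  have "group_hom (SL2 F) (Sym P) F.moebius"
    using F.group_SL2 group_Sym moebius_hom by (simp add: group_hom_def group_hom_axioms_def)
  then have M: "subgroup ?M (Sym P)" by (rule group_hom.img_is_subgroup)
  have tr_M: "translation U b \<in> ?M" if "b \<in> carrier U" for b
  proof -
    have b: "b \<in> carrier F" using that by simp
    then have "F.moebius (\<one>\<^bsub>F\<^esub>, \<zero>\<^bsub>F\<^esub>, b, \<one>\<^bsub>F\<^esub>) = translation U b"
      using F.moebius_translation(2) unfolding translation_F by blast
    then show ?thesis using F.moebius_translation(1)[OF b] by (metis image_eqI)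
  qed
  have tau_M: "field_tau F \<in> ?M" using F.moebius_field_tau by (metis image_eqI)
  have "RG p \<subseteq> ?M" if p: "p \<in> P" for p
  proof (cases p)
    case None
    then show ?thesis using tr_M by auto
  next
    case (Some b)
    then have b: "b \<in> carrier U" using p by (simp add: Some_P)
    let ?g = "translation U b \<circ> field_tau F"
    have g: "?g \<in> ?M" using subgroup_Sym(2)[OF M tau_M tr_M[OF b]] .
    then have "?g permutes P" using subgroup.mem_carrier[OF M] by (simp add: Sym_simps)
    moreover have "RG p = conjugate (Sym P) (translation U ` carrier U) ?g"
      using root_group_F[OF p] unfolding Some root_group_F_simps by (rule sym)
    ultimately have "RG p = (\<lambda>h. ?g \<circ> h \<circ> inv_into UNIV ?g) ` translation U ` carrier U"
      by (simp only: conjugate_Sym)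
    moreover have "?g \<circ> h \<circ> inv_into UNIV ?g \<in> ?M" if "h \<in> ?M" for h
      using subgroup_Sym(2,3)[OF M] g that by blast
    ultimately show ?thesis using tr_M by auto
  qed
  then have LM: "L \<subseteq> ?M"
    unfolding little_proj_def by (intro group.generate_subgroup_incl[OF group_Sym _ M]) auto
  moreover have "?M \<subseteq> L"
  proof
    fix f assume f: "f \<in> ?M"
    then have fP: "f permutes P" using subgroup.mem_carrier[OF M] by (simp add: Sym_simps)
    have "f None \<in> P" "f origin \<in> P" using fP None_P origin_P by (simp_all add: permutes_in_image)
    moreover have "f None \<noteq> f origin" using permutes_inj[OF fP] by (auto dest: injD)
    ultimately obtain g where g: "g \<in> G" "apply_bij g None = f None" "apply_bij g origin = f origin"
      using two_transitive[OF None_P origin_P] by auto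
    have gL: "apply_bij g \<in> L" using g by (simp add: G_def)
    let ?i = "inv_into UNIV (apply_bij g)"
    have i: "?i (apply_bij g x) = x" "apply_bij g (?i x) = x" for x
      using L_permutes[OF gL] by (simp_all add: permutes_inverses)
    have "?i \<circ> f \<in> ?M" using subgroup_Sym(2)[OF M f subgroup_Sym(3)[OF M]] gL LM by blast
    then obtain N where N: "N \<in> carrier (SL2 F)" "?i \<circ> f = F.moebius N" by auto
    obtain n1 n2 n3 n4 where n: "N = (n1, n2, n3, n4)" by (cases N)
    have nU: "n1 \<in> carrier F" "n2 \<in> carrier F" "n3 \<in> carrier F" "n4 \<in> carrier F"
      using N n by (auto simp: F.SL2_carrier simp del: F_simps)
    have fix0: "F.moebius N None = None" "F.moebius N origin = origin"
      unfolding N(2)[symmetric] using g i by (metis comp_apply)+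
    then have n0: "n2 = \<zero>\<^bsub>F\<^esub>" "n3 = \<zero>\<^bsub>F\<^esub>" "n1 \<otimes>\<^bsub>F\<^esub> n4 = \<one>\<^bsub>F\<^esub>" "n4 \<noteq> \<zero>\<^bsub>F\<^esub>"
      using F.moebius_fixes_zero_infinity[of n1 n2 n3 n4] N n by auto
    \<comment> \<open>A diagonal matrix multiplies by this quotient of its entries, and
      multiplication by a nonzero \<open>?c\<close> is the action of \<open>hua ?c\<close>.\<close>
    let ?c = "n1 \<otimes>\<^bsub>F\<^esub> inv\<^bsub>F\<^esub> n4"
    have inv4: "inv\<^bsub>F\<^esub> n4 \<in> carrier F" "inv\<^bsub>F\<^esub> n4 \<noteq> \<zero>\<^bsub>F\<^esub>"
      using F.inv_closed_nonzero F.inv_nonzero nU n0 by blast+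
    have "n1 \<noteq> \<zero>\<^bsub>F\<^esub>" using n0(3) nU F.l_null F.zero_not_one by metis
    then have c: "?c \<in> carrier F" "?c \<noteq> \<zero>\<^bsub>F\<^esub>"
      using F.integral nU inv4 F.m_closed by blast+
    then have h: "hua ?c \<in> H" using hua by simp
    have "F.moebius N x = apply_bij (hua ?c) x" for x
    proof -
      consider "x \<notin> P" | "x = None" | y where "x = Some y" "y \<in> carrier F"
        by (auto simp: points_def)
      then show ?thesis
      proof cases
        case 1
        then have "apply_bij (hua ?c) x = x" using G_outside H_G[OF h] by blast
        then show ?thesis using 1 unfolding F.moebius_def points_F by simp
      next
        case 2
        then show ?thesis using fix0 H_None[OF h] by simp
      next
        case 3
        have "F.moebius N x = F.proj_point (y \<otimes>\<^bsub>F\<^esub> n1 \<oplus>\<^bsub>F\<^esub> n3, y \<otimes>\<^bsub>F\<^esub> n2 \<oplus>\<^bsub>F\<^esub> n4)"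
          using F.moebius_apply(2)[OF nU 3(2)] n 3 by simp
        also have "\<dots> = F.proj_point (y \<otimes>\<^bsub>F\<^esub> n1, n4)"
          using nU 3 n0(1,2) by (simp del: F_simps)
        also have "\<dots> = Some (y \<otimes>\<^bsub>F\<^esub> n1 \<otimes>\<^bsub>F\<^esub> inv\<^bsub>F\<^esub> n4)"
          using n0(4) by (simp add: F.proj_point_def del: F_simps)
        also have "\<dots> = Some (y \<otimes>\<^bsub>F\<^esub> ?c)" using F.m_assoc 3 nU inv4 by (simp del: F_simps)
        also have "\<dots> = apply_bij (hua ?c) x"
          using 3 c apply_H[OF h, of y] by (simp add: field_mult_def)
        finally show ?thesis .
      qed
    qed
    then have "F.moebius N = apply_bij (hua ?c)" by blast
    then have "f = apply_bij g \<circ> apply_bij (hua ?c)" using N(2) i by (metis comp_assoc fun.map_comp comp_apply ext)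
    then show "f \<in> L" using subgroup_Sym(2)[OF L_subgroup _ gL] H_G[OF h] by (simp add: G_def)
  qed
  ultimately show ?thesis by blast
qed

lemma little_proj_group_iso: "little_proj_group P RG \<cong> PSL2 F"
proof -
  have "F.moebius \<in> iso (SL2 F) (little_proj_group P RG)"
    using moebius_hom F.moebius_inj[OF char_F] moebius_image
    by (auto simp: iso_def hom_def bij_betw_def little_proj_group_def)
  then have "SL2 F \<cong> little_proj_group P RG" by (auto simp: is_iso_def)
  then have 1: "little_proj_group P RG \<cong> SL2 F" by (rule group.iso_sym[OF F.group_SL2])
  have 2: "PSL2 F \<cong> SL2 F" by (rule F.PSL2_iso_SL2[OF char_F])
  have "group (PSL2 F)"
  proof -
    have "group_center (SL2 F) \<lhd> SL2 F"
      using F.group_center_SL2[OF char_F] group.one_is_normal[OF F.group_SL2] by simp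
    then show ?thesis unfolding PSL2_def by (rule normal.factorgroup_is_group)
  qed
  then have "SL2 F \<cong> PSL2 F" using group.iso_sym 2 by blast
  with 1 show ?thesis by (rule iso_trans)
qed

end

theorem theorem1:
  fixes U :: "('a, 'b) monoid_scheme" and \<tau> :: "'a option \<Rightarrow> 'a option"
  assumes "group U"
    and "swaps_zero_infinity U \<tau>"
    and "finite (carrier U)"
    and "zassenhaus_M U \<tau>"
    and "even (order U)"
    and "\<exists>a. involution U a \<and> special U \<tau> a"
  shows "\<exists>(m::nat) (F :: 'a ring).
    order U = 2 ^ m \<and> field F \<and> order F = order U \<and>
    moufang_isomorphic (points U) (root_group U \<tau>)
      (points (add_monoid F)) (root_group (add_monoid F) (field_tau F)) \<and>
    little_proj_group (points U) (root_group U \<tau>) \<cong> PSL2 F"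
proof -
  obtain a where a: "involution U a" "special U \<tau> a" using assms(6) by blast
  interpret special_zassenhaus_M U \<tau> a
    using assms a by (simp add: special_zassenhaus_M_def special_zassenhaus_M_axioms_def)
  obtain m where "order U = 2 ^ m" using order_power_2[OF assms(3) square_U] by blast
  moreover have "order F = order U" by (simp add: order_def)
  ultimately show ?thesis using field_F moufang_isomorphic_F little_proj_group_iso by blast
qed

end
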